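(* Let $T\in(0,\infty)$, let $X_0,X_1$ be Banach spaces with $X_1\hookrightarrow X_0$ densely and continuously, and let $A\colon[0,T]\to\mathcal{L}(X_1,X_0)$ be strongly measurable in the strong operator topology. Let $p\in(1,\infty)$, $\kappa\in[0,p-1)$ and $q\in(p,\infty)$. Suppose that there is a constant $C_A$ such that \[\|Av\|_{L^p(0,T,w_\kappa;X_0)}\le C_A\|v\|_{\mathrm{MR}^p(0,T,w_\kappa)}\quad\text{for all } v\in \mathrm{MR}^p(0,T,w_\kappa),\] and that $A$ has maximal $L^p(0,T,w_\kappa)$-regularity. Let $B\colon[0,T]\to\mathcal{L}(X_{1-1/q,1},X_0)$ be strongly measurable in the strong operator topology and suppose that $\|B(t)\|_{\mathcal{L}(X_{1-1/q,1},X_0)}\le b(t)$ for $t\in[0,T]$, where $b\in L^q(0,T)$. Then $A+B$ has maximal $L^p(0,T,w_\kappa)$-regularity, and $M_{p,\kappa,A+B}(0,T)\le C$, where $C$ depends only on $p,q,\kappa,X_0,X_1,M_{p,\kappa,A}(0,T)$ and $\|b\|_{L^q(0,T)}$.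
   Context: For $\theta\in(0,1)$ and $r\in[1,\infty]$, $X_{\theta,r}:=(X_0,X_1)_{\theta,r}$ denotes the real interpolation space; since $X_1\hookrightarrow X_{1-1/q,1}$, $B(t)$ is regarded as an element of $\mathcal{L}(X_1,X_0)$ and $(A+B)(t)=A(t)+B(t)$. For $\mu\ge0$, $w_\mu(t)=|t|^\mu$ (the weight is never shifted, also on subintervals). $L^p(a,b,w_\kappa;X)$ is the space of strongly measurable $f\colon(a,b)\to X$ with $\|f\|^p=\int_a^b t^\kappa\|f(t)\|_X^p\,dt<\infty$; $W^{1,p}(a,b,w_\kappa;X)$ is defined analogously. $\mathrm{MR}^p(a,b,w_\kappa):=L^p(a,b,w_\kappa;X_1)\cap W^{1,p}(a,b,w_\kappa;X_0)$ with norm $\max\{\|u\|_{L^p(a,b,w_\kappa;X_1)},\|u\|_{W^{1,p}(a,b,w_\kappa;X_0)}\}$. For an operator family $\mathcal{A}\colon[0,T]\to\mathcal{L}(X_1,X_0)$, $0\le a<b\le T$, $f\in L^1(a,b;X_0)$ and $u_a\in X_0$, a strong solution of $u'+\mathcal{A}u=f$ on $(a,b)$, $u(a)=u_a$, is a function $u\in L^1(a,b;X_1)\cap W^{1,1}(a,b;X_0)$ with $\mathcal{A}u\in L^1(a,b;X_0)$, $u(a)=u_a$ (using the continuous version) and $u'(t)+\mathcal{A}(t)u(t)=f(t)$ for a.e. $t$. $\mathcal{A}$ has maximal $L^p(a,b,w_\kappa)$-regularity if for every $f\in L^p(a,b,w_\kappa;X_0)$ there exists a unique strong solution $u\in\mathrm{MR}^p(a,b,w_\kappa)$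 of $u'+\mathcal{A}u=f$ on $(a,b)$ with $u(a)=0$, and there is a constant $C$ independent of $f$ such that for every $\tau\in(a,b]$ and every strong solution $v\in\mathrm{MR}^p(a,\tau,w_\kappa)$ of $v'+\mathcal{A}v=f$ on $(a,\tau)$ with $v(a)=0$ one has $\|v\|_{\mathrm{MR}^p(a,\tau,w_\kappa)}\le C\|f\|_{L^p(a,\tau,w_\kappa;X_0)}$. The infimum of such $C$ is denoted $M_{p,\kappa,\mathcal{A}}(a,b)$. *)

theory Defs
  imports "HOL-Analysis.Analysis"
begin

text \<open>Setting: X0 is the type 'b, X1 is the type 'a, and the continuous dense
  embedding X1 into X0 is a bounded linear injective map j with dense range.\<close>

definition strongly_measurable_on :: "real set \<Rightarrow> (real \<Rightarrow> 'x::real_normed_vector) \<Rightarrow> bool" where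
  "strongly_measurable_on S f \<longleftrightarrow>
     (\<exists>s. (\<forall>n. simple_function (lebesgue_on S) (s n)) \<and>
          (AE t in lebesgue_on S. (\<lambda>n. s n t) \<longlonglongrightarrow> f t))"

definition wLp_integral :: "real \<Rightarrow> real \<Rightarrow> real \<Rightarrow> real \<Rightarrow> (real \<Rightarrow> 'x::real_normed_vector) \<Rightarrow> ennreal" where
  "wLp_integral a b \<kappa> p f = (\<integral>\<^sup>+ t. ennreal (\<bar>t\<bar> powr \<kappa> * norm (f t) powr p) * indicator {a<..<b} t \<partial>lebesgue)"

definition wLp :: "real \<Rightarrow> real \<Rightarrow> real \<Rightarrow> real \<Rightarrow> (real \<Rightarrow> 'x::real_normed_vector) \<Rightarrow> bool" where
  "wLp a b \<kappa> p f \<longleftrightarrow> strongly_measurable_on {a<..<b} f \<and> wLp_integral a b \<kappa> p f < \<infinity>"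

definition wLp_norm :: "real \<Rightarrow> real \<Rightarrow> real \<Rightarrow> real \<Rightarrow> (real \<Rightarrow> 'x::real_normed_vector) \<Rightarrow> real" where
  "wLp_norm a b \<kappa> p f = enn2real (wLp_integral a b \<kappa> p f) powr (1 / p)"

definition smooth_test_fun :: "real \<Rightarrow> real \<Rightarrow> (real \<Rightarrow> real) \<Rightarrow> bool" where
  "smooth_test_fun a b \<phi> \<longleftrightarrow>
     (\<forall>k t. (deriv ^^ k) \<phi> differentiable (at t)) \<and>
     (\<exists>c d. a < c \<and> d < b \<and> (\<forall>t. t \<notin> {c..d} \<longrightarrow> \<phi> t = 0))"

definition loc_integrable :: "real \<Rightarrow> real \<Rightarrow> (real \<Rightarrow> 'x::real_normed_vector) \<Rightarrow> bool" where
  "loc_integrable a b f \<longleftrightarrow> strongly_measurable_on {a<..<b} f \<and>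
     (\<forall>c d. a < c \<and> d < b \<longrightarrow> (\<integral>\<^sup>+ t. ennreal (norm (f t)) * indicator {c..d} t \<partial>lebesgue) < \<infinity>)"

text \<open>Weak derivative on (a,b), tested against smooth compactly supported scalar test
  functions; the vector-valued identity is tested with all continuous linear functionals
  (equivalent to the Bochner-integral identity by Hahn-Banach; this avoids the
  separability restriction of the library's Bochner integral).\<close>
definition weak_deriv_on :: "real \<Rightarrow> real \<Rightarrow> (real \<Rightarrow> 'x::real_normed_vector) \<Rightarrow> (real \<Rightarrow> 'x) \<Rightarrow> bool" where
  "weak_deriv_on a b f g \<longleftrightarrow> loc_integrable a b f \<and> loc_integrable a b g \<and>
     (\<forall>\<phi> (l :: 'x \<Rightarrow>\<^sub>L real). smooth_test_fun a b \<phi> \<longrightarrow>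
        (LINT t:{a<..<b}|lebesgue. deriv \<phi> t * l (f t)) = - (LINT t:{a<..<b}|lebesgue. \<phi> t * l (g t)))"

definition wW1p :: "real \<Rightarrow> real \<Rightarrow> real \<Rightarrow> real \<Rightarrow> (real \<Rightarrow> 'x::real_normed_vector) \<Rightarrow> bool" where
  "wW1p a b \<kappa> p f \<longleftrightarrow> wLp a b \<kappa> p f \<and> (\<exists>g. weak_deriv_on a b f g \<and> wLp a b \<kappa> p g)"

text \<open>The weak derivative is unique a.e., so the norm below does not depend on the choice.\<close>
definition wW1p_norm :: "real \<Rightarrow> real \<Rightarrow> real \<Rightarrow> real \<Rightarrow> (real \<Rightarrow> 'x::real_normed_vector) \<Rightarrow> real" where
  "wW1p_norm a b \<kappa> p f = wLp_norm a b \<kappa> p f + wLp_norm a b \<kappa> p (SOME g. weak_deriv_on a b f g)"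

definition MR :: "('a::real_normed_vector \<Rightarrow>\<^sub>L 'b::real_normed_vector) \<Rightarrow> real \<Rightarrow> real \<Rightarrow> real \<Rightarrow> real \<Rightarrow> (real \<Rightarrow> 'a) \<Rightarrow> bool" where
  "MR j p \<kappa> a b u \<longleftrightarrow> wLp a b \<kappa> p u \<and> wW1p a b \<kappa> p (\<lambda>t. j (u t))"

definition MR_norm :: "('a::real_normed_vector \<Rightarrow>\<^sub>L 'b::real_normed_vector) \<Rightarrow> real \<Rightarrow> real \<Rightarrow> real \<Rightarrow> real \<Rightarrow> (real \<Rightarrow> 'a) \<Rightarrow> real" where
  "MR_norm j p \<kappa> a b u = max (wLp_norm a b \<kappa> p u) (wW1p_norm a b \<kappa> p (\<lambda>t. j (u t)))"

definition strong_solution ::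
  "('a::real_normed_vector \<Rightarrow>\<^sub>L 'b::real_normed_vector) \<Rightarrow> (real \<Rightarrow> 'a \<Rightarrow> 'b) \<Rightarrow> real \<Rightarrow> real \<Rightarrow>
   (real \<Rightarrow> 'b) \<Rightarrow> 'b \<Rightarrow> (real \<Rightarrow> 'a) \<Rightarrow> bool" where
  "strong_solution j \<A> a b f ua u \<longleftrightarrow>
     wLp a b 0 1 u \<and> wW1p a b 0 1 (\<lambda>t. j (u t)) \<and> wLp a b 0 1 (\<lambda>t. \<A> t (u t)) \<and>
     (\<exists>w. continuous_on {a..b} w \<and> (AE t in lebesgue_on {a<..<b}. w t = j (u t)) \<and> w a = ua) \<and>
     (\<exists>g. weak_deriv_on a b (\<lambda>t. j (u t)) g \<and>
          (AE t in lebesgue_on {a<..<b}. g t + \<A> t (u t) = f t))"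

definition maxreg_bound ::
  "('a::real_normed_vector \<Rightarrow>\<^sub>L 'b::real_normed_vector) \<Rightarrow> (real \<Rightarrow> 'a \<Rightarrow> 'b) \<Rightarrow> real \<Rightarrow> real \<Rightarrow> real \<Rightarrow> real \<Rightarrow> real \<Rightarrow> bool" where
  "maxreg_bound j \<A> p \<kappa> a b C \<longleftrightarrow> 0 \<le> C \<and>
     (\<forall>f \<tau> v. wLp a b \<kappa> p f \<and> a < \<tau> \<and> \<tau> \<le> b \<and> MR j p \<kappa> a \<tau> v \<and> strong_solution j \<A> a \<tau> f 0 v
        \<longrightarrow> MR_norm j p \<kappa> a \<tau> v \<le> C * wLp_norm a \<tau> \<kappa> p f)"

definition has_maxreg ::
  "('a::real_normed_vector \<Rightarrow>\<^sub>L 'b::real_normed_vector) \<Rightarrow> (real \<Rightarrow> 'a \<Rightarrow> 'b) \<Rightarrow> real \<Rightarrow> real \<Rightarrow> real \<Rightarrow> real \<Rightarrow> bool" where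
  "has_maxreg j \<A> p \<kappa> a b \<longleftrightarrow>
     (\<forall>f. wLp a b \<kappa> p f \<longrightarrow>
        (\<exists>u. MR j p \<kappa> a b u \<and> strong_solution j \<A> a b f 0 u) \<and>
        (\<forall>u v. MR j p \<kappa> a b u \<and> strong_solution j \<A> a b f 0 u \<and>
               MR j p \<kappa> a b v \<and> strong_solution j \<A> a b f 0 v \<longrightarrow>
               (AE t in lebesgue_on {a<..<b}. u t = v t))) \<and>
     (\<exists>C. maxreg_bound j \<A> p \<kappa> a b C)"

definition maxreg_const ::
  "('a::real_normed_vector \<Rightarrow>\<^sub>L 'b::real_normed_vector) \<Rightarrow> (real \<Rightarrow> 'a \<Rightarrow> 'b) \<Rightarrow> real \<Rightarrow> real \<Rightarrow> real \<Rightarrow> real \<Rightarrow> real" where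
  "maxreg_const j \<A> p \<kappa> a b = Inf {C. maxreg_bound j \<A> p \<kappa> a b C}"

definition K_fun :: "('a::real_normed_vector \<Rightarrow>\<^sub>L 'b::real_normed_vector) \<Rightarrow> real \<Rightarrow> 'b \<Rightarrow> real" where
  "K_fun j t x = Inf {norm x0 + t * norm x1 | x0 x1. x = x0 + j x1}"

definition interp_integral :: "('a::real_normed_vector \<Rightarrow>\<^sub>L 'b::real_normed_vector) \<Rightarrow> real \<Rightarrow> real \<Rightarrow> 'b \<Rightarrow> ennreal" where
  "interp_integral j \<theta> r x =
     (\<integral>\<^sup>+ t. ennreal ((t powr (-\<theta>) * K_fun j t x) powr r / t) * indicator {0<..} t \<partial>lebesgue)"

definition interp_space :: "('a::real_normed_vector \<Rightarrow>\<^sub>L 'b::real_normed_vector) \<Rightarrow> real \<Rightarrow> real \<Rightarrow> 'b set" where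
  "interp_space j \<theta> r = {x. interp_integral j \<theta> r x < \<infinity>}"

definition interp_norm :: "('a::real_normed_vector \<Rightarrow>\<^sub>L 'b::real_normed_vector) \<Rightarrow> real \<Rightarrow> real \<Rightarrow> 'b \<Rightarrow> real" where
  "interp_norm j \<theta> r x = enn2real (interp_integral j \<theta> r x) powr (1 / r)"

end

theory Submission
  imports Defs
begin

text \<open>
  Let \<open>v\<close> solve \<open>v' + A v = g\<close> on \<open>(0,t)\<close> with \<open>v 0 = 0\<close>. Comparing \<open>v t\<close> with \<open>v r\<close> for \<open>r\<close> close to \<open>t\<close>
  bounds the K-functional by \<open>K s (v t) \<le> C s\<^bsup>1-1/p\<^esup> t\<^bsup>-\<kappa>/p\<^esup> \<parallel>v\<parallel>\<close>, with the maximal regularity norm over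
  \<open>(0,t)\<close> on the right and \<open>C\<close> independent of \<open>t\<close>. Together with \<open>K s (v t) \<le> s \<parallel>v t\<parallel>\<close> this estimates the
  interpolation norm of \<open>v t\<close>, and hence, for every \<open>\<epsilon> > 0\<close>,
  \<open>\<parallel>B v\<parallel>\<^sup>p \<le> \<epsilon> \<parallel>g\<parallel>\<^sup>p + C\<^sub>\<epsilon> \<integral> \<bar>b s\<bar>\<^sup>q \<parallel>g\<parallel>\<^sup>p ds\<close>, where the norm of \<open>g\<close> under the integral is taken over \<open>(0,s)\<close>.
  In the norm weighted with \<open>exp (- \<nu> \<beta> t)\<close>, \<open>\<beta> t = \<integral> \<bar>b\<bar>\<^sup>q\<close> over \<open>(0,t)\<close>, the map \<open>g \<mapsto> B v\<close> is therefore
  a contraction once \<open>\<nu>\<close> is large, depending on the constant of \<open>A\<close> only. Writing the perturbed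
  problem as \<open>g = f - B v\<close> gives existence by a Neumann series and the a priori bound by absorption.

  Functions take values in spaces that need not be separable, so vector-valued integrals are
  avoided throughout: weak derivatives are accessed through norming functionals.
\<close>

section \<open>Strong measurability\<close>

text \<open>Maximal regularity is available only with zero initial value at time 0 and with the
  weight tied to 0, so the perturbation is not made small by cutting (0,T) into short pieces and
  restarting. The exponential weight does this job on the whole interval: the bound for
  \<open>A\<close> holds with one constant on every (0,s), hence \<open>v\<close> on (0,s) is
  controlled by \<open>g\<close> on (0,s) alone, and integrating |b|^q exp (\<nu> \<beta>) gains a
  factor 1/\<nu>, as in Gronwall's argument. The powers fit exactly: the factor t^(-\<kappa>/p) of
  the trace bound is cancelled by the weight t^\<kappa>, so no constant sees the length T, and q > p
  makes the interpolation integral converge at infinity. Sums are split by (x+y)^p \<le> 2^p (x^p +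
  y^p); the contraction factor aimed at is therefore 2^(-p-1), since one such splitting still leaves
  1/2.\<close>

lemma borel_measurable_lebesgue_on_AE:
  fixes f g :: "real \<Rightarrow> real"
  assumes S: "S \<in> sets lebesgue" and f: "f \<in> borel_measurable (lebesgue_on S)"
    and eq: "AE t in lebesgue_on S. f t = g t"
  shows "g \<in> borel_measurable (lebesgue_on S)"
proof -
  have "(\<lambda>x. if x \<in> S then f x else 0) \<in> borel_measurable lebesgue"
    using f S by (simp add: borel_measurable_if)
  moreover have "AE t in lebesgue. (if t \<in> S then f t else 0) = (if t \<in> S then g t else 0)"
    using eq S by (auto simp: AE_restrict_space_iff elim: eventually_mono)
  ultimately have "(\<lambda>x. if x \<in> S then g x else 0) \<in> borel_measurable lebesgue"
    by (rule borel_measurable_AE)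
  then show ?thesis
    using S by (simp add: borel_measurable_if)
qed

lemma borel_measurable_lebesgue_on_AE_limit:
  fixes f :: "real \<Rightarrow> real"
  assumes S: "S \<in> sets lebesgue" and m: "\<And>n. u n \<in> borel_measurable (lebesgue_on S)"
    and lim: "AE t in lebesgue_on S. (\<lambda>n. u n t) \<longlonglongrightarrow> f t"
  shows "f \<in> borel_measurable (lebesgue_on S)"
proof (rule borel_measurable_lebesgue_on_AE[OF S])
  show "(\<lambda>t. lim (\<lambda>n. u n t)) \<in> borel_measurable (lebesgue_on S)"
    by (rule borel_measurable_lim_metric[OF m])
  show "AE t in lebesgue_on S. lim (\<lambda>n. u n t) = f t"
    using lim by eventually_elim (rule limI)
qed

lemma borel_measurable_ennreal_indicator:
  fixes \<phi> :: "real \<Rightarrow> real"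
  assumes "S \<in> sets lebesgue" "\<phi> \<in> borel_measurable (lebesgue_on S)"
  shows "(\<lambda>x. ennreal (\<phi> x) * indicator S x) \<in> borel_measurable lebesgue"
proof -
  have "(\<lambda>x. if x \<in> S then \<phi> x else 0) \<in> borel_measurable lebesgue"
    using assms by (simp add: borel_measurable_if)
  then have "(\<lambda>x. ennreal (if x \<in> S then \<phi> x else 0)) \<in> borel_measurable lebesgue"
    by measurable
  also have "(\<lambda>x. ennreal (if x \<in> S then \<phi> x else 0)) = (\<lambda>x. ennreal (\<phi> x) * indicator S x)"
    by (auto simp: indicator_def)
  finally show ?thesis .
qed

lemma strongly_measurable_on_simpleI:
  assumes "\<And>n. simple_function (lebesgue_on S) (s n)"
    and "AE t in lebesgue_on S. (\<lambda>n. s n t) \<longlonglongrightarrow> f t"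
  shows "strongly_measurable_on S f"
  unfolding strongly_measurable_on_def using assms by (intro exI[of _ s]) simp

lemma strongly_measurable_on_compose:
  fixes h :: "'x::real_normed_vector \<Rightarrow> real"
  assumes S: "S \<in> sets lebesgue" and f: "strongly_measurable_on S f" and h: "continuous_on UNIV h"
  shows "(\<lambda>t. h (f t)) \<in> borel_measurable (lebesgue_on S)"
proof -
  obtain s where s: "\<And>n. simple_function (lebesgue_on S) (s n)"
    and lim: "AE t in lebesgue_on S. (\<lambda>n. s n t) \<longlonglongrightarrow> f t"
    using f unfolding strongly_measurable_on_def by blast
  show ?thesis
  proof (rule borel_measurable_lebesgue_on_AE_limit[OF S])
    show "(\<lambda>t. h (s n t)) \<in> borel_measurable (lebesgue_on S)" for n
      using simple_function_compose1[OF s] by (rule borel_measurable_simple_function)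
    show "AE t in lebesgue_on S. (\<lambda>n. h (s n t)) \<longlonglongrightarrow> h (f t)"
      using lim by eventually_elim (use h in \<open>auto intro: continuous_on_tendsto_compose\<close>)
  qed
qed

lemma strongly_measurable_on_norm:
  "S \<in> sets lebesgue \<Longrightarrow> strongly_measurable_on S f \<Longrightarrow>
    (\<lambda>t. norm (f t)) \<in> borel_measurable (lebesgue_on S)"
  by (rule strongly_measurable_on_compose[where h=norm]) (auto intro: continuous_on_norm_id)

lemma strongly_measurable_on_separable:
  assumes "strongly_measurable_on S f"
  obtains D where "countable D" "AE t in lebesgue_on S. f t \<in> closure D"
proof -
  obtain s where s: "\<And>n. simple_function (lebesgue_on S) (s n)"
    and lim: "AE t in lebesgue_on S. (\<lambda>n. s n t) \<longlonglongrightarrow> f t"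
    using assms unfolding strongly_measurable_on_def by blast
  let ?D = "\<Union>n. s n ` S"
  have "countable ?D"
    using s by (auto simp: simple_function_def intro: countable_finite)
  moreover have "AE t in lebesgue_on S. f t \<in> closure ?D"
    using lim AE_space
  proof eventually_elim
    case (elim t)
    then show ?case
      unfolding closure_sequential by (intro exI[of _ "\<lambda>n. s n t"]) auto
  qed
  ultimately show thesis by (rule that)
qed

text \<open>A Pettis-type criterion. The approximant takes the value \<open>d k\<close> for the
  least k \<le> n that minimises the distance to \<open>f t\<close> among the first points of a
  dense sequence. It is simple because this index depends measurably on finitely many distances, and
  it converges wherever \<open>f t\<close> lies in the closure of \<open>D\<close>.\<close>

lemma strongly_measurable_onI:
  fixes f :: "real \<Rightarrow> 'x::real_normed_vector"
  assumes D: "countable D" "AE t in lebesgue_on S. f t \<in> closure D"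
    and m [measurable]: "\<And>d. (\<lambda>t. norm (f t - d)) \<in> borel_measurable (lebesgue_on S)"
  shows "strongly_measurable_on S f"
proof -
  \<comment> \<open>The point 0 is added so that an enumeration exists even if \<open>D\<close> is
    empty.\<close>
  define d where "d = from_nat_into (insert 0 D)"
  have range_d: "range d = insert 0 D"
    unfolding d_def using D(1) by (intro range_from_nat_into) auto
  define idx where "idx n t = (LEAST k. k \<le> n \<and> (\<forall>i\<in>{..n}. norm (f t - d k) \<le> norm (f t - d i)))" for n t
  have idx: "idx n t \<le> n \<and> (\<forall>i\<in>{..n}. norm (f t - d (idx n t)) \<le> norm (f t - d i))" for n t
  proof -
    have "\<exists>k\<in>{..n}. \<forall>i\<in>{..n}. norm (f t - d k) \<le> norm (f t - d i)"
      using ex_min_if_finite[of "(\<lambda>i. norm (f t - d i)) ` {..n}"] by (auto simp: not_less)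
    then have "\<exists>k. k \<le> n \<and> (\<forall>i\<in>{..n}. norm (f t - d k) \<le> norm (f t - d i))" by auto
    then show ?thesis
      unfolding idx_def by (rule LeastI_ex)
  qed
  have "simple_function (lebesgue_on S) (idx n)" for n
    unfolding simple_function_eq_measurable
  proof
    show "idx n \<in> measurable (lebesgue_on S) (count_space UNIV)"
      unfolding idx_def by measurable
    show "finite (idx n ` space (lebesgue_on S))"
      by (rule finite_subset[of _ "{..n}"]) (use idx in auto)
  qed
  then have "simple_function (lebesgue_on S) (\<lambda>t. d (idx n t))" for n
    by (rule simple_function_compose1)
  moreover have "AE t in lebesgue_on S. (\<lambda>n. d (idx n t)) \<longlonglongrightarrow> f t"
    using D(2)
  proof eventually_elim
    case (elim t)
    show ?case
    proof (rule metric_LIMSEQ_I)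
      fix e :: real assume "e > 0"
      then obtain y where "y \<in> D" "dist y (f t) < e"
        using elim by (auto simp: closure_approachable)
      then obtain k where "dist (d k) (f t) < e"
        using range_d by (metis imageE insertCI)
      then have "dist (d (idx n t)) (f t) < e" if "n \<ge> k" for n
        using idx[of n t] that by (force simp: dist_norm norm_minus_commute)
      then show "\<exists>N. \<forall>n\<ge>N. dist (d (idx n t)) (f t) < e" by blast
    qed
  qed
  ultimately show ?thesis
    by (rule strongly_measurable_on_simpleI)
qed

text \<open>A diagonal choice among the simple approximants of the \<open>u n\<close> would need
  uniformity outside small sets. Separability of the range and measurability of the distances both
  pass to the limit directly, so the criterion above is checked instead.\<close>

lemma strongly_measurable_on_AE_limit:
  fixes f :: "real \<Rightarrow> 'x::real_normed_vector"
  assumes S: "S \<in> sets lebesgue" and u: "\<And>n. strongly_measurable_on S (u n)"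
    and lim: "AE t in lebesgue_on S. (\<lambda>n. u n t) \<longlonglongrightarrow> f t"
  shows "strongly_measurable_on S f"
proof -
  have "\<exists>D. countable D \<and> (AE t in lebesgue_on S. u n t \<in> closure D)" for n
    using strongly_measurable_on_separable[OF u[of n]] by blast
  then obtain D where D: "\<And>n. countable (D n)" "\<And>n. AE t in lebesgue_on S. u n t \<in> closure (D n)"
    by metis
  show ?thesis
  proof (rule strongly_measurable_onI)
    show "countable (\<Union>n. D n)" using D(1) by auto
    have "AE t in lebesgue_on S. \<forall>n. u n t \<in> closure (D n)"
      using D(2) by (simp add: AE_all_countable)
    then show "AE t in lebesgue_on S. f t \<in> closure (\<Union>n. D n)"
      using lim
    proof eventually_elim
      case (elim t)
      then have "u n t \<in> closure (\<Union>n. D n)" for n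
        using closure_mono[of "D n" "\<Union>n. D n"] by blast
      then show ?case
        by (intro closed_sequentially[OF closed_closure _ elim(2)])
    qed
    show "(\<lambda>t. norm (f t - d)) \<in> borel_measurable (lebesgue_on S)" for d
    proof (rule borel_measurable_lebesgue_on_AE_limit[OF S])
      show "(\<lambda>t. norm (u n t - d)) \<in> borel_measurable (lebesgue_on S)" for n
        by (rule strongly_measurable_on_compose[OF S u]) (intro continuous_intros)
      show "AE t in lebesgue_on S. (\<lambda>n. norm (u n t - d)) \<longlonglongrightarrow> norm (f t - d)"
        using lim by eventually_elim (intro tendsto_intros)
    qed
  qed
qed

lemma strongly_measurable_on_AE_cong:
  assumes "strongly_measurable_on S f" "AE t in lebesgue_on S. f t = g t"
  shows "strongly_measurable_on S g"
proof -
  obtain s where s: "\<And>n. simple_function (lebesgue_on S) (s n)"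
    and lim: "AE t in lebesgue_on S. (\<lambda>n. s n t) \<longlonglongrightarrow> f t"
    using assms unfolding strongly_measurable_on_def by blast
  have "AE t in lebesgue_on S. (\<lambda>n. s n t) \<longlonglongrightarrow> g t"
    using lim assms(2) by eventually_elim simp
  with s show ?thesis by (rule strongly_measurable_on_simpleI)
qed

lemma simple_function_imp_strongly_measurable_on:
  "simple_function (lebesgue_on S) f \<Longrightarrow> strongly_measurable_on S f"
  unfolding strongly_measurable_on_def by (intro exI[of _ "\<lambda>n. f"]) auto

lemma strongly_measurable_on_compose2:
  fixes h :: "'x::real_normed_vector \<Rightarrow> 'y::real_normed_vector \<Rightarrow> 'z::real_normed_vector"
  assumes f: "strongly_measurable_on S f" and g: "strongly_measurable_on S g"
    and h: "\<And>u v x y. u \<longlonglongrightarrow> x \<Longrightarrow> v \<longlonglongrightarrow> y \<Longrightarrow> (\<lambda>n. h (u n) (v n)) \<longlonglongrightarrow> h x y"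
  shows "strongly_measurable_on S (\<lambda>t. h (f t) (g t))"
proof -
  obtain s where s: "\<And>n. simple_function (lebesgue_on S) (s n)"
    and lim: "AE t in lebesgue_on S. (\<lambda>n. s n t) \<longlonglongrightarrow> f t"
    using f unfolding strongly_measurable_on_def by blast
  obtain r where r: "\<And>n. simple_function (lebesgue_on S) (r n)"
    and lim': "AE t in lebesgue_on S. (\<lambda>n. r n t) \<longlonglongrightarrow> g t"
    using g unfolding strongly_measurable_on_def by blast
  have "AE t in lebesgue_on S. (\<lambda>n. h (s n t) (r n t)) \<longlonglongrightarrow> h (f t) (g t)"
    using lim lim' by eventually_elim (rule h)
  with simple_function_compose2[OF s r] show ?thesis
    by (rule strongly_measurable_on_simpleI)
qed

lemma strongly_measurable_on_add:
  "strongly_measurable_on S f \<Longrightarrow> strongly_measurable_on S g \<Longrightarrow>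
    strongly_measurable_on S (\<lambda>t. f t + g t)"
  by (rule strongly_measurable_on_compose2[where h="(+)"]) (auto intro: tendsto_add)

lemma strongly_measurable_on_const: "strongly_measurable_on S (\<lambda>t. c)"
  by (rule simple_function_imp_strongly_measurable_on) simp

lemma strongly_measurable_on_scaleR:
  "strongly_measurable_on S f \<Longrightarrow> strongly_measurable_on S (\<lambda>t. c *\<^sub>R f t)"
  by (rule strongly_measurable_on_compose2[OF strongly_measurable_on_const, where h="(*\<^sub>R)"])
     (auto intro: tendsto_scaleR)

lemma strongly_measurable_on_lincomb:
  "strongly_measurable_on S f \<Longrightarrow> strongly_measurable_on S g \<Longrightarrow>
    strongly_measurable_on S (\<lambda>t. f t + c *\<^sub>R g t)"
  by (intro strongly_measurable_on_add strongly_measurable_on_scaleR)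

lemma strongly_measurable_on_scaleR_simple:
  "simple_function (lebesgue_on S) r \<Longrightarrow> strongly_measurable_on S f \<Longrightarrow>
    strongly_measurable_on S (\<lambda>t. (r t::real) *\<^sub>R f t)"
  by (rule strongly_measurable_on_compose2[OF simple_function_imp_strongly_measurable_on, where h="(*\<^sub>R)"])
     (auto intro: tendsto_scaleR)

lemma strongly_measurable_on_sum:
  assumes "\<And>i. i \<in> I \<Longrightarrow> strongly_measurable_on S (f i)"
  shows "strongly_measurable_on S (\<lambda>t. \<Sum>i\<in>I. f i t)"
  using assms
  by (induction I rule: infinite_finite_induct)
     (auto intro: strongly_measurable_on_const strongly_measurable_on_add)

lemma AE_lebesgue_on_subset:
  assumes "S \<in> sets lebesgue" "S' \<in> sets lebesgue" "S' \<subseteq> S" "AE t in lebesgue_on S. P t"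
  shows "AE t in lebesgue_on S'. P t"
  using assms by (auto simp: AE_restrict_space_iff elim: eventually_mono)

lemma strongly_measurable_on_subset:
  assumes S: "S \<in> sets lebesgue" "S' \<in> sets lebesgue" "S' \<subseteq> S" and f: "strongly_measurable_on S f"
  shows "strongly_measurable_on S' f"
proof -
  obtain s where s: "\<And>n. simple_function (lebesgue_on S) (s n)"
    and lim: "AE t in lebesgue_on S. (\<lambda>n. s n t) \<longlonglongrightarrow> f t"
    using f unfolding strongly_measurable_on_def by blast
  have "simple_function (lebesgue_on S') (s n)" for n
  proof -
    have "finite (s n ` S)" "s n \<in> measurable (lebesgue_on S) (count_space UNIV)"
      using s[of n] by (auto simp: simple_function_eq_measurable)
    then show ?thesis
      using measurable_restrict_mono[OF _ S(3)] S(3)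
      by (auto simp: simple_function_eq_measurable intro: finite_subset[OF image_mono])
  qed
  then show ?thesis
    using AE_lebesgue_on_subset[OF S lim] by (rule strongly_measurable_on_simpleI)
qed

text \<open>Used to extend a right-hand side from (0,\<tau>) to (0,T), because
  \<open>maxreg_bound\<close> quantifies over functions on the whole interval even when the solution
  lives on (0,\<tau>).\<close>

lemma strongly_measurable_on_extend_zero:
  fixes f :: "real \<Rightarrow> 'x::real_normed_vector"
  assumes S: "S \<in> sets lebesgue" "S' \<in> sets lebesgue" and f: "strongly_measurable_on S' f"
  shows "strongly_measurable_on S (\<lambda>t. if t \<in> S' then f t else 0)"
proof -
  obtain s where s: "\<And>n. simple_function (lebesgue_on S') (s n)"
    and lim: "AE t in lebesgue_on S'. (\<lambda>n. s n t) \<longlonglongrightarrow> f t"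
    using f unfolding strongly_measurable_on_def by blast
  have "simple_function lebesgue (\<lambda>t. if t \<in> S' then s n t else 0)" for n
  proof -
    have s': "finite (s n ` S')" "s n \<in> measurable (lebesgue_on S') (count_space UNIV)"
      using s[of n] by (auto simp: simple_function_eq_measurable)
    have "range (\<lambda>t. if t \<in> S' then s n t else 0) \<subseteq> insert 0 (s n ` S')"
      by auto
    then have "finite (range (\<lambda>t. if t \<in> S' then s n t else 0))"
      using s'(1) finite_subset by blast
    moreover have "(\<lambda>t. if t \<in> S' then s n t else 0) \<in> measurable lebesgue (count_space UNIV)"
      using s'(2) S(2) measurable_restrict_space_iff[of S' lebesgue 0 "count_space UNIV" "s n"] by simp
    ultimately show ?thesis by (simp add: simple_function_eq_measurable)
  qed
  moreover have "AE t in lebesgue. (\<lambda>n. if t \<in> S' then s n t else 0) \<longlonglongrightarrow> (if t \<in> S' then f t else 0)"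
    using lim S(2) by (auto simp: AE_restrict_space_iff elim!: eventually_mono)
  ultimately have "strongly_measurable_on UNIV (\<lambda>t. if t \<in> S' then f t else 0)"
    unfolding strongly_measurable_on_def lebesgue_on_UNIV_eq
    by (intro exI[of _ "\<lambda>n t. if t \<in> S' then s n t else 0"]) auto
  then show ?thesis
    by (rule strongly_measurable_on_subset[rotated 3]) (use S in auto)
qed

section \<open>Norming functionals and smooth test functions\<close>

text \<open>Hahn-Banach by Zorn's lemma on graphs: subspaces of pairs (y,r) with r \<le> norm y that
  contain (x, norm x). Working with subspaces of the product makes unions of chains easy;
  single-valuedness need not be carried along, since the norm bound enforces it.\<close>

theorem norming_functional:
  fixes x :: "'x::real_normed_vector"
  obtains l :: "'x \<Rightarrow>\<^sub>L real" where "\<And>y. \<bar>l y\<bar> \<le> norm y" "l x = norm x"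
proof -
  define \<G> where "\<G> = {G :: ('x \<times> real) set. subspace G \<and> (\<forall>(y,r)\<in>G. r \<le> norm y) \<and> (x, norm x) \<in> G}"
  have "span {(x, norm x)} \<in> \<G>"
  proof -
    have "c * norm x \<le> norm (c *\<^sub>R x)" for c
      by (simp add: mult_right_mono)
    then have "r \<le> norm y" if "(y, r) \<in> span {(x, norm x)}" for y r
      using that by (auto simp: span_singleton)
    then show ?thesis
      unfolding \<G>_def by (auto intro: span_base)
  qed
  then have "\<G> \<noteq> {}" by blast
  have chain: "\<Union>\<C> \<in> \<G>" if ne: "\<C> \<noteq> {}" and ch: "subset.chain \<G> \<C>" for \<C>
  proof -
    have sub: "\<And>G. G \<in> \<C> \<Longrightarrow> subspace G" "\<And>G y r. G \<in> \<C> \<Longrightarrow> (y,r) \<in> G \<Longrightarrow> r \<le> norm y"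
      "\<And>G. G \<in> \<C> \<Longrightarrow> (x, norm x) \<in> G"
      using ch unfolding subset.chain_def \<G>_def by blast+
    have "subspace (\<Union>\<C>)"
      unfolding subspace_def
    proof (intro conjI ballI allI)
      show "0 \<in> \<Union>\<C>" using ne sub(1) subspace_0 by blast
      show "u + v \<in> \<Union>\<C>" if uv: "u \<in> \<Union>\<C>" "v \<in> \<Union>\<C>" for u v
      proof -
        obtain G H where GH: "G \<in> \<C>" "u \<in> G" "H \<in> \<C>" "v \<in> H" using uv by blast
        then have "G \<subseteq> H \<or> H \<subseteq> G"
          using ch unfolding subset.chain_def by blast
        then show ?thesis
          using GH sub(1) subspace_add by blast
      qed
      show "c *\<^sub>R u \<in> \<Union>\<C>" if "u \<in> \<Union>\<C>" for c u
        using that sub(1) subspace_scale by blast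
    qed
    then show ?thesis
      unfolding \<G>_def using ne sub by blast
  qed
  obtain M where M: "M \<in> \<G>" and max: "\<And>G. G \<in> \<G> \<Longrightarrow> M \<subseteq> G \<Longrightarrow> G = M"
    using subset_Zorn_nonempty[OF \<open>\<G> \<noteq> {}\<close> chain] by blast
  have sM: "subspace M" and leM: "\<And>y r. (y,r) \<in> M \<Longrightarrow> r \<le> norm y" and xM: "(x, norm x) \<in> M"
    using M unfolding \<G>_def by auto
  have total: "\<exists>r. (y,r) \<in> M" for y
  proof -
    \<comment> \<open>Adding (y,c) to \<open>M\<close> keeps the norm bound if c lies above every r
      - norm (z - y) and below every norm (z + y) - r with (z,r) in \<open>M\<close>.
      \<open>R\<close> collects the lower constraints, and its supremum is an admissible c.\<close>
    define R where "R = {r - norm (z - y) | z r. (z,r) \<in> M}"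
    have Rle: "a \<le> norm (z + y) - r" if zrM: "(z,r) \<in> M" and aR: "a \<in> R" for a z r
    proof -
      obtain z' r' where zr: "(z',r') \<in> M" "a = r' - norm (z' - y)"
        using aR unfolding R_def by blast
      have "(z + z', r + r') \<in> M"
        using subspace_add[OF sM zrM zr(1)] by simp
      then have "r + r' \<le> norm ((z + y) + (z' - y))"
        using leM by fastforce
      also have "\<dots> \<le> norm (z + y) + norm (z' - y)" by (rule norm_triangle_ineq)
      finally show ?thesis using zr(2) by simp
    qed
    have "R \<noteq> {}" using xM unfolding R_def by blast
    define c where "c = Sup R"
    have c1: "r - norm (z - y) \<le> c" if "(z,r) \<in> M" for z r
      unfolding c_def
      by (rule cSup_upper) (use that Rle[OF xM] in \<open>auto simp: R_def intro!: bdd_aboveI\<close>)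
    have c2: "c \<le> norm (z + y) - r" if "(z,r) \<in> M" for z r
      unfolding c_def by (rule cSup_least[OF \<open>R \<noteq> {}\<close>]) (rule Rle[OF that])
    have le: "r \<le> norm z" if zr: "(z, r) \<in> span (insert (y, c) M)" for z r
    proof -
      have "span M = M" using sM by (simp add: span_eq_iff)
      then obtain k where k: "(z, r) - k *\<^sub>R (y, c) \<in> M"
        using zr span_breakdown_eq[of "(z,r)" "(y,c)" M] by metis
      show ?thesis
      proof (cases k "0::real" rule: linorder_cases)
        case equal
        then show ?thesis using k leM by simp
      next
        case greater
        have "(1/k) *\<^sub>R ((z, r) - k *\<^sub>R (y, c)) \<in> M"
          using sM k by (rule subspace_scale)
        then have "((1/k) *\<^sub>R z - y, r / k - c) \<in> M"
          using greater by (simp add: algebra_simps diff_divide_distrib)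
        from c2[OF this] have "r / k \<le> norm ((1/k) *\<^sub>R z)" by simp
        then show ?thesis using greater by (simp add: divide_simps)
      next
        case less
        have "(1/(-k)) *\<^sub>R ((z, r) - k *\<^sub>R (y, c)) \<in> M"
          using sM k by (rule subspace_scale)
        then have "((1/(-k)) *\<^sub>R z + y, r / (-k) + c) \<in> M"
          using less by (simp add: algebra_simps diff_divide_distrib)
        from c1[OF this] have "r / (-k) \<le> norm ((1/(-k)) *\<^sub>R z)" by simp
        then show ?thesis using less by (simp add: divide_simps)
      qed
    qed
    have "span (insert (y, c) M) \<in> \<G>"
      unfolding \<G>_def using le xM by (auto intro: span_base)
    then have "span (insert (y, c) M) = M"
      by (rule max) (auto intro: span_base)
    then show ?thesis
      by (metis insertI1 span_base)
  qed
  \<comment> \<open>Both (0, r - r') and (0, r' - r) lie in \<open>M\<close>, so the norm bound at 0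
    forces r = r'.\<close>
  have uniq: "r = r'" if "(y,r) \<in> M" "(y,r') \<in> M" for y r r'
    using leM[of 0 "r - r'"] leM[of 0 "r' - r"] subspace_diff[OF sM that] subspace_diff[OF sM that(2,1)]
    by simp
  define L where "L y = (THE r. (y,r) \<in> M)" for y
  have L: "(y, L y) \<in> M" for y
    unfolding L_def using total[of y] uniq by (metis theI)
  have L_eq: "L y = r" if "(y,r) \<in> M" for y r
    using uniq[OF L that] .
  have "bounded_linear L"
  proof (rule bounded_linear_intro[where K=1])
    show "L (y + z) = L y + L z" for y z
      using subspace_add[OF sM L[of y] L[of z]] by (intro L_eq) simp
    show "L (c *\<^sub>R y) = c *\<^sub>R L y" for c y
      using subspace_scale[OF sM L[of y], of c] by (intro L_eq) simp
    show "norm (L y) \<le> norm y * 1" for y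
      using leM[OF L[of y]] leM[of "- y" "- L y"] subspace_scale[OF sM L[of y], of "-1"]
      by auto
  qed
  moreover have "\<bar>L y\<bar> \<le> norm y" for y
    using leM[OF L[of y]] leM[of "- y" "- L y"] subspace_scale[OF sM L[of y], of "-1"]
    by auto
  ultimately show thesis
    using that[of "Blinfun L"] L_eq[OF xM] by (simp add: bounded_linear_Blinfun_apply)
qed

section \<open>Smooth step functions built from exp(-1/x)\<close>

definition flat :: "nat \<Rightarrow> real \<Rightarrow> real" where
  "flat k x = (if 0 < x then (1/x) ^ k * exp (- 1/x) else 0)"

lemma flat_tendsto_0: "((\<lambda>x. (1/x) ^ k * exp (- 1/x)) \<longlongrightarrow> (0::real)) (at_right 0)"
proof -
  have "((\<lambda>y::real. y ^ k / exp y) \<longlongrightarrow> 0) at_top"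
    by (rule tendsto_power_div_exp_0)
  then have "((\<lambda>x::real. (inverse x) ^ k / exp (inverse x)) \<longlongrightarrow> 0) (at_right 0)"
    by (rule filterlim_compose[OF _ filterlim_inverse_at_top_right])
  then show ?thesis
    by (simp add: exp_minus field_simps)
qed

text \<open>Powers of 1/x are built into \<open>flat\<close> because differentiation then only
  shifts the index. At 0 the right-hand difference quotient of \<open>flat k\<close> is the formula
  of index k+1, which tends to 0.\<close>

lemma flat_DERIV: "(flat k has_real_derivative flat (k+2) x - real k * flat (k+1) x) (at x)"
proof (cases x "0::real" rule: linorder_cases)
  case less
  have "((\<lambda>x. 0) has_real_derivative 0) (at x)" by simp
  then have "(flat k has_real_derivative 0) (at x)"
    by (rule DERIV_cong_ev[THEN iffD1, rotated 3])
       (use less in \<open>auto simp: flat_def eventually_nhds intro!: exI[of _ "{..<0}"]\<close>)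
  then show ?thesis using less by (simp add: flat_def)
next
  case greater
  have "((\<lambda>x. (1/x) ^ k * exp (- 1/x)) has_real_derivative
      flat (k+2) x - real k * flat (k+1) x) (at x)"
  proof -
    have inv: "((\<lambda>x. 1/x) has_real_derivative - ((1/x) ^ 2)) (at x)"
      using DERIV_inverse[of x] greater by (simp add: inverse_eq_divide power2_eq_square)
    have "((\<lambda>x. exp (- (1/x))) has_real_derivative exp (- (1/x)) * (1/x) ^ 2) (at x)"
      using DERIV_chain2[OF DERIV_exp DERIV_minus[OF inv]] by simp
    from DERIV_mult[OF DERIV_power[OF inv, of k] this] show ?thesis
      using greater by (cases k) (auto simp: flat_def algebra_simps power2_eq_square power_add)
  qed
  then show ?thesis
    by (rule DERIV_cong_ev[THEN iffD1, rotated 3])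
       (use greater in \<open>auto simp: flat_def eventually_nhds intro!: exI[of _ "{0<..}"]\<close>)
next
  case equal
  have "((\<lambda>h. (flat k (0 + h) - flat k 0) / h) \<longlongrightarrow> 0) (at_right 0)"
  proof (rule Lim_transform_eventually[OF flat_tendsto_0[of "Suc k"]])
    show "\<forall>\<^sub>F h in at_right 0. (1/h) ^ Suc k * exp (- 1/h) = (flat k (0 + h) - flat k 0) / h"
      by (auto simp: eventually_at_right_field flat_def intro!: exI[of _ 1])
  qed
  moreover have "((\<lambda>h. (flat k (0 + h) - flat k 0) / h) \<longlongrightarrow> 0) (at_left 0)"
    by (rule Lim_transform_eventually[OF tendsto_const])
       (auto simp: eventually_at_left_field flat_def intro!: exI[of _ "-1"])
  ultimately have "((\<lambda>h. (flat k (0 + h) - flat k 0) / h) \<longlongrightarrow> 0) (at 0)"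
    by (simp add: filterlim_at_split)
  then have "(flat k has_real_derivative 0) (at 0)"
    by (simp add: DERIV_def)
  then show ?thesis using equal by (simp add: flat_def)
qed

text \<open>Closed under sums, products, affine substitutions and, by \<open>flat_DERIV\<close>,
  derivatives. Smoothness of every order follows from membership, with no formula for the higher
  derivatives.\<close>

inductive_set flat_algebra :: "(real \<Rightarrow> real) set" where
  base: "(\<lambda>x. flat k (c * x + d)) \<in> flat_algebra"
| const: "(\<lambda>x. c) \<in> flat_algebra"
| add: "f \<in> flat_algebra \<Longrightarrow> g \<in> flat_algebra \<Longrightarrow> (\<lambda>x. f x + g x) \<in> flat_algebra"
| mult: "f \<in> flat_algebra \<Longrightarrow> g \<in> flat_algebra \<Longrightarrow> (\<lambda>x. f x * g x) \<in> flat_algebra"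

lemma flat_algebra_affine: "f \<in> flat_algebra \<Longrightarrow> (\<lambda>x. f (c * x + d)) \<in> flat_algebra"
proof (induction rule: flat_algebra.induct)
  case (base k c' d')
  have "(\<lambda>x. flat k ((c' * c) * x + (c' * d + d'))) \<in> flat_algebra" by (rule flat_algebra.base)
  then show ?case by (simp add: algebra_simps)
qed (auto intro: flat_algebra.intros)

lemma flat_algebra_DERIV:
  "f \<in> flat_algebra \<Longrightarrow> \<exists>f'\<in>flat_algebra. \<forall>x. (f has_real_derivative f' x) (at x)"
proof (induction rule: flat_algebra.induct)
  case (base k c d)
  let ?f' = "\<lambda>x. c * (flat (k+2) (c * x + d) + (- real k) * flat (k+1) (c * x + d))"
  have "((\<lambda>x. flat k (c * x + d)) has_real_derivative
      (flat (k+2) (c * x + d) - real k * flat (k+1) (c * x + d)) * c) (at x)" for x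
    by (rule DERIV_chain2[OF flat_DERIV]) (auto intro!: derivative_eq_intros)
  moreover have "?f' \<in> flat_algebra" by (intro flat_algebra.intros)
  ultimately show ?case by (intro bexI[of _ ?f']) (auto simp: mult.commute)
next
  case (const c)
  show ?case by (intro bexI[of _ "\<lambda>x. 0"]) (auto intro: flat_algebra.const)
next
  case (add f g)
  then obtain f' g' where fg: "f' \<in> flat_algebra" "g' \<in> flat_algebra"
    "\<And>x. (f has_real_derivative f' x) (at x)" "\<And>x. (g has_real_derivative g' x) (at x)" by blast
  show ?case
    by (intro bexI[of _ "\<lambda>x. f' x + g' x"] allI DERIV_add fg flat_algebra.add)
next
  case (mult f g)
  then obtain f' g' where fg: "f' \<in> flat_algebra" "g' \<in> flat_algebra"
    "\<And>x. (f has_real_derivative f' x) (at x)" "\<And>x. (g has_real_derivative g' x) (at x)" by blast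
  show ?case
    by (intro bexI[of _ "\<lambda>x. f' x * g x + g' x * f x"] allI DERIV_mult fg flat_algebra.add
        flat_algebra.mult mult.hyps)
qed

lemma flat_algebra_deriv: "f \<in> flat_algebra \<Longrightarrow> deriv f \<in> flat_algebra"
proof -
  assume "f \<in> flat_algebra"
  then obtain f' where f': "f' \<in> flat_algebra" "\<And>x. (f has_real_derivative f' x) (at x)"
    using flat_algebra_DERIV by blast
  then have "deriv f = f'" by (intro ext DERIV_imp_deriv)
  with f'(1) show ?thesis by simp
qed

lemma flat_algebra_funpow_deriv: "f \<in> flat_algebra \<Longrightarrow> (deriv ^^ k) f \<in> flat_algebra"
  by (induction k) (auto intro: flat_algebra_deriv)

lemma flat_algebra_continuous: "f \<in> flat_algebra \<Longrightarrow> continuous_on S f"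
  using flat_algebra_DERIV by (meson DERIV_continuous continuous_at_imp_continuous_on)

text \<open>Step functions arise as antiderivatives and are known only through their derivative. It
  is enough that this derivative lies in the algebra, since every higher one then does.\<close>

lemma smooth_if_DERIV_flat_algebra:
  assumes "f' \<in> flat_algebra" "\<And>x. (f has_real_derivative f' x) (at x)"
  shows "(deriv ^^ k) f differentiable (at t)"
proof (cases k)
  case 0
  then show ?thesis using assms(2) real_differentiable_def by auto
next
  case (Suc m)
  have "deriv f = f'" using assms(2) by (intro ext DERIV_imp_deriv)
  then have "(deriv ^^ k) f = (deriv ^^ m) f'"
    using Suc by (simp del: funpow.simps add: funpow_Suc_right)
  then have "(deriv ^^ k) f \<in> flat_algebra"
    using assms(1) flat_algebra_funpow_deriv by simp
  then show ?thesis
    using flat_algebra_DERIV real_differentiable_def by blast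
qed

text \<open>\<open>E\<close> is an antiderivative of the bump exp(-1/x) exp(-1/(1-x)) on (0,1),
  shifted and scaled so that it rises from 0 to 1.\<close>

lemma smooth_step:
  obtains E \<rho> where "\<rho> \<in> flat_algebra" "\<And>x. (E has_real_derivative \<rho> x) (at x)"
    "\<And>x. x \<le> 0 \<Longrightarrow> E x = 0" "\<And>x. 1 \<le> x \<Longrightarrow> E x = 1" "mono E"
    "\<And>x. 0 \<le> \<rho> x" "\<And>x. x \<notin> {0<..<1} \<Longrightarrow> \<rho> x = 0"
proof -
  define \<rho> where "\<rho> x = flat 0 (1 * x + 0) * flat 0 ((-1) * x + 1)" for x
  have \<rho>: "\<rho> \<in> flat_algebra" unfolding \<rho>_def by (intro flat_algebra.intros)
  have \<rho>0: "0 \<le> \<rho> x" for x by (auto simp: \<rho>_def flat_def)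
  have \<rho>1: "\<rho> x = 0" if "x \<notin> {0<..<1}" for x using that by (auto simp: \<rho>_def flat_def)
  have \<rho>2: "\<rho> x > 0" if "x \<in> {0<..<1}" for x using that by (auto simp: \<rho>_def flat_def)
  obtain F where "\<forall>x. (F has_vector_derivative \<rho> x) (at x)"
    using einterval_antiderivative[of "-\<infinity>" "\<infinity>" \<rho>] flat_algebra_continuous[OF \<rho>, of UNIV]
    by (auto simp: continuous_on_eq_continuous_at)
  then have F: "(F has_real_derivative \<rho> x) (at x)" for x
    by (simp add: has_real_derivative_iff_has_vector_derivative)
  have monoF: "F x \<le> F y" if "x \<le> y" for x y
    using F \<rho>0 by (intro DERIV_nonneg_imp_nondecreasing[OF that]) blast
  have contF: "continuous_on S F" for S
    using F by (meson DERIV_continuous continuous_at_imp_continuous_on)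
  have F01: "F 0 < F 1"
    by (rule DERIV_pos_imp_increasing_open) (use F \<rho>2 contF in \<open>auto simp: continuous_on_eq_continuous_at\<close>)
  have Fneg: "F x = F 0" if "x \<le> 0" for x
    using DERIV_nonpos_imp_nonincreasing[OF that, of F] F \<rho>1 monoF[OF that] by fastforce
  have Fpos: "F x = F 1" if "1 \<le> x" for x
    using DERIV_nonpos_imp_nonincreasing[OF that, of F] F \<rho>1 monoF[OF that] by fastforce
  define d where "d = 1 / (F 1 - F 0)"
  have d: "d > 0" "(F 1 - F 0) * d = 1" using F01 by (auto simp: d_def)
  show thesis
  proof (rule that[of "\<lambda>x. \<rho> x * d" "\<lambda>x. (F x - F 0) * d"])
    show "(\<lambda>x. \<rho> x * d) \<in> flat_algebra" by (intro flat_algebra.intros \<rho>)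
    show "((\<lambda>x. (F x - F 0) * d) has_real_derivative \<rho> x * d) (at x)" for x
      using F[of x] by (auto intro!: derivative_eq_intros)
    show "mono (\<lambda>x. (F x - F 0) * d)"
      using d monoF by (intro monoI mult_right_mono) auto
    show "(F x - F 0) * d = 0" if "x \<le> 0" for x
      using Fneg[OF that] by simp
    show "(F x - F 0) * d = 1" if "1 \<le> x" for x
      using Fpos[OF that] d(2) by simp
    show "0 \<le> \<rho> x * d" for x using \<rho>0 d(1) by simp
    show "\<rho> x * d = 0" if "x \<notin> {0<..<1}" for x using \<rho>1[OF that] by simp
  qed
qed

text \<open>\<open>\<phi> n\<close> is the difference of two smooth steps of width r/(n+1), one
  starting at s and one at t. Both rise to the right of their starting point, so all supports stay
  in [s, t+r], inside (a,b), the limit is the indicator of the half-open interval, and the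
  derivative is a difference of two one-sided mollifiers.\<close>

lemma smooth_test_fun_approx_indicator:
  assumes "a < s" "s < t" "t < b"
  obtains \<phi> \<rho> :: "nat \<Rightarrow> real \<Rightarrow> real" and r :: real where
    "0 < r" "t + r < b"
    "\<And>n. smooth_test_fun a b (\<phi> n)"
    "\<And>n x. 0 \<le> \<phi> n x" "\<And>n x. \<phi> n x \<le> 1"
    "\<And>n x. x \<notin> {s..t+r} \<Longrightarrow> \<phi> n x = 0"
    "\<And>x. (\<lambda>n. \<phi> n x) \<longlonglongrightarrow> indicator {s<..t} x"
    "\<And>n x. deriv (\<phi> n) x = \<rho> n (x - s) - \<rho> n (x - t)"
    "\<And>n. continuous_on UNIV (\<phi> n)"
    "\<And>n. continuous_on UNIV (\<rho> n)"
    "\<And>n x. 0 \<le> \<rho> n x"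
    "\<And>n x. x \<notin> {0..r / Suc n} \<Longrightarrow> \<rho> n x = 0"
    "\<And>n. (\<rho> n has_integral 1) {0..r / Suc n}"
proof -
  obtain E \<rho> where \<rho>: "\<rho> \<in> flat_algebra" and E: "\<And>x. (E has_real_derivative \<rho> x) (at x)"
    and E0: "\<And>x. x \<le> 0 \<Longrightarrow> E x = 0" and E1: "\<And>x. 1 \<le> x \<Longrightarrow> E x = 1" and mE: "mono E"
    and \<rho>0: "\<And>x. 0 \<le> \<rho> x" and \<rho>1: "\<And>x. x \<notin> {0<..<1} \<Longrightarrow> \<rho> x = 0"
    by (rule smooth_step, rule that)
  define r where "r = (b - t) / 2"
  have r: "0 < r" "t + r < b" using assms by (auto simp: r_def field_simps)
  define m where "m n = real (Suc n) / r" for n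
  have m: "m n > 0" for n using r by (simp add: m_def)
  define \<phi> where "\<phi> n x = E (m n * (x - s)) - E (m n * (x - t))" for n x
  define R where "R n x = m n * \<rho> (m n * x)" for n x
  have R: "R n \<in> flat_algebra" for n
    unfolding R_def using flat_algebra_affine[OF \<rho>, of "m n" 0] by (auto intro: flat_algebra.intros)
  have RE: "((\<lambda>x. E (m n * (x - c))) has_real_derivative R n (x - c)) (at x)" for n x c
  proof -
    have "((\<lambda>x. E (m n * (x - c))) has_real_derivative \<rho> (m n * (x - c)) * m n) (at x)"
      by (rule DERIV_chain2[OF E]) (auto intro!: derivative_eq_intros)
    then show ?thesis by (simp add: R_def mult.commute)
  qed
  have D\<phi>: "(\<phi> n has_real_derivative (R n (x - s) - R n (x - t))) (at x)" for n x
    unfolding \<phi>_def by (intro DERIV_diff RE)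
  have "(\<lambda>x. R n (1 * x + (- s)) + (-1) * R n (1 * x + (- t))) \<in> flat_algebra" for n
    by (intro flat_algebra.intros flat_algebra_affine R)
  then have RR: "(\<lambda>x. R n (x - s) - R n (x - t)) \<in> flat_algebra" for n by simp
  have supp: "\<phi> n x = 0" if "x \<notin> {s..t+r}" for n x
  proof (cases "x < s")
    case True
    then have "m n * (x - s) \<le> 0" "m n * (x - t) \<le> 0"
      using m[of n] assms by (auto simp: mult_le_0_iff)
    then show ?thesis by (simp add: \<phi>_def E0)
  next
    case False
    then have x: "x > t + r" using that by auto
    then have "m n * r \<le> m n * (x - t)" using m[of n] by (intro mult_left_mono) auto
    moreover have "m n * r \<ge> 1" using r by (simp add: m_def)
    ultimately have "1 \<le> m n * (x - t)" by linarith
    moreover have "m n * (x - t) \<le> m n * (x - s)" using m[of n] assms by (intro mult_left_mono) auto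
    ultimately show ?thesis by (simp add: \<phi>_def E1)
  qed
  have E01: "0 \<le> E x" "E x \<le> 1" for x
    using monoD[OF mE, of "min x 0" x] monoD[OF mE, of x "max x 1"] E0[of "min x 0"] E1[of "max x 1"] by auto
  have mlim: "filterlim m at_top sequentially"
  proof -
    have "filterlim (\<lambda>n. real (Suc n)) at_top sequentially"
      by (intro filterlim_compose[OF filterlim_real_sequentially] filterlim_Suc)
    then have "filterlim (\<lambda>n. (1/r) * real (Suc n)) at_top sequentially"
      by (intro filterlim_tendsto_pos_mult_at_top[OF tendsto_const]) (use r in auto)
    then show ?thesis by (simp add: m_def[abs_def])
  qed
  have Elim: "(\<lambda>n. E (m n * y)) \<longlonglongrightarrow> (if 0 < y then 1 else 0)" for y
  proof (cases "0 < y")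
    case True
    have "\<forall>\<^sub>F n in sequentially. 1 / y \<le> m n"
      using mlim by (simp add: filterlim_at_top)
    then have "\<forall>\<^sub>F n in sequentially. 1 = E (m n * y)"
      by eventually_elim (use True in \<open>auto simp: field_simps E1\<close>)
    then show ?thesis using True by (intro Lim_transform_eventually[OF tendsto_const]) auto
  next
    case False
    then have "m n * y \<le> 0" for n using m[of n] by (auto simp: mult_le_0_iff)
    then show ?thesis using False by (simp add: E0)
  qed
  show thesis
  proof (rule that[of r \<phi> R])
    show "smooth_test_fun a b (\<phi> n)" for n
      unfolding smooth_test_fun_def
    proof (intro conjI allI)
      show "(deriv ^^ k) (\<phi> n) differentiable at x" for k x
        by (rule smooth_if_DERIV_flat_algebra[OF RR D\<phi>])
      show "\<exists>c d. a < c \<and> d < b \<and> (\<forall>x. x \<notin> {c..d} \<longrightarrow> \<phi> n x = 0)"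
        using assms r supp by (intro exI[of _ s] exI[of _ "t + r"]) auto
    qed
    show "0 \<le> \<phi> n x" for n x
    proof -
      have "m n * (x - t) \<le> m n * (x - s)" using m[of n] assms by (intro mult_left_mono) auto
      then show ?thesis using monoD[OF mE] by (simp add: \<phi>_def)
    qed
    show "\<phi> n x \<le> 1" for n x
      using E01(2)[of "m n * (x - s)"] E01(1)[of "m n * (x - t)"] by (simp add: \<phi>_def)
    show "(\<lambda>n. \<phi> n x) \<longlonglongrightarrow> indicator {s<..t} x" for x
    proof -
      have "(\<lambda>n. \<phi> n x) \<longlonglongrightarrow> (if 0 < x - s then 1 else 0) - (if 0 < x - t then 1 else 0)"
        unfolding \<phi>_def by (intro tendsto_diff Elim)
      moreover have "(if 0 < x - s then 1 else 0) - (if 0 < x - t then 1 else 0) = (indicator {s<..t} x :: real)"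
        using assms by (auto simp: indicator_def)
      ultimately show ?thesis by simp
    qed
    show "deriv (\<phi> n) x = R n (x - s) - R n (x - t)" for n x
      using D\<phi> by (rule DERIV_imp_deriv)
    show "continuous_on UNIV (\<phi> n)" for n
      using D\<phi> by (meson DERIV_continuous continuous_at_imp_continuous_on)
    show "continuous_on UNIV (R n)" for n by (rule flat_algebra_continuous[OF R])
    show "0 \<le> R n x" for n x using m[of n] \<rho>0 by (simp add: R_def)
    show "R n x = 0" if "x \<notin> {0..r / Suc n}" for n x
    proof -
      have "m n * x \<notin> {0<..<1}"
      proof (cases "x < 0")
        case True
        then show ?thesis using m[of n] by (auto simp: zero_less_mult_iff)
      next
        case False
        then have "r / Suc n \<le> x" using that by simp
        then have "m n * (r / Suc n) \<le> m n * x" using m[of n] by (intro mult_left_mono) auto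
        then show ?thesis using r by (simp add: m_def)
      qed
      then show ?thesis by (simp add: R_def \<rho>1)
    qed
    show "(R n has_integral 1) {0..r / Suc n}" for n
    proof -
      have "(R n has_integral (E (m n * (r / Suc n - 0)) - E (m n * (0 - 0)))) {0..r / Suc n}"
      proof (rule fundamental_theorem_of_calculus)
        show "0 \<le> r / Suc n" using r by simp
        show "((\<lambda>x. E (m n * (x - 0))) has_vector_derivative R n x) (at x within {0..r / Suc n})" for x
          using RE[of n 0 x]
          by (simp add: has_real_derivative_iff_has_vector_derivative has_vector_derivative_at_within)
      qed
      moreover have "E (m n * (r / Suc n - 0)) - E (m n * (0 - 0)) = 1"
        using r by (simp add: m_def E0 E1)
      ultimately show ?thesis by metis
    qed
  qed (use r supp in auto)
qed

section \<open>Weak derivatives\<close>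

lemma AE_lebesgue_neq: "AE x in lebesgue. x \<noteq> (c::real)"
  by (rule AE_completion[OF AE_lborel_singleton])

lemma loc_integrable_set_integrable:
  fixes f :: "real \<Rightarrow> 'x::real_normed_vector" and l :: "'x \<Rightarrow>\<^sub>L real"
  assumes f: "loc_integrable a b f" and c: "a < c" and d: "d < b"
  shows "set_integrable lebesgue {c..d} (\<lambda>t. l (f t))"
  unfolding set_integrable_def
proof (rule integrableI_bounded)
  have sub: "{c..d} \<subseteq> {a<..<b}" using c d by auto
  have "strongly_measurable_on {c..d} f"
    using f strongly_measurable_on_subset[OF _ _ sub] unfolding loc_integrable_def by auto
  then have "(\<lambda>t. l (f t)) \<in> borel_measurable (lebesgue_on {c..d})"
    by (rule strongly_measurable_on_compose[rotated]) (auto intro: linear_continuous_on blinfun.bounded_linear_right)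
  then have "(\<lambda>t. if t \<in> {c..d} then l (f t) else 0) \<in> borel_measurable lebesgue"
    by (subst borel_measurable_if) auto
  also have "(\<lambda>t. if t \<in> {c..d} then l (f t) else 0) = (\<lambda>t. indicator {c..d} t *\<^sub>R l (f t))"
    by (auto simp: indicator_def)
  finally show "(\<lambda>t. indicator {c..d} t *\<^sub>R l (f t)) \<in> borel_measurable lebesgue" .
  have "(\<integral>\<^sup>+ t. ennreal (norm (indicator {c..d} t *\<^sub>R l (f t))) \<partial>lebesgue)
      \<le> (\<integral>\<^sup>+ t. ennreal (norm l) * (ennreal (norm (f t)) * indicator {c..d} t) \<partial>lebesgue)"
    by (intro nn_integral_mono)
       (auto simp: indicator_def norm_blinfun simp flip: ennreal_mult real_norm_def)
  also have "\<dots> \<le> ennreal (norm l) * (\<integral>\<^sup>+ t. ennreal (norm (f t)) * indicator {c..d} t \<partial>lebesgue)"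
  proof (subst nn_integral_cmult)
    show "(\<lambda>t. ennreal (norm (f t)) * indicator {c..d} t) \<in> borel_measurable lebesgue"
      using strongly_measurable_on_norm[OF _ \<open>strongly_measurable_on {c..d} f\<close>]
      by (intro borel_measurable_ennreal_indicator) auto
  qed simp
  also have "\<dots> < \<infinity>"
    using f c d unfolding loc_integrable_def by (auto simp: ennreal_mult_less_top)
  finally show "(\<integral>\<^sup>+ t. ennreal (norm (indicator {c..d} t *\<^sub>R l (f t))) \<partial>lebesgue) < \<infinity>" .
qed

lemma integral_test_fun_tendsto:
  fixes k :: "real \<Rightarrow> real"
  assumes ab: "a < s" "s < t" "0 < r" "t + r < b"
    and k: "set_integrable lebesgue {s..t+r} k"
    and \<phi>: "\<And>n x. 0 \<le> \<phi> n x" "\<And>n x. \<phi> n x \<le> (1::real)" "\<And>n. continuous_on UNIV (\<phi> n)"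
      "\<And>n x. x \<notin> {s..t+r} \<Longrightarrow> \<phi> n x = 0"
      "\<And>x. (\<lambda>n. \<phi> n x) \<longlonglongrightarrow> indicator {s<..t} x"
  shows "(\<lambda>n. LINT x:{a<..<b}|lebesgue. \<phi> n x * k x) \<longlonglongrightarrow> (LINT x:{s..t}|lebesgue. k x)"
proof -
  let ?k = "\<lambda>x. indicator {s..t+r} x *\<^sub>R k x"
  have k': "integrable lebesgue ?k" using k by (simp add: set_integrable_def)
  then have km: "?k \<in> borel_measurable lebesgue" by simp
  have \<phi>m: "\<phi> n \<in> borel_measurable lebesgue" for n
    using \<phi>(3)[of n] by (intro measurable_completion) (simp add: borel_measurable_continuous_onI)
  have "(\<lambda>n. LINT x|lebesgue. \<phi> n x * ?k x) \<longlonglongrightarrow> (LINT x|lebesgue. indicator {s..t} x *\<^sub>R k x)"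
  proof (rule integral_dominated_convergence[where w="\<lambda>x. norm (?k x)"])
    show "(\<lambda>x. indicator {s..t} x *\<^sub>R k x) \<in> borel_measurable lebesgue"
      using set_integrable_subset[OF k, of "{s..t}"] ab
      by (simp add: set_integrable_def borel_measurable_integrable)
    show "(\<lambda>x. \<phi> n x * ?k x) \<in> borel_measurable lebesgue" for n
      using km \<phi>m by (intro borel_measurable_times)
    show "integrable lebesgue (\<lambda>x. norm (?k x))" using k' by (rule integrable_norm)
    show "AE x in lebesgue. (\<lambda>n. \<phi> n x * ?k x) \<longlonglongrightarrow> indicator {s..t} x *\<^sub>R k x"
      using AE_lebesgue_neq[of s]
    proof eventually_elim
      case (elim x)
      have "(\<lambda>n. \<phi> n x * ?k x) \<longlonglongrightarrow> indicator {s<..t} x * ?k x"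
        by (intro tendsto_mult \<phi>(5) tendsto_const)
      also have "indicator {s<..t} x * ?k x = indicator {s..t} x *\<^sub>R k x"
        using elim ab by (auto simp: indicator_def)
      finally show ?case .
    qed
    show "AE x in lebesgue. norm (\<phi> n x * ?k x) \<le> norm (?k x)" for n
      using \<phi>(1,2)[of n] by (intro AE_I2) (simp add: abs_mult mult_left_le_one_le)
  qed
  moreover have "(LINT x|lebesgue. \<phi> n x * ?k x) = (LINT x:{a<..<b}|lebesgue. \<phi> n x * k x)" for n
    unfolding set_lebesgue_integral_def
    by (rule Bochner_Integration.integral_cong) (use \<phi>(4)[of _ n] ab in \<open>auto simp: indicator_def\<close>)
  ultimately show ?thesis by (simp add: set_lebesgue_integral_def)
qed

text \<open>The kernel has mass 1 and sits on [s, s + r/(n+1)], so only values of \<open>h\<close>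
  just to the right of s enter, and their oscillation tends to 0 by continuity.\<close>

lemma integral_mollifier_tendsto:
  fixes h :: "real \<Rightarrow> real"
  assumes ab: "a < s" "0 < r" "s + r < b" and h: "continuous_on {s..s+r} h"
    and \<rho>: "\<And>n. continuous_on UNIV (\<rho> n)" "\<And>n x. 0 \<le> \<rho> n x"
      "\<And>n x. x \<notin> {0..r / Suc n} \<Longrightarrow> \<rho> n x = 0" "\<And>n. (\<rho> n has_integral 1) {0..r / Suc n}"
  shows "\<And>n. set_integrable lebesgue {a<..<b} (\<lambda>x. \<rho> n (x - s) * h x)"
    and "(\<lambda>n. LINT x:{a<..<b}|lebesgue. \<rho> n (x - s) * h x) \<longlonglongrightarrow> h s"
proof -
  define e where "e n = r / Suc n" for n
  have e: "0 < e n" "e n \<le> r" for n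
    using ab by (auto simp: e_def field_simps mult_le_cancel_left1)
  have cont: "continuous_on {s..s + e n} (\<lambda>x. \<rho> n (x - s) * h x)" for n
  proof (intro continuous_on_mult)
    show "continuous_on {s..s + e n} (\<lambda>x. \<rho> n (x - s))"
      by (rule continuous_on_compose2[OF \<rho>(1)]) (auto intro: continuous_intros)
    show "continuous_on {s..s + e n} h"
      by (rule continuous_on_subset[OF h]) (use e[of n] in auto)
  qed
  then have int: "set_integrable lebesgue {s..s + e n} (\<lambda>x. \<rho> n (x - s) * h x)" for n
    by (rule absolutely_integrable_continuous_real)
  have eq: "(\<lambda>x. indicator {a<..<b} x *\<^sub>R (\<rho> n (x - s) * h x)) = (\<lambda>x. indicator {s..s + e n} x *\<^sub>R (\<rho> n (x - s) * h x))" for n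
  proof
    fix x
    show "indicator {a<..<b} x *\<^sub>R (\<rho> n (x - s) * h x) = indicator {s..s + e n} x *\<^sub>R (\<rho> n (x - s) * h x)"
    proof (cases "x \<in> {s..s + e n}")
      case True
      then show ?thesis using ab e[of n] by auto
    next
      case False
      then have "\<rho> n (x - s) = 0" by (intro \<rho>(3)) (auto simp: e_def)
      then show ?thesis by simp
    qed
  qed
  show "set_integrable lebesgue {a<..<b} (\<lambda>x. \<rho> n (x - s) * h x)" for n
    using int[of n] unfolding set_integrable_def eq .
  have one: "((\<lambda>x. \<rho> n (x - s)) has_integral 1) {s..s + e n}" for n
    using has_integral_shift_real_ivl[OF \<rho>(4), of n "- s"] by (simp add: e_def add.commute)
  have elim: "e \<longlonglongrightarrow> 0"
    unfolding e_def using tendsto_mult[OF tendsto_const[of r] LIMSEQ_inverse_real_of_nat]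
    by (simp add: field_simps)
  show "(\<lambda>n. LINT x:{a<..<b}|lebesgue. \<rho> n (x - s) * h x) \<longlonglongrightarrow> h s"
  proof (rule LIMSEQ_I)
    fix \<epsilon> :: real assume \<epsilon>: "\<epsilon> > 0"
    obtain d where d: "d > 0" "\<And>x. x \<in> {s..s+r} \<Longrightarrow> dist x s < d \<Longrightarrow> dist (h x) (h s) < \<epsilon>/2"
      using h ab \<epsilon> unfolding continuous_on_iff by (metis atLeastAtMost_iff half_gt_zero le_add_same_cancel1 less_eq_real_def)
    obtain N where N: "\<And>n. n \<ge> N \<Longrightarrow> e n < d"
      using order_tendstoD(2)[OF elim d(1)] by (auto simp: eventually_sequentially)
    have "norm ((LINT x:{a<..<b}|lebesgue. \<rho> n (x - s) * h x) - h s) < \<epsilon>" if "n \<ge> N" for n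
    proof -
      have "(LINT x:{a<..<b}|lebesgue. \<rho> n (x - s) * h x) = (LINT x:{s..s + e n}|lebesgue. \<rho> n (x - s) * h x)"
        unfolding set_lebesgue_integral_def eq ..
      also have "\<dots> = integral {s..s + e n} (\<lambda>x. \<rho> n (x - s) * h x)"
        by (rule set_lebesgue_integral_eq_integral[OF int])
      finally have "(LINT x:{a<..<b}|lebesgue. \<rho> n (x - s) * h x) - h s =
          integral {s..s + e n} (\<lambda>x. \<rho> n (x - s) * h x) - integral {s..s + e n} (\<lambda>x. \<rho> n (x - s) * h s)"
        using integral_unique[OF has_integral_mult_left[OF one[of n], of "h s"]] by simp
      also have "\<dots> = integral {s..s + e n} (\<lambda>x. \<rho> n (x - s) * h x - \<rho> n (x - s) * h s)"
        using one[of n] cont[of n]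
        by (intro Henstock_Kurzweil_Integration.integral_diff[symmetric])
           (auto intro: integrable_on_mult_left integrable_continuous_real)
      also have "norm \<dots> \<le> integral {s..s + e n} (\<lambda>x. \<rho> n (x - s) * (\<epsilon>/2))"
      proof (rule integral_norm_bound_integral)
        show "(\<lambda>x. \<rho> n (x - s) * h x - \<rho> n (x - s) * h s) integrable_on {s..s + e n}"
          using one[of n] cont[of n]
          by (intro integrable_diff) (auto intro: integrable_on_mult_left integrable_continuous_real)
        show "(\<lambda>x. \<rho> n (x - s) * (\<epsilon>/2)) integrable_on {s..s + e n}"
          using one[of n] by (auto intro: integrable_on_mult_left)
        fix x assume x: "x \<in> {s..s + e n}"
        then have "dist (h x) (h s) < \<epsilon>/2"
          using N[OF that] e[of n] by (intro d(2)) (auto simp: dist_norm)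
        then have "\<rho> n (x - s) * norm (h x - h s) \<le> \<rho> n (x - s) * (\<epsilon>/2)"
          using \<rho>(2) by (intro mult_left_mono) (auto simp: dist_norm)
        then show "norm (\<rho> n (x - s) * h x - \<rho> n (x - s) * h s) \<le> \<rho> n (x - s) * (\<epsilon>/2)"
          using \<rho>(2) by (simp add: abs_mult flip: right_diff_distrib)
      qed
      also have "\<dots> = \<epsilon>/2"
        using integral_unique[OF has_integral_mult_left[OF one[of n], of "\<epsilon>/2"]] by simp
      finally show ?thesis using \<epsilon> by simp
    qed
    then show "\<exists>N. \<forall>n\<ge>N. norm ((LINT x:{a<..<b}|lebesgue. \<rho> n (x - s) * h x) - h s) < \<epsilon>" by blast
  qed
qed

text \<open>Test the weak derivative with the smooth approximations of the indicator of (s,t]. The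
  side with \<open>deriv (\<phi> n)\<close> consists of two mollified values of the continuous
  representative and tends to l (w s) - l (w t); the other side tends to minus the integral by
  dominated convergence.\<close>

lemma weak_deriv_on_FTC:
  fixes f g :: "real \<Rightarrow> 'x::real_normed_vector" and l :: "'x \<Rightarrow>\<^sub>L real"
  assumes fg: "weak_deriv_on a b f g" and w: "continuous_on {a..b} w"
    and wf: "AE t in lebesgue_on {a<..<b}. w t = f t" and ab: "a < s" "s < t" "t < b"
  shows "l (w t) - l (w s) = (LINT x:{s..t}|lebesgue. l (g x))"
proof -
  obtain \<phi> \<rho> :: "nat \<Rightarrow> real \<Rightarrow> real" and r :: real where r: "0 < r" "t + r < b"
    and test: "\<And>n. smooth_test_fun a b (\<phi> n)"
    and \<phi>: "\<And>n x. 0 \<le> \<phi> n x" "\<And>n x. \<phi> n x \<le> 1"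
    "\<And>n x. x \<notin> {s..t+r} \<Longrightarrow> \<phi> n x = 0"
    "\<And>x. (\<lambda>n. \<phi> n x) \<longlonglongrightarrow> indicator {s<..t} x"
    and D: "\<And>n x. deriv (\<phi> n) x = \<rho> n (x - s) - \<rho> n (x - t)"
    and \<phi>c: "\<And>n. continuous_on UNIV (\<phi> n)"
    and \<rho>: "\<And>n. continuous_on UNIV (\<rho> n)"
    "\<And>n x. 0 \<le> \<rho> n x"
    "\<And>n x. x \<notin> {0..r / Suc n} \<Longrightarrow> \<rho> n x = 0"
    "\<And>n. (\<rho> n has_integral 1) {0..r / Suc n}"
    by (rule smooth_test_fun_approx_indicator[OF ab], rule that)
  have weak: "(LINT x:{a<..<b}|lebesgue. deriv (\<phi> n) x * l (f x)) = - (LINT x:{a<..<b}|lebesgue. \<phi> n x * l (g x))" for n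
    using fg test unfolding weak_deriv_on_def by blast
  have g: "set_integrable lebesgue {s..t+r} (\<lambda>x. l (g x))"
    using fg ab r unfolding weak_deriv_on_def by (intro loc_integrable_set_integrable) auto
  have rhs: "(\<lambda>n. LINT x:{a<..<b}|lebesgue. \<phi> n x * l (g x)) \<longlonglongrightarrow> (LINT x:{s..t}|lebesgue. l (g x))"
    by (rule integral_test_fun_tendsto[OF ab(1,2) r g \<phi>(1,2) \<phi>c \<phi>(3,4)])
  define h where "h x = l (w x)" for x
  have h: "continuous_on {a..b} h"
    unfolding h_def by (intro continuous_intros w)
  have hs: "continuous_on {s..s+r} h" "continuous_on {t..t+r} h"
    using ab r by (auto intro: continuous_on_subset[OF h])
  have srb: "s + r < b" "a < t" using ab r by auto
  note ms = integral_mollifier_tendsto[of a s r b h \<rho>, OF ab(1) r(1) srb(1) hs(1) \<rho>]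
  note mt = integral_mollifier_tendsto[of a t r b h \<rho>, OF srb(2) r hs(2) \<rho>]
  have "(LINT x:{a<..<b}|lebesgue. deriv (\<phi> n) x * l (f x)) =
      (LINT x:{a<..<b}|lebesgue. \<rho> n (x - s) * h x) - (LINT x:{a<..<b}|lebesgue. \<rho> n (x - t) * h x)" for n
  proof -
    let ?F = "\<lambda>x. indicator {a<..<b} x *\<^sub>R (\<rho> n (x - s) * h x - \<rho> n (x - t) * h x)"
    have ae: "AE x in lebesgue. ?F x = indicator {a<..<b} x *\<^sub>R (deriv (\<phi> n) x * l (f x))"
    proof -
      have "AE x in lebesgue. x \<in> {a<..<b} \<longrightarrow> w x = f x"
        using wf by (simp add: AE_restrict_space_iff)
      then show ?thesis
        by eventually_elim (auto simp: D h_def indicator_def algebra_simps)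
    qed
    have "set_integrable lebesgue {a<..<b} (\<lambda>x. \<rho> n (x - s) * h x - \<rho> n (x - t) * h x)"
      using ms(1)[of n] mt(1)[of n] by (rule set_integral_diff)
    then have Fm: "?F \<in> borel_measurable lebesgue"
      by (simp add: set_integrable_def borel_measurable_integrable)
    have "(LINT x|lebesgue. ?F x) = (LINT x|lebesgue. indicator {a<..<b} x *\<^sub>R (deriv (\<phi> n) x * l (f x)))"
      by (rule integral_cong_AE[OF Fm borel_measurable_AE[OF Fm ae] ae])
    then have "(LINT x:{a<..<b}|lebesgue. deriv (\<phi> n) x * l (f x)) =
        (LINT x:{a<..<b}|lebesgue. \<rho> n (x - s) * h x - \<rho> n (x - t) * h x)"
      by (simp add: set_lebesgue_integral_def)
    also have "\<dots> = (LINT x:{a<..<b}|lebesgue. \<rho> n (x - s) * h x) - (LINT x:{a<..<b}|lebesgue. \<rho> n (x - t) * h x)"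
      using ms(1)[of n] mt(1)[of n] by (rule set_integral_diff)
    finally show ?thesis .
  qed
  then have "(\<lambda>n. - (LINT x:{a<..<b}|lebesgue. \<phi> n x * l (g x))) \<longlonglongrightarrow> h s - h t"
    using tendsto_diff[OF ms(2) mt(2)] weak by simp
  from LIMSEQ_unique[OF this tendsto_minus[OF rhs]] show ?thesis by (simp add: h_def)
qed

text \<open>A functional norming w t - w s turns the scalar identity into a norm estimate, so no
  vector-valued integral of \<open>g\<close> occurs.\<close>

lemma weak_deriv_on_norm_diff_le_interior:
  fixes f g :: "real \<Rightarrow> 'x::real_normed_vector"
  assumes fg: "weak_deriv_on a b f g" and w: "continuous_on {a..b} w"
    and wf: "AE t in lebesgue_on {a<..<b}. w t = f t" and ab: "a < s" "s < t" "t < b"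
  shows "ennreal (norm (w t - w s)) \<le> (\<integral>\<^sup>+x. ennreal (norm (g x)) * indicator {s<..<t} x \<partial>lebesgue)"
proof -
  obtain l :: "'x \<Rightarrow>\<^sub>L real" where l: "\<And>y. \<bar>l y\<bar> \<le> norm y" "l (w t - w s) = norm (w t - w s)"
    using norming_functional by blast
  have int: "set_integrable lebesgue {s..t} (\<lambda>x. l (g x))"
    using fg ab unfolding weak_deriv_on_def by (intro loc_integrable_set_integrable) auto
  have "norm (w t - w s) = (LINT x:{s..t}|lebesgue. l (g x))"
    using weak_deriv_on_FTC[OF assms, of l] l(2) by (simp add: blinfun.diff_right)
  then have "ennreal (norm (w t - w s)) = ennreal (norm (LINT x|lebesgue. indicator {s..t} x *\<^sub>R l (g x)))"
    unfolding set_lebesgue_integral_def by (metis abs_norm_cancel real_norm_def)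
  also have "\<dots> \<le> (\<integral>\<^sup>+x. norm (indicator {s..t} x *\<^sub>R l (g x)) \<partial>lebesgue)"
    using int by (intro integral_norm_bound_ennreal) (simp add: set_integrable_def)
  also have "\<dots> \<le> (\<integral>\<^sup>+x. ennreal (norm (g x)) * indicator {s<..<t} x \<partial>lebesgue)"
  proof (rule nn_integral_mono_AE)
    show "AE x in lebesgue. ennreal (norm (indicator {s..t} x *\<^sub>R l (g x))) \<le> ennreal (norm (g x)) * indicator {s<..<t} x"
      using AE_lebesgue_neq[of s] AE_lebesgue_neq[of t]
      by eventually_elim (auto simp: indicator_def l(1))
  qed
  finally show ?thesis .
qed

text \<open>Test functions reach only interior points. The left endpoint, where the initial value
  sits, is included by continuity of \<open>w\<close>.\<close>

lemma weak_deriv_on_norm_diff_le: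
  fixes f g :: "real \<Rightarrow> 'x::real_normed_vector"
  assumes fg: "weak_deriv_on a b f g" and w: "continuous_on {a..b} w"
    and wf: "AE t in lebesgue_on {a<..<b}. w t = f t" and ab: "a \<le> s" "s < t" "t < b"
  shows "ennreal (norm (w t - w s)) \<le> (\<integral>\<^sup>+x. ennreal (norm (g x)) * indicator {s<..<t} x \<partial>lebesgue)"
proof -
  \<comment> \<open>The denominator n+2 instead of n+1 keeps every \<open>s' n\<close> strictly
    below t.\<close>
  define s' where "s' n = s + (t - s) * inverse (real (Suc (Suc n)))" for n
  have lim: "s' \<longlonglongrightarrow> s"
  proof -
    have "(\<lambda>n. s + (t - s) * inverse (real (Suc (Suc n)))) \<longlonglongrightarrow> s + (t - s) * 0"
      by (intro tendsto_intros LIMSEQ_Suc[OF LIMSEQ_inverse_real_of_nat])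
    then show ?thesis by (simp add: s'_def[abs_def])
  qed
  have s': "s < s' n" "s' n < t" for n
  proof -
    show "s < s' n" using ab by (simp add: s'_def)
    have "inverse (real (Suc (Suc n))) < 1" by (simp add: inverse_less_1_iff)
    then have "(t - s) * inverse (real (Suc (Suc n))) < (t - s) * 1"
      using ab by (intro mult_strict_left_mono) auto
    then show "s' n < t" by (simp add: s'_def)
  qed
  have "(\<lambda>n. w (s' n)) \<longlonglongrightarrow> w s"
    by (rule continuous_on_tendsto_compose[OF w lim])
       (use ab s' in \<open>auto intro!: always_eventually less_imp_le[OF le_less_trans[OF ab(1)]]
          less_imp_le[OF less_trans[OF _ ab(3)]]\<close>)
  then have "(\<lambda>n. ennreal (norm (w t - w (s' n)))) \<longlonglongrightarrow> ennreal (norm (w t - w s))"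
    by (intro tendsto_ennrealI tendsto_norm tendsto_diff tendsto_const)
  moreover have "ennreal (norm (w t - w (s' n))) \<le> (\<integral>\<^sup>+x. ennreal (norm (g x)) * indicator {s<..<t} x \<partial>lebesgue)" for n
  proof -
    have "a < s' n" using s'(1)[of n] ab by simp
    then have "ennreal (norm (w t - w (s' n))) \<le> (\<integral>\<^sup>+x. ennreal (norm (g x)) * indicator {s' n<..<t} x \<partial>lebesgue)"
      using s'(2) ab(3) by (intro weak_deriv_on_norm_diff_le_interior[OF fg w wf])
    also have "\<dots> \<le> (\<integral>\<^sup>+x. ennreal (norm (g x)) * indicator {s<..<t} x \<partial>lebesgue)"
      using s'(1)[of n] by (intro nn_integral_mono) (auto simp: indicator_def)
    finally show ?thesis .
  qed
  ultimately show ?thesis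
    by (metis (no_types, lifting) LIMSEQ_le_const2)
qed

text \<open>Lebesgue differentiation: outside a negligible set k x is the limit of the averages over
  [x, x+h], all of which vanish. This is done on compact subintervals, which exhaust (a,b) along a
  sequence so that the null sets can be collected.\<close>

lemma AE_zero_if_integral_zero:
  fixes k :: "real \<Rightarrow> real"
  assumes int: "\<And>c d. a < c \<Longrightarrow> d < b \<Longrightarrow> set_integrable lebesgue {c..d} k"
    and zero: "\<And>s t. a < s \<Longrightarrow> s < t \<Longrightarrow> t < b \<Longrightarrow> (LINT x:{s..t}|lebesgue. k x) = 0"
  shows "AE x in lebesgue. a < x \<longrightarrow> x < b \<longrightarrow> k x = 0"
proof -
  have part: "AE x in lebesgue. c < x \<longrightarrow> x < d \<longrightarrow> k x = 0" if cd: "a < c" "d < b" for c d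
  proof -
    let ?k = "\<lambda>x. if x \<in> {c..d} then k x else 0"
    have k: "k integrable_on {c..d}"
      using int[OF cd] by (rule set_lebesgue_integral_eq_integral)
    have "?k integrable_on UNIV"
      using k by (simp only: integrable_restrict_UNIV)
    then have "?k integrable_on cbox u v" for u v
      by (rule integrable_on_subcbox) simp
    then obtain N where N: "negligible N" "\<And>x e. x \<notin> N \<Longrightarrow> 0 < e \<Longrightarrow>
        \<exists>d>0. \<forall>h. 0 < h \<and> h < d \<longrightarrow> norm (integral (cbox x (x + h *\<^sub>R One)) ?k /\<^sub>R h ^ DIM(real) - ?k x) < e"
      by (rule integrable_ccontinuous_explicit[of ?k]) blast
    have "k x = 0" if x: "x \<notin> N" "c < x" "x < d" for x
    proof (rule ccontr)
      assume "k x \<noteq> 0"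
      then obtain e where e: "e > 0" "\<forall>h. 0 < h \<and> h < e \<longrightarrow> norm (integral {x..x + h} ?k /\<^sub>R h - ?k x) < norm (k x)"
        using N(2)[OF x(1), of "norm (k x)"] by auto
      define h where "h = min (e/2) ((d - x)/2)"
      have h: "0 < h" "h < e" "x + h < d" using e(1) x by (auto simp: h_def min_def field_simps)
      have "integral {x..x + h} ?k = integral {x..x + h} k"
        by (rule Henstock_Kurzweil_Integration.integral_cong) (use h x in auto)
      also have "\<dots> = (LINT y:{x..x + h}|lebesgue. k y)"
        using cd x h by (intro set_lebesgue_integral_eq_integral(2)[symmetric] int) auto
      also have "\<dots> = 0" using cd x h by (intro zero) auto
      finally have "norm (?k x) < norm (k x)" using e(2) h by fastforce
      then show False using x by simp
    qed
    then show ?thesis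
      using N(1) unfolding eventually_ae_filter_negligible by blast
  qed
  have "AE x in lebesgue. \<forall>n::nat. a + 1 / real (Suc n) < x \<longrightarrow> x < b - 1 / real (Suc n) \<longrightarrow> k x = 0"
    unfolding AE_all_countable by (intro allI part) auto
  then show ?thesis
  proof eventually_elim
    case (elim x)
    show ?case
    proof (intro impI)
      assume "a < x" "x < b"
      then obtain n where "inverse (real (Suc n)) < min (x - a) (b - x)"
        using reals_Archimedean[of "min (x - a) (b - x)"] by auto
      then show "k x = 0" using elim by (auto simp: inverse_eq_divide algebra_simps)
    qed
  qed
qed

text \<open>For each single functional the difference \<open>k\<close> is annihilated almost
  everywhere, but the null set depends on the functional. Since \<open>k\<close> takes almost all
  its values in the closure of a countable set, countably many norming functionals decide whether it
  vanishes.\<close>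

lemma weak_deriv_on_unique:
  fixes f g g' :: "real \<Rightarrow> 'x::real_normed_vector"
  assumes g: "weak_deriv_on a b f g" and g': "weak_deriv_on a b f g'"
  shows "AE t in lebesgue_on {a<..<b}. g t = g' t"
proof -
  define k where "k t = g t + (-1) *\<^sub>R g' t" for t
  have int: "set_integrable lebesgue {c..d} (\<lambda>x. l (g x))" "set_integrable lebesgue {c..d} (\<lambda>x. l (g' x))"
    if "a < c" "d < b" for c d and l :: "'x \<Rightarrow>\<^sub>L real"
    using g g' that unfolding weak_deriv_on_def by (auto intro: loc_integrable_set_integrable)
  have zero: "AE x in lebesgue. a < x \<longrightarrow> x < b \<longrightarrow> l (k x) = 0" for l :: "'x \<Rightarrow>\<^sub>L real"
  proof (rule AE_zero_if_integral_zero)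
    have lk: "l (k x) = l (g x) - l (g' x)" for x
      by (simp add: k_def blinfun.diff_right)
    show "set_integrable lebesgue {c..d} (\<lambda>x. l (k x))" if "a < c" "d < b" for c d
      unfolding lk using int[OF that] by (rule set_integral_diff)
    show "(LINT x:{s..t}|lebesgue. l (k x)) = 0" if ab: "a < s" "s < t" "t < b" for s t
    proof -
      obtain \<phi> \<rho> :: "nat \<Rightarrow> real \<Rightarrow> real" and r :: real where r: "0 < r" "t + r < b"
        and test: "\<And>n. smooth_test_fun a b (\<phi> n)"
        and \<phi>: "\<And>n x. 0 \<le> \<phi> n x" "\<And>n x. \<phi> n x \<le> 1"
        "\<And>n x. x \<notin> {s..t+r} \<Longrightarrow> \<phi> n x = 0"
        "\<And>x. (\<lambda>n. \<phi> n x) \<longlonglongrightarrow> indicator {s<..t} x"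
        and "\<And>n x. deriv (\<phi> n) x = \<rho> n (x - s) - \<rho> n (x - t)"
        and \<phi>c: "\<And>n. continuous_on UNIV (\<phi> n)"
        and "\<And>n. continuous_on UNIV (\<rho> n)"
        "\<And>n x. 0 \<le> \<rho> n x"
        "\<And>n x. x \<notin> {0..r / Suc n} \<Longrightarrow> \<rho> n x = 0"
        "\<And>n. (\<rho> n has_integral 1) {0..r / Suc n}"
        by (rule smooth_test_fun_approx_indicator[OF ab], rule that)
      have eq: "(LINT x:{a<..<b}|lebesgue. \<phi> n x * l (g x)) = (LINT x:{a<..<b}|lebesgue. \<phi> n x * l (g' x))" for n
      proof -
        have "- (LINT x:{a<..<b}|lebesgue. \<phi> n x * l (g x)) = (LINT x:{a<..<b}|lebesgue. deriv (\<phi> n) x * l (f x))"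
          using g test[of n] unfolding weak_deriv_on_def by simp
        also have "\<dots> = - (LINT x:{a<..<b}|lebesgue. \<phi> n x * l (g' x))"
          using g' test[of n] unfolding weak_deriv_on_def by simp
        finally show ?thesis by simp
      qed
      have lim: "(\<lambda>n. LINT x:{a<..<b}|lebesgue. \<phi> n x * m x) \<longlonglongrightarrow> (LINT x:{s..t}|lebesgue. m x)"
        if "set_integrable lebesgue {s..t+r} m" for m
        by (rule integral_test_fun_tendsto[OF ab(1,2) r that \<phi>(1,2) \<phi>c \<phi>(3,4)])
      have "(LINT x:{s..t}|lebesgue. l (g x)) = (LINT x:{s..t}|lebesgue. l (g' x))"
        using lim[OF int(1)[OF ab(1) r(2), of l]] lim[OF int(2)[OF ab(1) r(2), of l]]
        unfolding eq by (rule LIMSEQ_unique)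
      then show ?thesis
        unfolding lk using set_integral_diff(2)[OF int[OF ab(1,3)]] by simp
    qed
  qed
  have "strongly_measurable_on {a<..<b} k"
    unfolding k_def using g g' unfolding weak_deriv_on_def loc_integrable_def
    by (intro strongly_measurable_on_lincomb) auto
  then obtain D where D: "countable D" "AE t in lebesgue_on {a<..<b}. k t \<in> closure D"
    by (rule strongly_measurable_on_separable)
  have "\<exists>l :: 'x \<Rightarrow>\<^sub>L real. (\<forall>y. \<bar>l y\<bar> \<le> norm y) \<and> l d = norm d" for d
    using norming_functional[of d] by blast
  then obtain L :: "'x \<Rightarrow> 'x \<Rightarrow>\<^sub>L real" where L: "\<And>d y. \<bar>L d y\<bar> \<le> norm y" "\<And>d. L d d = norm d"
    by metis
  have "AE x in lebesgue. \<forall>d\<in>D. a < x \<longrightarrow> x < b \<longrightarrow> L d (k x) = 0"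
    by (subst AE_ball_countable[OF D(1)]) (intro ballI zero)
  moreover have "AE x in lebesgue. x \<in> {a<..<b} \<longrightarrow> k x \<in> closure D"
    using D(2) by (simp add: AE_restrict_space_iff)
  ultimately have "AE x in lebesgue. x \<in> {a<..<b} \<longrightarrow> g x = g' x"
  proof eventually_elim
    case (elim x)
    show ?case
    proof
      assume x: "x \<in> {a<..<b}"
      have "norm (k x) \<le> e" if "e > 0" for e
      proof -
        obtain d where d: "d \<in> D" "dist d (k x) < e/2"
          using elim(2) x \<open>e > 0\<close> by (metis closure_approachable half_gt_zero)
        \<comment> \<open>As \<open>L d\<close> kills k x, the norm of d is at most the distance
          from d to k x. A point d within e/2 of k x thus gives norm (k x) \<le> e.\<close>
        have "norm d = L d (d - k x)"
          using L(2) elim(1) d(1) x by (simp add: blinfun.diff_right)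
        also have "\<dots> \<le> norm (d - k x)" using L(1)[of d "d - k x"] by linarith
        finally have "norm d \<le> norm (d - k x)" .
        moreover have "norm (k x) \<le> norm d + norm (d - k x)"
          by (metis norm_minus_commute norm_triangle_sub)
        ultimately show ?thesis using d(2) by (simp add: dist_norm)
      qed
      then have "norm (k x) \<le> 0 + e" if "e > 0" for e using that by simp
      then have "norm (k x) \<le> 0" by (rule field_le_epsilon)
      then show "g x = g' x" by (simp add: k_def)
    qed
  qed
  then show ?thesis by (simp add: AE_restrict_space_iff)
qed

section \<open>The K-functional\<close>

lemma K_fun_bdd_below: "0 \<le> s \<Longrightarrow> bdd_below {norm x0 + s * norm x1 | x0 x1. x = x0 + blinfun_apply j x1}"
  by (rule bdd_belowI[of _ 0]) auto

lemma K_fun_le: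
  assumes "0 \<le> s" "x = x0 + blinfun_apply j x1"
  shows "K_fun j s x \<le> norm x0 + s * norm x1"
  unfolding K_fun_def using assms by (intro cInf_lower K_fun_bdd_below) auto

lemma K_fun_nonneg: "0 \<le> s \<Longrightarrow> 0 \<le> K_fun j s x"
  unfolding K_fun_def
proof (rule cInf_greatest)
  have "x = x + blinfun_apply j 0" by (simp add: blinfun.zero_right)
  then show "{norm x0 + s * norm x1 | x0 x1. x = x0 + blinfun_apply j x1} \<noteq> {}" by blast
qed auto

lemma nn_integral_has_integral_indicator:
  fixes f :: "real \<Rightarrow> real"
  assumes "\<And>x. x \<in> S \<Longrightarrow> 0 \<le> f x" "(f has_integral I) S"
  shows "(\<integral>\<^sup>+x. ennreal (f x) * indicator S x \<partial>lebesgue) = ennreal I"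
    and "(\<lambda>x. ennreal (f x) * indicator S x) \<in> borel_measurable lebesgue"
proof -
  have "(\<lambda>x. indicator S x *\<^sub>R f x) \<in> borel_measurable lebesgue"
    using assms(2) by (rule has_integral_implies_lebesgue_measurable)
  then have "(\<lambda>x. ennreal (indicator S x *\<^sub>R f x)) \<in> borel_measurable lebesgue" by measurable
  also have "(\<lambda>x. ennreal (indicator S x *\<^sub>R f x)) = (\<lambda>x. ennreal (f x) * indicator S x)"
    by (auto simp: indicator_def)
  finally show "(\<lambda>x. ennreal (f x) * indicator S x) \<in> borel_measurable lebesgue" .
  show "(\<integral>\<^sup>+x. ennreal (f x) * indicator S x \<partial>lebesgue) = ennreal I"
    unfolding nn_integral_completion by (rule nn_integral_has_integral_lebesgue'[OF assms])
qed

text \<open>The integrand is s^(1/q-2) times the K-functional. The linear bound is used on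
  [0,\<sigma>], where s^(1/q-1) is integrable, and the bound by s^(1-1/p) beyond \<sigma>, where
  s^(1/q-1/p-1) is integrable because p < q. The free parameter \<sigma> is chosen later, depending
  on the size of b.\<close>

lemma interp_integral_le:
  fixes j :: "'a::real_normed_vector \<Rightarrow>\<^sub>L 'b::real_normed_vector"
  assumes p: "1 < p" and q: "p < q" and V: "0 \<le> V" and N: "0 \<le> N" and \<sigma>: "0 < \<sigma>"
    and KV: "\<And>s. 0 < s \<Longrightarrow> K_fun j s x \<le> s * V"
    and KN: "\<And>s. 0 < s \<Longrightarrow> K_fun j s x \<le> N * s powr (1 - 1/p)"
  shows "interp_integral j (1 - 1/q) 1 x
    \<le> ennreal (q * \<sigma> powr (1/q) * V + N * \<sigma> powr (1/q - 1/p) / (1/p - 1/q))"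
proof -
  have q0: "1 < q" "0 < q" "1/q < 1/p" using p q by (auto simp: field_simps)
  let ?A = "\<lambda>s. ennreal (s powr (1/q - 1) * V) * indicator {0..\<sigma>} s"
  let ?B = "\<lambda>s. ennreal (s powr (1/q - 1/p - 1) * N) * indicator {\<sigma>..} s"
  have A: "((\<lambda>s. s powr (1/q - 1) * V) has_integral (q * \<sigma> powr (1/q)) * V) {0..\<sigma>}"
    using has_integral_mult_left[OF has_integral_powr_from_0[of "1/q - 1" \<sigma>], of V] q0 \<sigma>
    by (simp add: mult.commute)
  have "((\<lambda>s. s powr (1/q - 1/p - 1) * N) has_integral
      (- (\<sigma> powr (1/q - 1/p - 1 + 1)) / (1/q - 1/p - 1 + 1)) * N) {\<sigma>..}"
    using q0 \<sigma> by (intro has_integral_mult_left has_integral_powr_to_inf) auto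
  moreover have "(- (\<sigma> powr (1/q - 1/p - 1 + 1)) / (1/q - 1/p - 1 + 1)) * N
      = N * \<sigma> powr (1/q - 1/p) / (1/p - 1/q)"
  proof -
    have "(- X / - d) * N = N * X / d" for X d :: real by simp
    from this[of "\<sigma> powr (1/q - 1/p)" "1/p - 1/q"] show ?thesis by simp
  qed
  ultimately have B: "((\<lambda>s. s powr (1/q - 1/p - 1) * N) has_integral
      N * \<sigma> powr (1/q - 1/p) / (1/p - 1/q)) {\<sigma>..}" by simp
  have "interp_integral j (1 - 1/q) 1 x \<le> (\<integral>\<^sup>+s. ?A s + ?B s \<partial>lebesgue)"
    unfolding interp_integral_def
  proof (rule nn_integral_mono)
    fix s :: real
    show "ennreal ((s powr - (1 - 1/q) * K_fun j s x) powr 1 / s) * indicator {0<..} s \<le> ?A s + ?B s"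
    proof (cases "0 < s")
      case True
      have K: "0 \<le> K_fun j s x" using True by (intro K_fun_nonneg) simp
      have eq: "(s powr - (1 - 1/q) * K_fun j s x) powr 1 / s = s powr (1/q - 2) * K_fun j s x"
      proof -
        have "s powr - (1 - 1/q) / s = s powr (1/q - 2)"
          using True powr_diff[of s "- (1 - 1/q)" 1] by simp
        then have "s powr - (1 - 1/q) / s * K_fun j s x = s powr (1/q - 2) * K_fun j s x" by simp
        then show ?thesis using K by simp
      qed
      show ?thesis
      proof (cases "s \<le> \<sigma>")
        case le: True
        have "s powr (1/q - 2) * K_fun j s x \<le> s powr (1/q - 2) * (s * V)"
          by (intro mult_left_mono KV True) auto
        also have "\<dots> = s powr (1/q - 1) * V"
          using True powr_add[of s "1/q - 2" 1] by simp
        finally have "ennreal (s powr (1/q - 2) * K_fun j s x) \<le> ?A s"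
          using True le by (simp add: ennreal_leI)
        also have "\<dots> \<le> ?A s + ?B s" by (rule add_increasing2) auto
        finally show ?thesis using True unfolding eq by simp
      next
        case False
        have "s powr (1/q - 2) * K_fun j s x \<le> s powr (1/q - 2) * (N * s powr (1 - 1/p))"
          by (intro mult_left_mono KN True) auto
        also have "\<dots> = s powr (1/q - 1/p - 1) * N"
          using powr_add[of s "1/q - 2" "1 - 1/p"] by (simp add: algebra_simps)
        finally have "ennreal (s powr (1/q - 2) * K_fun j s x) \<le> ?B s"
          using False by (simp add: ennreal_leI)
        also have "\<dots> \<le> ?A s + ?B s" by (rule add_increasing) auto
        finally show ?thesis using True unfolding eq by simp
      qed
    qed simp
  qed
  also have "\<dots> = (\<integral>\<^sup>+s. ?A s \<partial>lebesgue) + (\<integral>\<^sup>+s. ?B s \<partial>lebesgue)"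
    by (intro nn_integral_add nn_integral_has_integral_indicator(2)[OF _ A] nn_integral_has_integral_indicator(2)[OF _ B])
       (use V N in auto)
  also have "(\<integral>\<^sup>+s. ?A s \<partial>lebesgue) = ennreal (q * \<sigma> powr (1/q) * V)"
    by (rule nn_integral_has_integral_indicator(1)[OF _ A]) (use V in auto)
  also have "(\<integral>\<^sup>+s. ?B s \<partial>lebesgue) = ennreal (N * \<sigma> powr (1/q - 1/p) / (1/p - 1/q))"
    by (rule nn_integral_has_integral_indicator(1)[OF _ B]) (use N in auto)
  also have "ennreal (q * \<sigma> powr (1/q) * V) + ennreal (N * \<sigma> powr (1/q - 1/p) / (1/p - 1/q))
      = ennreal (q * \<sigma> powr (1/q) * V + N * \<sigma> powr (1/q - 1/p) / (1/p - 1/q))"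
    using q0 V N by (intro ennreal_plus[symmetric]) auto
  finally show ?thesis .
qed

lemma interp_norm_le:
  fixes j :: "'a::real_normed_vector \<Rightarrow>\<^sub>L 'b::real_normed_vector"
  assumes p: "1 < p" and q: "p < q" and V: "0 \<le> V" and N: "0 \<le> N" and \<sigma>: "0 < \<sigma>"
    and KV: "\<And>s. 0 < s \<Longrightarrow> K_fun j s x \<le> s * V"
    and KN: "\<And>s. 0 < s \<Longrightarrow> K_fun j s x \<le> N * s powr (1 - 1/p)"
  shows "x \<in> interp_space j (1 - 1/q) 1"
    and "interp_norm j (1 - 1/q) 1 x \<le> q * \<sigma> powr (1/q) * V + N * \<sigma> powr (1/q - 1/p) / (1/p - 1/q)"
proof -
  note le = interp_integral_le[OF assms]
  show "x \<in> interp_space j (1 - 1/q) 1"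
    unfolding interp_space_def using le_less_trans[OF le ennreal_less_top] by simp
  have "1/q \<le> 1/p" using p q by (simp add: frac_le)
  then have "0 \<le> q * \<sigma> powr (1/q) * V + N * \<sigma> powr (1/q - 1/p) / (1/p - 1/q)"
    using p q V N by (intro add_nonneg_nonneg mult_nonneg_nonneg divide_nonneg_nonneg) auto
  then show "interp_norm j (1 - 1/q) 1 x \<le> q * \<sigma> powr (1/q) * V + N * \<sigma> powr (1/q - 1/p) / (1/p - 1/q)"
    unfolding interp_norm_def using enn2real_mono[OF le] by simp
qed

lemma K_fun_embedding:
  fixes j :: "'a::real_normed_vector \<Rightarrow>\<^sub>L 'b::real_normed_vector"
  assumes "0 < s"
  shows "K_fun j s (j y) \<le> s * norm y" "K_fun j s (j y) \<le> norm (j y)"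
  using K_fun_le[of s "j y" 0 j y] K_fun_le[of s "j y" "j y" j 0] assms by (auto simp: blinfun.zero_right)

text \<open>For s \<le> 1 the K-functional is estimated through the norm of y, for s > 1 through the
  norm of j y. The result makes \<open>B t\<close> applicable to every \<open>j y\<close> and
  continuous in y for fixed t.\<close>

lemma interp_norm_embedding:
  fixes j :: "'a::real_normed_vector \<Rightarrow>\<^sub>L 'b::real_normed_vector"
  assumes p: "1 < p" and q: "p < q"
  obtains C where "\<And>y. j y \<in> interp_space j (1 - 1/q) 1" "\<And>y. interp_norm j (1 - 1/q) 1 (j y) \<le> C * norm y"
proof -
  have KN: "K_fun j s (j y) \<le> (max 1 (norm j) * norm y) * s powr (1 - 1/p)" if s: "0 < s" for s y
  proof (cases "s \<le> 1")
    case True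
    have "K_fun j s (j y) \<le> s * norm y" by (rule K_fun_embedding[OF s])
    also have "s * norm y \<le> s powr (1 - 1/p) * norm y"
      using powr_mono'[of "1 - 1/p" 1 s] True s p by (intro mult_right_mono) auto
    also have "\<dots> \<le> s powr (1 - 1/p) * (max 1 (norm j) * norm y)"
      using mult_right_mono[of 1 "max 1 (norm j)" "norm y"] by (intro mult_left_mono) auto
    finally show ?thesis by (simp add: mult.commute)
  next
    case False
    have "K_fun j s (j y) \<le> norm (j y)" by (rule K_fun_embedding[OF s])
    also have "\<dots> \<le> norm j * norm y" by (rule norm_blinfun)
    also have "\<dots> \<le> max 1 (norm j) * norm y" by (intro mult_right_mono) auto
    also have "\<dots> = (max 1 (norm j) * norm y) * 1" by simp
    also have "\<dots> \<le> (max 1 (norm j) * norm y) * s powr (1 - 1/p)"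
      using False p by (intro mult_left_mono ge_one_powr_ge_zero) auto
    finally show ?thesis .
  qed
  note le = interp_norm_le[OF p q norm_ge_zero _ zero_less_one K_fun_embedding(1) KN]
  show thesis
  proof (rule that[of "q + max 1 (norm j) / (1/p - 1/q)"])
    fix y
    show "j y \<in> interp_space j (1 - 1/q) 1" by (rule le(1)) auto
    have "interp_norm j (1 - 1/q) 1 (j y) \<le> q * 1 powr (1/q) * norm y + max 1 (norm j) * norm y * 1 powr (1/q - 1/p) / (1/p - 1/q)"
      by (rule le(2)) auto
    then show "interp_norm j (1 - 1/q) 1 (j y) \<le> (q + max 1 (norm j) / (1/p - 1/q)) * norm y"
      by (simp add: algebra_simps)
  qed
qed

section \<open>Weighted bounds for integrals over short intervals\<close>

lemma has_integral_powr_le: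
  fixes s t \<gamma> :: real
  assumes \<gamma>: "0 < \<gamma>" "\<gamma> \<le> 1" and s: "0 < s" "s \<le> t"
  obtains I where "((\<lambda>x. x powr (\<gamma> - 1)) has_integral I) {t-s..t}" "I \<le> s * t powr (\<gamma> - 1) / \<gamma>"
proof -
  define F where "F x = x powr \<gamma> / \<gamma>" for x :: real
  have t: "0 < t" using s by simp
  have "((\<lambda>x. x powr (\<gamma> - 1)) has_integral (F t - F (t - s))) {t-s..t}"
  proof (rule fundamental_theorem_of_calculus_interior)
    show "continuous_on {t - s..t} F"
      unfolding F_def using \<gamma> s by (intro continuous_intros continuous_on_powr') auto
    show "(F has_vector_derivative x powr (\<gamma> - 1)) (at x)" if "x \<in> {t - s<..<t}" for x
    proof -
      have "x > 0" using that s by auto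
      then have "((\<lambda>z. z powr \<gamma>) has_real_derivative \<gamma> * x powr (\<gamma> - 1)) (at x)"
        by (rule has_real_derivative_powr)
      from DERIV_cdivide[OF this, of \<gamma>] show ?thesis
        unfolding F_def using \<gamma> by (simp add: has_real_derivative_iff_has_vector_derivative)
    qed
  qed (use s in simp)
  moreover have "F t - F (t - s) \<le> s * t powr (\<gamma> - 1) / \<gamma>"
  proof -
    \<comment> \<open>With u = 1 - s/t in [0,1] and \<gamma> \<le> 1 one has u^\<gamma> \<ge> u,
      which makes the increment of x^\<gamma> over [t-s,t] linear in s, up to the full length s =
      t.\<close>
    have u: "0 \<le> 1 - s / t" "1 - s / t \<le> 1" using s t by (auto simp: field_simps)
    have "t - s = t * (1 - s / t)" using t by (simp add: field_simps)
    then have "(t - s) powr \<gamma> = t powr \<gamma> * (1 - s / t) powr \<gamma>"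
      using t u by (metis powr_mult less_imp_le)
    also have "\<dots> \<ge> t powr \<gamma> * (1 - s / t)"
      using powr_mono'[OF \<gamma>(2) u] u by (intro mult_left_mono) auto
    finally have "t powr \<gamma> - (t - s) powr \<gamma> \<le> t powr \<gamma> * (s / t)" by (simp add: algebra_simps)
    also have "t powr \<gamma> * (s / t) = s * t powr (\<gamma> - 1)"
      using t by (simp add: powr_diff)
    finally show ?thesis
      using \<gamma> by (simp add: F_def divide_right_mono flip: diff_divide_distrib)
  qed
  ultimately show thesis by (rule that)
qed

text \<open>Applied with \<open>A\<close> depending on the point, this replaces Hoelder's inequality.\<close>

lemma le_add_powr:
  fixes x A p :: real
  assumes "0 \<le> x" "0 < A" "1 < p"
  shows "x \<le> A + A powr (1 - p) * x powr p"
proof (cases "x \<le> A")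
  case True
  then show ?thesis by (simp add: add_increasing2)
next
  case False
  then have x: "0 < x" "A \<le> x" using assms by auto
  have "x = x powr (1 - p) * x powr p" using x by (simp flip: powr_add)
  also have "\<dots> \<le> A powr (1 - p) * x powr p"
    using assms x by (intro mult_right_mono powr_mono2') auto
  finally show ?thesis using assms by simp
qed

text \<open>A Hoelder estimate, obtained from \<open>le_add_powr\<close> with a threshold \<alpha>
  x^(\<gamma>-1) that varies with x. The powers of s and t are what matters: s gives the growth rate
  of the K-functional, and t^(-\<kappa>/p) is later cancelled by the weight.\<close>

lemma weighted_L1_le:
  fixes \<phi> :: "real \<Rightarrow> real"
  assumes p: "1 < p" and \<kappa>: "0 \<le> \<kappa>" "\<kappa> < p - 1" and s: "0 < s" "s \<le> t"
    and \<phi>: "\<And>x. 0 \<le> \<phi> x" "\<phi> \<in> borel_measurable (lebesgue_on {0<..<t})"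
    and \<Phi>: "0 < \<Phi>" "(\<integral>\<^sup>+x. ennreal (\<bar>x\<bar> powr \<kappa> * \<phi> x powr p) * indicator {0<..<t} x \<partial>lebesgue) \<le> ennreal (\<Phi> powr p)"
  shows "(\<integral>\<^sup>+x. ennreal (\<phi> x) * indicator {t-s<..<t} x \<partial>lebesgue)
    \<le> ennreal (((p-1)/(p-1-\<kappa>) + 1) * \<Phi> * s powr (1 - 1/p) * t powr (- \<kappa>/p))"
proof -
  \<comment> \<open>x^(-\<kappa>') is the weight dual to x^\<kappa>, and \<kappa> < p - 1 makes it
    integrable at 0. The identity (\<gamma>-1)(1-p) = \<kappa> lets the p-th power term carry
    exactly the weight x^\<kappa>.\<close>
  define \<kappa>' where "\<kappa>' = \<kappa> / (p - 1)"
  define \<gamma> where "\<gamma> = 1 - \<kappa>'"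
  have \<gamma>: "0 < \<gamma>" "\<gamma> \<le> 1" using p \<kappa> by (auto simp: \<gamma>_def \<kappa>'_def field_simps)
  have c: "1/\<gamma> = (p-1)/(p-1-\<kappa>)" using p \<kappa> by (simp add: \<gamma>_def \<kappa>'_def field_simps)
  have t: "0 < t" using s by simp
  \<comment> \<open>Chosen to balance the two contributions: s t^(\<gamma>-1) \<alpha> and
    \<alpha>^(1-p) \<Phi>^p both equal \<Phi> s^(1-1/p) t^(-\<kappa>/p).\<close>
  define \<alpha> where "\<alpha> = \<Phi> * s powr (-1/p) * t powr (\<kappa>'/p)"
  have \<alpha>: "0 < \<alpha>" using \<Phi> s t by (simp add: \<alpha>_def)
  obtain I where I: "((\<lambda>x. x powr (\<gamma> - 1)) has_integral I) {t-s..t}" "I \<le> s * t powr (\<gamma> - 1) / \<gamma>"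
    by (rule has_integral_powr_le[OF \<gamma> s])
  let ?A = "\<lambda>x. ennreal (x powr (\<gamma> - 1) * \<alpha>) * indicator {t-s..t} x"
  let ?B = "\<lambda>x. ennreal (\<alpha> powr (1-p)) * (ennreal (\<bar>x\<bar> powr \<kappa> * \<phi> x powr p) * indicator {0<..<t} x)"
  have I\<alpha>: "((\<lambda>x. x powr (\<gamma> - 1) * \<alpha>) has_integral I * \<alpha>) {t-s..t}"
    by (rule has_integral_mult_left[OF I(1)])
  have Bm: "(\<lambda>x. ennreal (\<bar>x\<bar> powr \<kappa> * \<phi> x powr p) * indicator {0<..<t} x) \<in> borel_measurable lebesgue"
  proof -
    have "(\<lambda>x. x) \<in> borel_measurable (lebesgue_on {0<..<t})"
      using id_borel_measurable_lebesgue_on by (simp add: id_def)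
    then have "(\<lambda>x. \<bar>x\<bar> powr \<kappa> * \<phi> x powr p) \<in> borel_measurable (lebesgue_on {0<..<t})"
      using \<phi>(2) by measurable
    then show ?thesis by (intro borel_measurable_ennreal_indicator) auto
  qed
  have "(\<integral>\<^sup>+x. ?B x \<partial>lebesgue) = ennreal (\<alpha> powr (1-p)) * (\<integral>\<^sup>+x. ennreal (\<bar>x\<bar> powr \<kappa> * \<phi> x powr p) * indicator {0<..<t} x \<partial>lebesgue)"
    by (rule nn_integral_cmult[OF Bm])
  also have "\<dots> \<le> ennreal (\<alpha> powr (1-p)) * ennreal (\<Phi> powr p)"
    by (intro mult_left_mono \<Phi>(2)) auto
  also have "\<dots> = ennreal (\<alpha> powr (1-p) * \<Phi> powr p)" by (simp add: ennreal_mult)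
  finally have IB: "(\<integral>\<^sup>+x. ?B x \<partial>lebesgue) \<le> ennreal (\<alpha> powr (1-p) * \<Phi> powr p)" .
  have "(\<integral>\<^sup>+x. ennreal (\<phi> x) * indicator {t-s<..<t} x \<partial>lebesgue) \<le> (\<integral>\<^sup>+x. ?A x + ?B x \<partial>lebesgue)"
  proof (rule nn_integral_mono)
    fix x
    show "ennreal (\<phi> x) * indicator {t-s<..<t} x \<le> ?A x + ?B x"
    proof (cases "x \<in> {t-s<..<t}")
      case True
      then have x: "0 < x" "x \<in> {0<..<t}" using s by auto
      have "\<phi> x \<le> x powr (\<gamma> - 1) * \<alpha> + (x powr (\<gamma> - 1) * \<alpha>) powr (1 - p) * \<phi> x powr p"
        using x \<alpha> p \<phi>(1) by (intro le_add_powr) auto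
      also have "(x powr (\<gamma> - 1) * \<alpha>) powr (1 - p) = \<alpha> powr (1-p) * \<bar>x\<bar> powr \<kappa>"
      proof -
        have "(\<gamma> - 1) * (1 - p) = \<kappa>" using p by (simp add: \<gamma>_def \<kappa>'_def field_simps)
        then show ?thesis using x \<alpha> by (simp add: powr_mult powr_powr mult.commute)
      qed
      finally have "ennreal (\<phi> x) \<le> ennreal (x powr (\<gamma> - 1) * \<alpha> + \<alpha> powr (1-p) * (\<bar>x\<bar> powr \<kappa> * \<phi> x powr p))"
        by (intro ennreal_leI) (simp add: mult.assoc)
      also have "\<dots> = ?A x + ?B x"
        using True x \<alpha> by (simp add: ennreal_plus ennreal_mult)
      finally show ?thesis using True by simp
    qed simp
  qed
  also have "\<dots> = (\<integral>\<^sup>+x. ?A x \<partial>lebesgue) + (\<integral>\<^sup>+x. ?B x \<partial>lebesgue)"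
    using Bm nn_integral_has_integral_indicator(2)[OF _ I\<alpha>] \<alpha> by (intro nn_integral_add) auto
  also have "(\<integral>\<^sup>+x. ?A x \<partial>lebesgue) = ennreal (I * \<alpha>)"
    by (rule nn_integral_has_integral_indicator(1)[OF _ I\<alpha>]) (use \<alpha> in auto)
  also have "ennreal (I * \<alpha>) + (\<integral>\<^sup>+x. ?B x \<partial>lebesgue) \<le> ennreal (s * t powr (\<gamma> - 1) / \<gamma> * \<alpha>) + ennreal (\<alpha> powr (1-p) * \<Phi> powr p)"
    using I(2) \<alpha> by (intro add_mono IB ennreal_leI mult_right_mono) auto
  also have "s * t powr (\<gamma> - 1) / \<gamma> * \<alpha> = (p-1)/(p-1-\<kappa>) * (\<Phi> * s powr (1 - 1/p) * t powr (- \<kappa>/p))"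
  proof -
    have 1: "s * s powr (-1/p) = s powr (1 - 1/p)"
      using powr_add[of s 1 "-1/p"] s by simp
    have "\<kappa>' * (p-1) = \<kappa>" using p by (simp add: \<kappa>'_def)
    moreover have "\<gamma> - 1 + \<kappa>'/p = - (\<kappa>' * (p-1))/p" using p by (simp add: \<gamma>_def field_simps)
    ultimately have "\<gamma> - 1 + \<kappa>'/p = - \<kappa>/p" by simp
    then have 2: "t powr (\<gamma> - 1) * t powr (\<kappa>'/p) = t powr (- \<kappa>/p)"
      by (simp flip: powr_add)
    have "s * t powr (\<gamma> - 1) / \<gamma> * \<alpha> = (1/\<gamma>) * (\<Phi> * (s * s powr (-1/p)) * (t powr (\<gamma> - 1) * t powr (\<kappa>'/p)))"
      by (simp add: \<alpha>_def)
    then show ?thesis unfolding 1 2 c .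
  qed
  also have "\<alpha> powr (1-p) * \<Phi> powr p = \<Phi> * s powr (1 - 1/p) * t powr (- \<kappa>/p)"
  proof -
    have 1: "\<Phi> powr (1-p) * \<Phi> powr p = \<Phi>" using \<Phi> by (simp flip: powr_add)
    have 2: "(s powr (-1/p)) powr (1-p) = s powr (1 - 1/p)"
    proof -
      have "(-1/p) * (1-p) = 1 - 1/p" using p by (simp add: field_simps)
      then show ?thesis by (simp only: powr_powr)
    qed
    have 3: "(t powr (\<kappa>'/p)) powr (1-p) = t powr (- \<kappa>/p)"
    proof -
      have "\<kappa>' * (p-1) = \<kappa>" using p by (simp add: \<kappa>'_def)
      moreover have "(\<kappa>'/p) * (1-p) = - (\<kappa>' * (p-1))/p" using p by (simp add: field_simps)
      ultimately have "(\<kappa>'/p) * (1-p) = - \<kappa>/p" by simp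
      then show ?thesis by (simp only: powr_powr)
    qed
    have "\<alpha> powr (1-p) = \<Phi> powr (1-p) * (s powr (-1/p)) powr (1-p) * (t powr (\<kappa>'/p)) powr (1-p)"
      unfolding \<alpha>_def using \<Phi> s t by (simp add: powr_mult)
    then have "\<alpha> powr (1-p) * \<Phi> powr p = (\<Phi> powr (1-p) * \<Phi> powr p) * (s powr (-1/p)) powr (1-p) * (t powr (\<kappa>'/p)) powr (1-p)"
      by (simp only: ac_simps)
    then show ?thesis unfolding 1 2 3 .
  qed
  also have "ennreal ((p-1)/(p-1-\<kappa>) * (\<Phi> * s powr (1 - 1/p) * t powr (- \<kappa>/p))) + ennreal (\<Phi> * s powr (1 - 1/p) * t powr (- \<kappa>/p))
      = ennreal (((p-1)/(p-1-\<kappa>) + 1) * \<Phi> * s powr (1 - 1/p) * t powr (- \<kappa>/p))"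
  proof -
    have *: "ennreal (C * X) + ennreal X = ennreal ((C + 1) * X)" if "0 \<le> C" "0 \<le> X" for C X
      using that by (simp add: distrib_right ennreal_plus)
    have "0 \<le> (p-1)/(p-1-\<kappa>)" "0 \<le> \<Phi> * s powr (1 - 1/p) * t powr (- \<kappa>/p)"
      using p \<kappa> \<Phi>(1) by auto
    from *[OF this] show ?thesis by (simp only: mult.assoc)
  qed
  finally show ?thesis .
qed

section \<open>Weighted spaces and strong solutions\<close>

text \<open>The crude substitute for the triangle inequality in weighted L^p, applied to p-th
  powers; it is the origin of the powers of 2 in the constants below.\<close>

lemma powr_add_le:
  fixes x y p :: real
  assumes "0 \<le> x" "0 \<le> y" "0 \<le> p"
  shows "(x + y) powr p \<le> 2 powr p * (x powr p + y powr p)"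
proof -
  have "(x + y) powr p \<le> (2 * max x y) powr p"
    using assms by (intro powr_mono2) auto
  also have "\<dots> = 2 powr p * (max x y) powr p"
    using assms by (simp add: powr_mult)
  also have "(max x y) powr p \<le> x powr p + y powr p"
    by (simp add: max_def)
  finally show ?thesis by simp
qed

lemma wLp_integrand_measurable:
  fixes f :: "real \<Rightarrow> 'x::real_normed_vector"
  assumes "strongly_measurable_on {a<..<b} f"
  shows "(\<lambda>t. ennreal (\<bar>t\<bar> powr \<kappa> * norm (f t) powr p) * indicator {a<..<b} t) \<in> borel_measurable lebesgue"
proof (rule borel_measurable_ennreal_indicator)
  have "(\<lambda>x. x) \<in> borel_measurable (lebesgue_on {a<..<b})"
    using id_borel_measurable_lebesgue_on by (simp add: id_def)
  moreover have "(\<lambda>t. norm (f t)) \<in> borel_measurable (lebesgue_on {a<..<b})"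
    using assms by (intro strongly_measurable_on_norm) auto
  ultimately show "(\<lambda>t. \<bar>t\<bar> powr \<kappa> * norm (f t) powr p) \<in> borel_measurable (lebesgue_on {a<..<b})"
    by measurable
qed simp

lemma wLp_integral_lincomb_le:
  fixes f g :: "real \<Rightarrow> 'x::real_normed_vector"
  assumes f: "strongly_measurable_on {a<..<b} f" and g: "strongly_measurable_on {a<..<b} g" and p: "0 \<le> p"
  shows "wLp_integral a b \<kappa> p (\<lambda>t. f t + c *\<^sub>R g t)
    \<le> ennreal (2 powr p) * (wLp_integral a b \<kappa> p f + ennreal (\<bar>c\<bar> powr p) * wLp_integral a b \<kappa> p g)"
proof -
  let ?F = "\<lambda>t. ennreal (\<bar>t\<bar> powr \<kappa> * norm (f t) powr p) * indicator {a<..<b} t"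
  let ?G = "\<lambda>t. ennreal (\<bar>t\<bar> powr \<kappa> * norm (g t) powr p) * indicator {a<..<b} t"
  note [measurable] = wLp_integrand_measurable[OF f, of \<kappa> p] wLp_integrand_measurable[OF g, of \<kappa> p]
  have "wLp_integral a b \<kappa> p (\<lambda>t. f t + c *\<^sub>R g t) \<le> (\<integral>\<^sup>+t. ennreal (2 powr p) * (?F t + ennreal (\<bar>c\<bar> powr p) * ?G t) \<partial>lebesgue)"
    unfolding wLp_integral_def
  proof (rule nn_integral_mono)
    fix t
    have "norm (f t + c *\<^sub>R g t) powr p \<le> (norm (f t) + \<bar>c\<bar> * norm (g t)) powr p"
      using p norm_triangle_ineq[of "f t" "c *\<^sub>R g t"] by (intro powr_mono2) auto
    also have "\<dots> \<le> 2 powr p * (norm (f t) powr p + (\<bar>c\<bar> * norm (g t)) powr p)"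
      using p by (intro powr_add_le) auto
    also have "(\<bar>c\<bar> * norm (g t)) powr p = \<bar>c\<bar> powr p * norm (g t) powr p"
      by (simp add: powr_mult)
    finally have "\<bar>t\<bar> powr \<kappa> * norm (f t + c *\<^sub>R g t) powr p
        \<le> \<bar>t\<bar> powr \<kappa> * (2 powr p * (norm (f t) powr p + \<bar>c\<bar> powr p * norm (g t) powr p))"
      by (intro mult_left_mono) auto
    also have "\<dots> = 2 powr p * (\<bar>t\<bar> powr \<kappa> * norm (f t) powr p + \<bar>c\<bar> powr p * (\<bar>t\<bar> powr \<kappa> * norm (g t) powr p))"
      by (simp add: algebra_simps)
    finally have "ennreal (\<bar>t\<bar> powr \<kappa> * norm (f t + c *\<^sub>R g t) powr p)
        \<le> ennreal (2 powr p) * (ennreal (\<bar>t\<bar> powr \<kappa> * norm (f t) powr p) + ennreal (\<bar>c\<bar> powr p) * ennreal (\<bar>t\<bar> powr \<kappa> * norm (g t) powr p))"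
      by (subst (asm) ennreal_le_iff[symmetric]) (auto simp: ennreal_mult ennreal_plus)
    then show "ennreal (\<bar>t\<bar> powr \<kappa> * norm (f t + c *\<^sub>R g t) powr p) * indicator {a<..<b} t
        \<le> ennreal (2 powr p) * (?F t + ennreal (\<bar>c\<bar> powr p) * ?G t)"
      by (auto simp: indicator_def)
  qed
  also have "\<dots> = ennreal (2 powr p) * (wLp_integral a b \<kappa> p f + ennreal (\<bar>c\<bar> powr p) * wLp_integral a b \<kappa> p g)"
    unfolding wLp_integral_def by (simp add: nn_integral_cmult nn_integral_add)
  finally show ?thesis .
qed

lemma wLp_lincomb:
  assumes "wLp a b \<kappa> p f" "wLp a b \<kappa> p g" "0 \<le> p"
  shows "wLp a b \<kappa> p (\<lambda>t. f t + c *\<^sub>R g t)"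
proof -
  have f: "strongly_measurable_on {a<..<b} f" "wLp_integral a b \<kappa> p f < top"
    and g: "strongly_measurable_on {a<..<b} g" "wLp_integral a b \<kappa> p g < top"
    using assms by (auto simp: wLp_def)
  have "ennreal (2 powr p) * (wLp_integral a b \<kappa> p f + ennreal (\<bar>c\<bar> powr p) * wLp_integral a b \<kappa> p g) < top"
    using f(2) g(2) by (auto simp: ennreal_mult_less_top)
  from le_less_trans[OF wLp_integral_lincomb_le[OF f(1) g(1) assms(3)] this] show ?thesis
    unfolding wLp_def using strongly_measurable_on_lincomb[OF f(1) g(1)] by simp
qed

lemma wLp_integral_cong_AE:
  assumes "AE t in lebesgue_on {a<..<b}. f t = g t"
  shows "wLp_integral a b \<kappa> p f = wLp_integral a b \<kappa> p g"
  unfolding wLp_integral_def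
  by (rule nn_integral_cong_AE) (use assms in \<open>auto simp: AE_restrict_space_iff indicator_def elim!: eventually_mono\<close>)

lemma wLp_cong_AE:
  assumes "AE t in lebesgue_on {a<..<b}. f t = g t" "wLp a b \<kappa> p f"
  shows "wLp a b \<kappa> p g"
  using assms wLp_integral_cong_AE[OF assms(1)] strongly_measurable_on_AE_cong
  unfolding wLp_def by metis

lemma wLp_integral_mono_interval:
  "a' \<le> a \<Longrightarrow> b \<le> b' \<Longrightarrow> wLp_integral a b \<kappa> p f \<le> wLp_integral a' b' \<kappa> p f"
  unfolding wLp_integral_def by (intro nn_integral_mono) (auto simp: indicator_def)

lemma wLp_subinterval:
  assumes "wLp a b \<kappa> p f" "\<tau> \<le> b"
  shows "wLp a \<tau> \<kappa> p f"
proof -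
  have "strongly_measurable_on {a<..<\<tau>} f"
    by (rule strongly_measurable_on_subset[of "{a<..<b}"]) (use assms in \<open>auto simp: wLp_def\<close>)
  moreover have "wLp_integral a \<tau> \<kappa> p f < \<infinity>"
    using assms wLp_integral_mono_interval[of a a \<tau> b] by (auto simp: wLp_def intro: le_less_trans)
  ultimately show ?thesis by (simp add: wLp_def)
qed

lemma AE_lebesgue_on_subinterval:
  "AE t in lebesgue_on {a<..<b::real}. P t \<Longrightarrow> \<tau> \<le> b \<Longrightarrow> AE t in lebesgue_on {a<..<\<tau>}. P t"
  by (rule AE_lebesgue_on_subset[of "{a<..<b}"]) auto

lemma wLp_norm_nonneg: "0 \<le> wLp_norm a b \<kappa> p f"
  by (simp add: wLp_norm_def)

lemma wLp_integral_eq_norm_powr: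
  assumes "wLp a b \<kappa> p f" "0 < p"
  shows "wLp_integral a b \<kappa> p f = ennreal (wLp_norm a b \<kappa> p f powr p)"
proof -
  have "wLp_norm a b \<kappa> p f powr p = enn2real (wLp_integral a b \<kappa> p f)"
    using assms(2) by (simp add: wLp_norm_def powr_powr)
  then show ?thesis using assms(1) by (simp add: wLp_def less_top)
qed

lemma wLp_integral_eq_0_imp_AE:
  assumes "wLp 0 b \<kappa> p f" "wLp_integral 0 b \<kappa> p f = 0" "0 < p"
  shows "AE t in lebesgue_on {0<..<b}. f t = 0"
proof -
  have "AE t in lebesgue. ennreal (\<bar>t\<bar> powr \<kappa> * norm (f t) powr p) * indicator {0<..<b} t = 0"
    using assms wLp_integrand_measurable[of 0 b f \<kappa> p]
    unfolding wLp_def wLp_integral_def by (subst (asm) nn_integral_0_iff_AE) auto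
  then have "AE t in lebesgue. t \<in> {0<..<b} \<longrightarrow> f t = 0"
  proof eventually_elim
    case (elim t)
    show ?case
    proof
      assume t: "t \<in> {0<..<b}"
      then have "\<bar>t\<bar> powr \<kappa> * norm (f t) powr p = 0"
        using elim by (auto simp: ennreal_eq_0_iff zero_le_mult_iff mult_le_0_iff)
      then show "f t = 0" using t by simp
    qed
  qed
  then show ?thesis by (simp add: AE_restrict_space_iff)
qed

lemma wLp_0_1_iff:
  "wLp 0 b 0 1 f \<longleftrightarrow> strongly_measurable_on {0<..<b} f \<and>
    (\<integral>\<^sup>+t. ennreal (norm (f t)) * indicator {0<..<b} t \<partial>lebesgue) < \<infinity>"
proof -
  have "wLp_integral 0 b 0 1 f = (\<integral>\<^sup>+t. ennreal (norm (f t)) * indicator {0<..<b} t \<partial>lebesgue)"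
    unfolding wLp_integral_def by (intro nn_integral_cong) (auto simp: indicator_def)
  then show ?thesis by (simp add: wLp_def)
qed

text \<open>The case s = t = b of \<open>weighted_L1_le\<close>, using \<kappa> < p - 1. Strong
  solutions are defined through unweighted L^1, so perturbation terms known in the weighted space
  must be moved there.\<close>

lemma wLp_imp_wLp_0_1:
  assumes f: "wLp 0 b \<kappa> p f" and p: "1 < p" and \<kappa>: "0 \<le> \<kappa>" "\<kappa> < p - 1" and b: "0 < b"
  shows "wLp 0 b 0 1 f"
proof -
  let ?I = "enn2real (wLp_integral 0 b \<kappa> p f)"
  \<comment> \<open>Adding 1 makes \<Phi> positive even when f vanishes almost everywhere.\<close>
  define \<Phi> where "\<Phi> = (?I + 1) powr (1/p)"
  have \<Phi>: "0 < \<Phi>" "\<Phi> powr p = ?I + 1"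
    using p enn2real_nonneg[of "wLp_integral 0 b \<kappa> p f"]
    by (auto simp: \<Phi>_def powr_powr intro!: add_nonneg_pos simp del: enn2real_nonneg)
  have "wLp_integral 0 b \<kappa> p f = ennreal ?I" using f by (simp add: wLp_def)
  also have "\<dots> \<le> ennreal (\<Phi> powr p)" unfolding \<Phi>(2) by (intro ennreal_leI) simp
  finally have int: "wLp_integral 0 b \<kappa> p f \<le> ennreal (\<Phi> powr p)" .
  have SM: "strongly_measurable_on {0<..<b} f" using f by (simp add: wLp_def)
  have "(\<integral>\<^sup>+x. ennreal (norm (f x)) * indicator {b-b<..<b} x \<partial>lebesgue)
    \<le> ennreal (((p-1)/(p-1-\<kappa>) + 1) * \<Phi> * b powr (1 - 1/p) * b powr (- \<kappa>/p))"
    using SM int unfolding wLp_integral_def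
    by (intro weighted_L1_le p \<kappa> b \<Phi>(1) strongly_measurable_on_norm) auto
  also have "\<dots> < \<infinity>" by simp
  finally show ?thesis using SM by (simp add: wLp_0_1_iff)
qed

section \<open>Superposition and restriction of weak derivatives and strong solutions\<close>

lemma loc_integrable_lincomb:
  assumes "loc_integrable a b f" "loc_integrable a b g"
  shows "loc_integrable a b (\<lambda>t. f t + c *\<^sub>R g t)"
  unfolding loc_integrable_def
proof (intro conjI allI impI)
  have f: "strongly_measurable_on {a<..<b} f" and g: "strongly_measurable_on {a<..<b} g"
    using assms by (auto simp: loc_integrable_def)
  then show "strongly_measurable_on {a<..<b} (\<lambda>t. f t + c *\<^sub>R g t)"
    by (rule strongly_measurable_on_lincomb)
  fix u v assume uv: "a < u \<and> v < b"
  then have sub: "{u..v} \<subseteq> {a<..<b}" by auto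
  have m: "(\<lambda>t. ennreal (norm (h t)) * indicator {u..v} t) \<in> borel_measurable lebesgue"
    if "strongly_measurable_on {a<..<b} h" for h :: "real \<Rightarrow> 'a"
    using strongly_measurable_on_subset[OF _ _ sub that]
    by (intro borel_measurable_ennreal_indicator strongly_measurable_on_norm) auto
  have "(\<integral>\<^sup>+ t. ennreal (norm (f t + c *\<^sub>R g t)) * indicator {u..v} t \<partial>lebesgue)
    \<le> (\<integral>\<^sup>+ t. ennreal (norm (f t)) * indicator {u..v} t + ennreal \<bar>c\<bar> * (ennreal (norm (g t)) * indicator {u..v} t) \<partial>lebesgue)"
  proof (rule nn_integral_mono)
    fix t
    have "norm (f t + c *\<^sub>R g t) \<le> norm (f t) + \<bar>c\<bar> * norm (g t)"
      using norm_triangle_ineq[of "f t" "c *\<^sub>R g t"] by simp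
    then have "ennreal (norm (f t + c *\<^sub>R g t)) \<le> ennreal (norm (f t)) + ennreal \<bar>c\<bar> * ennreal (norm (g t))"
      by (subst (asm) ennreal_le_iff[symmetric]) (auto simp: ennreal_mult ennreal_plus)
    then show "ennreal (norm (f t + c *\<^sub>R g t)) * indicator {u..v} t
      \<le> ennreal (norm (f t)) * indicator {u..v} t + ennreal \<bar>c\<bar> * (ennreal (norm (g t)) * indicator {u..v} t)"
      by (auto simp: indicator_def)
  qed
  also have "\<dots> = (\<integral>\<^sup>+ t. ennreal (norm (f t)) * indicator {u..v} t \<partial>lebesgue) + ennreal \<bar>c\<bar> * (\<integral>\<^sup>+ t. ennreal (norm (g t)) * indicator {u..v} t \<partial>lebesgue)"
    using m[OF f] m[OF g] by (simp add: nn_integral_add nn_integral_cmult)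
  also have "\<dots> < \<infinity>"
    using assms uv by (auto simp: loc_integrable_def ennreal_mult_less_top)
  finally show "(\<integral>\<^sup>+ t. ennreal (norm (f t + c *\<^sub>R g t)) * indicator {u..v} t \<partial>lebesgue) < \<infinity>" .
qed

lemma loc_integrable_subinterval:
  assumes "loc_integrable a b f" "\<tau> \<le> b"
  shows "loc_integrable a \<tau> f"
proof -
  have "strongly_measurable_on {a<..<\<tau>} f"
    by (rule strongly_measurable_on_subset[of "{a<..<b}"]) (use assms in \<open>auto simp: loc_integrable_def\<close>)
  then show ?thesis using assms unfolding loc_integrable_def by auto
qed

lemma smooth_test_fun_support:
  assumes "smooth_test_fun a b \<phi>"
  obtains c d where "a < c" "d < b" "\<And>t. t \<notin> {c..d} \<Longrightarrow> \<phi> t = 0" "\<And>t. t \<notin> {c..d} \<Longrightarrow> deriv \<phi> t = 0"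
    "continuous_on UNIV \<phi>" "continuous_on UNIV (deriv \<phi>)"
proof -
  obtain c d where cd: "a < c" "d < b" "\<And>t. t \<notin> {c..d} \<Longrightarrow> \<phi> t = 0"
    and diff: "\<And>k t. (deriv ^^ k) \<phi> differentiable (at t)"
    using assms unfolding smooth_test_fun_def by blast
  have "deriv \<phi> t = 0" if "t \<notin> {c..d}" for t
  proof -
    have "\<forall>\<^sub>F x in nhds t. x \<in> - {c..d}"
      using that by (intro eventually_nhds_in_open) auto
    then have "\<forall>\<^sub>F x in nhds t. \<phi> x = 0"
      by eventually_elim (use cd(3) in auto)
    then have "deriv \<phi> t = deriv (\<lambda>x. 0) t" by (intro deriv_cong_ev) auto
    then show ?thesis by simp
  qed
  moreover have "continuous_on UNIV \<phi>" "continuous_on UNIV (deriv \<phi>)"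
    using diff[of 0] diff[of 1]
    by (auto intro!: continuous_at_imp_continuous_on differentiable_imp_continuous_within)
  ultimately show thesis using that[OF cd] by blast
qed

lemma set_integrable_continuous_mult:
  fixes k \<phi> :: "real \<Rightarrow> real"
  assumes cd: "a < c" "d < b" and k: "set_integrable lebesgue {c..d} k"
    and \<phi>: "continuous_on UNIV \<phi>" "\<And>t. t \<notin> {c..d} \<Longrightarrow> \<phi> t = 0"
  shows "set_integrable lebesgue {a<..<b} (\<lambda>t. \<phi> t * k t)"
proof -
  have "compact (\<phi> ` {c..d})"
    using \<phi>(1) by (intro compact_continuous_image continuous_on_subset[OF \<phi>(1)]) auto
  then have "bounded (\<phi> ` {c..d})" by (rule compact_imp_bounded)
  then obtain B where B: "\<And>t. t \<in> {c..d} \<Longrightarrow> \<bar>\<phi> t\<bar> \<le> B"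
    unfolding bounded_iff by (metis imageI real_norm_def)
  have "integrable lebesgue (\<lambda>t. \<phi> t * (indicator {c..d} t *\<^sub>R k t))"
  proof (rule Bochner_Integration.integrable_bound[where f="\<lambda>t. B * (indicator {c..d} t *\<^sub>R k t)"])
    show "integrable lebesgue (\<lambda>t. B * (indicator {c..d} t *\<^sub>R k t))"
      using k by (intro integrable_mult_right) (simp add: set_integrable_def)
    have "\<phi> \<in> borel_measurable lebesgue"
      using \<phi>(1) by (intro measurable_completion) (simp add: borel_measurable_continuous_onI)
    moreover have "(\<lambda>t. indicator {c..d} t *\<^sub>R k t) \<in> borel_measurable lebesgue"
      using k unfolding set_integrable_def by (rule borel_measurable_integrable)
    ultimately show "(\<lambda>t. \<phi> t * (indicator {c..d} t *\<^sub>R k t)) \<in> borel_measurable lebesgue"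
      by (rule borel_measurable_times)
    have "\<bar>\<phi> t\<bar> * \<bar>k t\<bar> \<le> \<bar>B\<bar> * \<bar>k t\<bar>" if "t \<in> {c..d}" for t
      using B[OF that] by (intro mult_right_mono) auto
    then show "AE t in lebesgue. norm (\<phi> t * (indicator {c..d} t *\<^sub>R k t)) \<le> norm (B * (indicator {c..d} t *\<^sub>R k t))"
      by (intro AE_I2) (auto simp: indicator_def abs_mult)
  qed
  also have "(\<lambda>t. \<phi> t * (indicator {c..d} t *\<^sub>R k t)) = (\<lambda>t. indicator {a<..<b} t *\<^sub>R (\<phi> t * k t))"
    using cd \<phi>(2) by (auto simp: indicator_def fun_eq_iff)
  finally show ?thesis by (simp add: set_integrable_def)
qed

lemma weak_deriv_on_lincomb:
  fixes f g f' g' :: "real \<Rightarrow> 'x::real_normed_vector"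
  assumes fg: "weak_deriv_on a b f g" and fg': "weak_deriv_on a b f' g'"
  shows "weak_deriv_on a b (\<lambda>t. f t + c *\<^sub>R f' t) (\<lambda>t. g t + c *\<^sub>R g' t)"
  unfolding weak_deriv_on_def
proof (intro conjI allI impI)
  have loc: "loc_integrable a b f" "loc_integrable a b g" "loc_integrable a b f'" "loc_integrable a b g'"
    using assms by (auto simp: weak_deriv_on_def)
  then show "loc_integrable a b (\<lambda>t. f t + c *\<^sub>R f' t)" "loc_integrable a b (\<lambda>t. g t + c *\<^sub>R g' t)"
    by (auto intro: loc_integrable_lincomb)
  fix \<phi> and l :: "'x \<Rightarrow>\<^sub>L real"
  assume test: "smooth_test_fun a b \<phi>"
  obtain u v where uv: "a < u" "v < b" "\<And>t. t \<notin> {u..v} \<Longrightarrow> \<phi> t = 0" "\<And>t. t \<notin> {u..v} \<Longrightarrow> deriv \<phi> t = 0"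
    "continuous_on UNIV \<phi>" "continuous_on UNIV (deriv \<phi>)"
    by (rule smooth_test_fun_support[OF test], rule that)
  have int: "set_integrable lebesgue {a<..<b} (\<lambda>t. \<psi> t * l (h t))"
    if "loc_integrable a b h" "\<psi> = \<phi> \<or> \<psi> = deriv \<phi>" for h \<psi>
    using loc_integrable_set_integrable[OF that(1) uv(1,2)] that(2) uv
    by (intro set_integrable_continuous_mult[OF uv(1,2)]) auto
  have lin: "(LINT t:{a<..<b}|lebesgue. \<psi> t * l (h t + c *\<^sub>R k t)) =
      (LINT t:{a<..<b}|lebesgue. \<psi> t * l (h t)) + c * (LINT t:{a<..<b}|lebesgue. \<psi> t * l (k t))"
    if hk: "loc_integrable a b h" "loc_integrable a b k" and \<psi>: "\<psi> = \<phi> \<or> \<psi> = deriv \<phi>" for h k \<psi>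
  proof -
    have "(LINT t:{a<..<b}|lebesgue. \<psi> t * l (h t + c *\<^sub>R k t)) =
        (LINT t:{a<..<b}|lebesgue. \<psi> t * l (h t) + c * (\<psi> t * l (k t)))"
      by (simp add: blinfun.add_right blinfun.scaleR_right algebra_simps)
    also have "\<dots> = (LINT t:{a<..<b}|lebesgue. \<psi> t * l (h t)) + (LINT t:{a<..<b}|lebesgue. c * (\<psi> t * l (k t)))"
      using int[OF hk(1) \<psi>] int[OF hk(2) \<psi>] by (intro set_integral_add(2)) auto
    finally show ?thesis by simp
  qed
  have "(LINT t:{a<..<b}|lebesgue. deriv \<phi> t * l (f t)) = - (LINT t:{a<..<b}|lebesgue. \<phi> t * l (g t))"
    "(LINT t:{a<..<b}|lebesgue. deriv \<phi> t * l (f' t)) = - (LINT t:{a<..<b}|lebesgue. \<phi> t * l (g' t))"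
    using fg fg' test by (auto simp: weak_deriv_on_def)
  then show "(LINT t:{a<..<b}|lebesgue. deriv \<phi> t * l (f t + c *\<^sub>R f' t)) =
      - (LINT t:{a<..<b}|lebesgue. \<phi> t * l (g t + c *\<^sub>R g' t))"
    using loc by (simp add: lin)
qed

lemma weak_deriv_on_subinterval:
  fixes f g :: "real \<Rightarrow> 'x::real_normed_vector"
  assumes fg: "weak_deriv_on a b f g" and \<tau>: "\<tau> \<le> b"
  shows "weak_deriv_on a \<tau> f g"
  unfolding weak_deriv_on_def
proof (intro conjI allI impI)
  show "loc_integrable a \<tau> f" "loc_integrable a \<tau> g"
    using assms by (auto simp: weak_deriv_on_def intro: loc_integrable_subinterval)
  fix \<phi> and l :: "'x \<Rightarrow>\<^sub>L real"
  assume test: "smooth_test_fun a \<tau> \<phi>"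
  obtain u v where uv: "a < u" "v < \<tau>" "\<And>t. t \<notin> {u..v} \<Longrightarrow> \<phi> t = 0" "\<And>t. t \<notin> {u..v} \<Longrightarrow> deriv \<phi> t = 0"
    "continuous_on UNIV \<phi>" "continuous_on UNIV (deriv \<phi>)"
    by (rule smooth_test_fun_support[OF test], rule that)
  have "smooth_test_fun a b \<phi>"
    using test \<tau> unfolding smooth_test_fun_def by (meson less_le_trans)
  then have "(LINT t:{a<..<b}|lebesgue. deriv \<phi> t * l (f t)) = - (LINT t:{a<..<b}|lebesgue. \<phi> t * l (g t))"
    using fg by (auto simp: weak_deriv_on_def)
  moreover have "(LINT t:{a<..<b}|lebesgue. \<psi> t * k t) = (LINT t:{a<..<\<tau>}|lebesgue. \<psi> t * k t)"
    if "\<psi> = \<phi> \<or> \<psi> = deriv \<phi>" for \<psi> k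
  proof -
    have "indicator {a<..<b} t *\<^sub>R (\<psi> t * k t) = indicator {a<..<\<tau>} t *\<^sub>R (\<psi> t * k t)" for t
      using that uv \<tau> by (cases "t \<in> {u..v}") (auto simp: indicator_def)
    then show ?thesis unfolding set_lebesgue_integral_def by presburger
  qed
  ultimately show "(LINT t:{a<..<\<tau>}|lebesgue. deriv \<phi> t * l (f t)) = - (LINT t:{a<..<\<tau>}|lebesgue. \<phi> t * l (g t))"
    by simp
qed

text \<open>Uniqueness of weak derivatives frees \<open>wW1p_norm\<close> from its choice operator,
  so that any weak derivative at hand may be used in the norm.\<close>

lemma wLp_norm_some_weak_deriv:
  assumes "weak_deriv_on a b f g"
  shows "wLp_norm a b \<kappa> p (SOME g. weak_deriv_on a b f g) = wLp_norm a b \<kappa> p g"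
proof -
  have "weak_deriv_on a b f (SOME g. weak_deriv_on a b f g)"
    using someI[of "weak_deriv_on a b f", OF assms] .
  from weak_deriv_on_unique[OF this assms] show ?thesis
    unfolding wLp_norm_def by (simp add: wLp_integral_cong_AE)
qed

lemma wW1p_lincomb:
  assumes "wW1p a b \<kappa> p f" "wW1p a b \<kappa> p g" "0 \<le> p"
  shows "wW1p a b \<kappa> p (\<lambda>t. f t + c *\<^sub>R g t)"
proof -
  obtain f' g' where fg: "weak_deriv_on a b f f'" "wLp a b \<kappa> p f'" "weak_deriv_on a b g g'" "wLp a b \<kappa> p g'"
    using assms unfolding wW1p_def by blast
  have "weak_deriv_on a b (\<lambda>t. f t + c *\<^sub>R g t) (\<lambda>t. f' t + c *\<^sub>R g' t)"
    by (rule weak_deriv_on_lincomb[OF fg(1,3)])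
  moreover have "wLp a b \<kappa> p (\<lambda>t. f' t + c *\<^sub>R g' t)"
    by (rule wLp_lincomb[OF fg(2,4) assms(3)])
  moreover have "wLp a b \<kappa> p (\<lambda>t. f t + c *\<^sub>R g t)"
    using assms by (intro wLp_lincomb) (auto simp: wW1p_def)
  ultimately show ?thesis unfolding wW1p_def by (intro conjI exI) 
qed

lemma wW1p_subinterval:
  assumes "wW1p a b \<kappa> p f" "\<tau> \<le> b"
  shows "wW1p a \<tau> \<kappa> p f"
  using assms wLp_subinterval weak_deriv_on_subinterval unfolding wW1p_def by metis

lemma MR_lincomb:
  assumes "MR j p \<kappa> a b u" "MR j p \<kappa> a b v" "0 \<le> p"
  shows "MR j p \<kappa> a b (\<lambda>t. u t + c *\<^sub>R v t)"
  using assms wLp_lincomb[of a b \<kappa> p u v c] wW1p_lincomb[of a b \<kappa> p "\<lambda>t. j (u t)" "\<lambda>t. j (v t)" c]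
  unfolding MR_def by (simp add: blinfun.add_right blinfun.scaleR_right)

lemma MR_subinterval:
  assumes "MR j p \<kappa> a b u" "\<tau> \<le> b"
  shows "MR j p \<kappa> a \<tau> u"
  using assms wLp_subinterval wW1p_subinterval unfolding MR_def by blast

text \<open>Linearity of the operator is required only at interior times, because \<open>B t\<close>
  is known to be linear only for t in [0,T].\<close>

lemma strong_solution_lincomb:
  assumes u: "strong_solution j \<A> a b f ua u" and v: "strong_solution j \<A> a b g va v"
    and lin: "\<And>t x y. a < t \<Longrightarrow> t < b \<Longrightarrow> \<A> t (x + c *\<^sub>R y) = \<A> t x + c *\<^sub>R \<A> t y"
  shows "strong_solution j \<A> a b (\<lambda>t. f t + c *\<^sub>R g t) (ua + c *\<^sub>R va) (\<lambda>t. u t + c *\<^sub>R v t)"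
  unfolding strong_solution_def
proof (intro conjI)
  have eqj: "(\<lambda>t. j (u t + c *\<^sub>R v t)) = (\<lambda>t. j (u t) + c *\<^sub>R j (v t))"
    by (simp add: blinfun.add_right blinfun.scaleR_right)
  have eqA: "AE t in lebesgue_on {a<..<b}. \<A> t (u t) + c *\<^sub>R \<A> t (v t) = \<A> t (u t + c *\<^sub>R v t)"
    by (rule AE_I2) (simp add: lin)
  show "wLp a b 0 1 (\<lambda>t. u t + c *\<^sub>R v t)"
    using u v by (intro wLp_lincomb) (auto simp: strong_solution_def)
  show "wW1p a b 0 1 (\<lambda>t. j (u t + c *\<^sub>R v t))"
    unfolding eqj using u v by (intro wW1p_lincomb) (auto simp: strong_solution_def)
  show "wLp a b 0 1 (\<lambda>t. \<A> t (u t + c *\<^sub>R v t))"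
    using u v by (intro wLp_cong_AE[OF eqA] wLp_lincomb) (auto simp: strong_solution_def)
  obtain w z where wz: "continuous_on {a..b} w" "AE t in lebesgue_on {a<..<b}. w t = j (u t)" "w a = ua"
    "continuous_on {a..b} z" "AE t in lebesgue_on {a<..<b}. z t = j (v t)" "z a = va"
    using u v unfolding strong_solution_def by blast
  have "continuous_on {a..b} (\<lambda>t. w t + c *\<^sub>R z t)"
    using wz by (intro continuous_intros)
  moreover have "AE t in lebesgue_on {a<..<b}. w t + c *\<^sub>R z t = j (u t + c *\<^sub>R v t)"
    using wz(2,5) by eventually_elim (simp add: blinfun.add_right blinfun.scaleR_right)
  ultimately show "\<exists>w. continuous_on {a..b} w \<and> (AE t in lebesgue_on {a<..<b}. w t = j (u t + c *\<^sub>R v t)) \<and> w a = ua + c *\<^sub>R va"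
    using wz(3,6) by (intro exI[of _ "\<lambda>t. w t + c *\<^sub>R z t"]) simp
  obtain h k where hk: "weak_deriv_on a b (\<lambda>t. j (u t)) h" "AE t in lebesgue_on {a<..<b}. h t + \<A> t (u t) = f t"
    "weak_deriv_on a b (\<lambda>t. j (v t)) k" "AE t in lebesgue_on {a<..<b}. k t + \<A> t (v t) = g t"
    using u v unfolding strong_solution_def by blast
  have "AE t in lebesgue_on {a<..<b}. (h t + c *\<^sub>R k t) + \<A> t (u t + c *\<^sub>R v t) = f t + c *\<^sub>R g t"
    using hk(2,4) eqA
  proof eventually_elim
    case (elim t)
    show ?case
      unfolding elim(3)[symmetric] elim(1,2)[symmetric] by (simp add: algebra_simps)
  qed
  with weak_deriv_on_lincomb[OF hk(1,3), of c]
  show "\<exists>g'. weak_deriv_on a b (\<lambda>t. j (u t + c *\<^sub>R v t)) g' \<and>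
      (AE t in lebesgue_on {a<..<b}. g' t + \<A> t (u t + c *\<^sub>R v t) = f t + c *\<^sub>R g t)"
    unfolding eqj by (intro exI[of _ "\<lambda>t. h t + c *\<^sub>R k t"]) simp
qed

lemma strong_solution_subinterval:
  assumes "strong_solution j \<A> a b f ua u" "\<tau> \<le> b"
  shows "strong_solution j \<A> a \<tau> f ua u"
proof -
  obtain w g where w: "continuous_on {a..b} w" "AE t in lebesgue_on {a<..<b}. w t = j (u t)" "w a = ua"
    and g: "weak_deriv_on a b (\<lambda>t. j (u t)) g" "AE t in lebesgue_on {a<..<b}. g t + \<A> t (u t) = f t"
    and 1: "wLp a b 0 1 u" "wW1p a b 0 1 (\<lambda>t. j (u t))" "wLp a b 0 1 (\<lambda>t. \<A> t (u t))"
    using assms unfolding strong_solution_def by blast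
  have "continuous_on {a..\<tau>} w"
    using w(1) by (rule continuous_on_subset) (use assms(2) in auto)
  then show ?thesis
    unfolding strong_solution_def
    using 1(1,3)[THEN wLp_subinterval[OF _ assms(2)]] wW1p_subinterval[OF 1(2) assms(2)]
      w(3) AE_lebesgue_on_subinterval[OF w(2) assms(2)]
      weak_deriv_on_subinterval[OF g(1) assms(2)] AE_lebesgue_on_subinterval[OF g(2) assms(2)]
    by blast
qed

text \<open>Moves B u between the operator and the right-hand side: from A + B to A in the a priori
  estimate, from A to A + B in the existence proof.\<close>

lemma strong_solution_perturb:
  assumes u: "strong_solution j \<A> a b f ua u" and L1: "wLp a b 0 1 (\<lambda>t. \<A>' t (u t))"
    and eq: "AE t in lebesgue_on {a<..<b}. f t - \<A> t (u t) = f' t - \<A>' t (u t)"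
  shows "strong_solution j \<A>' a b f' ua u"
proof -
  obtain g where g: "weak_deriv_on a b (\<lambda>t. j (u t)) g" "AE t in lebesgue_on {a<..<b}. g t + \<A> t (u t) = f t"
    using u unfolding strong_solution_def by blast
  have "AE t in lebesgue_on {a<..<b}. g t + \<A>' t (u t) = f' t"
    using g(2) eq by eventually_elim (metis add_diff_cancel_right' diff_add_cancel)
  then show ?thesis
    using u L1 g(1) unfolding strong_solution_def by blast
qed

section \<open>Trace estimate and exponential weights\<close>

text \<open>For almost every r in (t-s,t) the splitting w t = (w t - w r) + j (v r) bounds the
  K-functional by the integral of \<open>g\<close> over (r,t) plus s times the norm of v r.
  Averaging over r turns the last term into an integral of \<open>v\<close>.\<close>

lemma K_fun_trace_le:
  fixes j :: "'a::real_normed_vector \<Rightarrow>\<^sub>L 'b::real_normed_vector"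
  assumes wd: "weak_deriv_on 0 \<tau> (\<lambda>t. j (v t)) g" and w: "continuous_on {0..\<tau>} w"
    and wv: "AE t in lebesgue_on {0<..<\<tau>}. w t = j (v t)" and w0: "w 0 = 0"
    and v: "strongly_measurable_on {0<..<\<tau>} v" and t: "0 < t" "t < \<tau>" and s: "0 < s"
  shows "ennreal (K_fun j s (w t)) \<le>
    (\<integral>\<^sup>+x. ennreal (norm (g x) + norm (v x)) * indicator {t - min s t<..<t} x \<partial>lebesgue)"
proof (cases "t \<le> s")
  \<comment> \<open>The window would leave (0,\<tau>). Here the zero initial value replaces v r: the
    splitting is w t = (w t - w 0) + j 0.\<close>
  case True
  have "K_fun j s (w t) \<le> norm (w t - w 0)"
    using K_fun_le[of s "w t" "w t" j 0] s by (simp add: w0 blinfun.zero_right)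
  then have "ennreal (K_fun j s (w t)) \<le> ennreal (norm (w t - w 0))" by (rule ennreal_leI)
  also have "\<dots> \<le> (\<integral>\<^sup>+x. ennreal (norm (g x)) * indicator {0<..<t} x \<partial>lebesgue)"
    using t by (intro weak_deriv_on_norm_diff_le[OF wd w wv]) auto
  also have "\<dots> \<le> (\<integral>\<^sup>+x. ennreal (norm (g x) + norm (v x)) * indicator {t - min s t<..<t} x \<partial>lebesgue)"
    using True by (intro nn_integral_mono mult_mono) (auto intro: ennreal_leI)
  finally show ?thesis .
next
  case False
  let ?S = "{t - s<..<t}"
  have sub: "?S \<subseteq> {0<..<\<tau>}" using False t s by auto
  have gm: "(\<lambda>x. norm (g x)) \<in> borel_measurable (lebesgue_on ?S)"
    using wd strongly_measurable_on_subset[OF _ _ sub, of g]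
    by (intro strongly_measurable_on_norm) (auto simp: weak_deriv_on_def loc_integrable_def)
  have vm: "(\<lambda>x. norm (v x)) \<in> borel_measurable (lebesgue_on ?S)"
    using strongly_measurable_on_subset[OF _ _ sub v] by (intro strongly_measurable_on_norm) auto
  note gm' = borel_measurable_ennreal_indicator[OF _ gm] and vm' = borel_measurable_ennreal_indicator[OF _ vm]
  define I where "I = (\<integral>\<^sup>+x. ennreal (norm (g x)) * indicator ?S x \<partial>lebesgue)"
  have step: "ennreal (K_fun j s (w t)) \<le> I + ennreal s * ennreal (norm (v r))"
    if r: "r \<in> ?S" "w r = j (v r)" for r
  proof -
    have "K_fun j s (w t) \<le> norm (w t - w r) + s * norm (v r)"
      using s r(2) by (intro K_fun_le) auto
    then have "ennreal (K_fun j s (w t)) \<le> ennreal (norm (w t - w r)) + ennreal s * ennreal (norm (v r))"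
      using s by (subst (asm) ennreal_le_iff[symmetric]) (auto simp: ennreal_mult ennreal_plus)
    also have "ennreal (norm (w t - w r)) \<le> (\<integral>\<^sup>+x. ennreal (norm (g x)) * indicator {r<..<t} x \<partial>lebesgue)"
      using r t sub by (intro weak_deriv_on_norm_diff_le[OF wd w wv]) auto
    also have "\<dots> \<le> I"
      unfolding I_def using r by (intro nn_integral_mono) (auto simp: indicator_def)
    finally show ?thesis by (simp add: add_mono)
  qed
  have len: "emeasure lebesgue ?S = ennreal s" using s by simp
  \<comment> \<open>The K-functional is written as the mean over r of a constant, so that the
    pointwise estimate \<open>step\<close> can be integrated.\<close>
  have "ennreal (1/s) * ennreal (K_fun j s (w t)) * ennreal s
      = (\<integral>\<^sup>+r. (ennreal (1/s) * ennreal (K_fun j s (w t))) * indicator ?S r \<partial>lebesgue)"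
    using len by (subst nn_integral_cmult_indicator) auto
  also have "\<dots> \<le> (\<integral>\<^sup>+r. (ennreal (1/s) * I) * indicator ?S r + ennreal (norm (v r)) * indicator ?S r \<partial>lebesgue)"
  proof (rule nn_integral_mono_AE)
    have "AE r in lebesgue. r \<in> {0<..<\<tau>} \<longrightarrow> w r = j (v r)"
      using wv by (simp add: AE_restrict_space_iff)
    then show "AE r in lebesgue. (ennreal (1/s) * ennreal (K_fun j s (w t))) * indicator ?S r
        \<le> (ennreal (1/s) * I) * indicator ?S r + ennreal (norm (v r)) * indicator ?S r"
    proof eventually_elim
      case (elim r)
      show ?case
      proof (cases "r \<in> ?S")
        case True
        then have "ennreal (K_fun j s (w t)) \<le> I + ennreal s * ennreal (norm (v r))"
          using elim sub by (intro step) auto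
        then have "ennreal (1/s) * ennreal (K_fun j s (w t)) \<le> ennreal (1/s) * (I + ennreal s * ennreal (norm (v r)))"
          by (intro mult_left_mono) auto
        also have "\<dots> = ennreal (1/s) * I + (ennreal (1/s) * ennreal s) * ennreal (norm (v r))"
          by (simp add: distrib_left mult.assoc)
        also have "ennreal (1/s) * ennreal s = 1" using s by (simp flip: ennreal_mult)
        finally show ?thesis using True by simp
      qed simp
    qed
  qed
  also have "\<dots> = (ennreal (1/s) * I) * ennreal s + (\<integral>\<^sup>+r. ennreal (norm (v r)) * indicator ?S r \<partial>lebesgue)"
  proof (subst nn_integral_add)
    show "(\<lambda>r. (ennreal (1/s) * I) * indicator ?S r) \<in> borel_measurable lebesgue"
      by (intro borel_measurable_times_ennreal borel_measurable_const borel_measurable_indicator) simp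
  qed (use len vm' in \<open>auto simp: nn_integral_cmult_indicator\<close>)
  finally have "(ennreal (1/s) * ennreal s) * ennreal (K_fun j s (w t))
      \<le> (ennreal (1/s) * ennreal s) * I + (\<integral>\<^sup>+r. ennreal (norm (v r)) * indicator ?S r \<partial>lebesgue)"
    by (simp only: ac_simps)
  moreover have "ennreal (1/s) * ennreal s = 1" using s by (simp flip: ennreal_mult)
  ultimately have "ennreal (K_fun j s (w t)) \<le> I + (\<integral>\<^sup>+r. ennreal (norm (v r)) * indicator ?S r \<partial>lebesgue)"
    by simp
  also have "\<dots> = (\<integral>\<^sup>+x. ennreal (norm (g x)) * indicator ?S x + ennreal (norm (v x)) * indicator ?S x \<partial>lebesgue)"
    unfolding I_def using gm' vm' by (intro nn_integral_add[symmetric]) auto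
  also have "\<dots> = (\<integral>\<^sup>+x. ennreal (norm (g x) + norm (v x)) * indicator {t - min s t<..<t} x \<partial>lebesgue)"
    using False by (intro nn_integral_cong) (auto simp: indicator_def ennreal_plus)
  finally show ?thesis .
qed

text \<open>The window of length min s t enters \<open>weighted_L1_le\<close>, with \<open>g\<close>
  and \<open>v\<close> measured over (0,t) only. The resulting rate s^(1-1/p) improves on the
  trivial linear bound for large s.\<close>

lemma K_fun_trace_powr_le:
  fixes j :: "'a::real_normed_vector \<Rightarrow>\<^sub>L 'b::real_normed_vector"
  assumes wd: "weak_deriv_on 0 \<tau> (\<lambda>t. j (v t)) g" and w: "continuous_on {0..\<tau>} w"
    and wv: "AE t in lebesgue_on {0<..<\<tau>}. w t = j (v t)" and w0: "w 0 = 0"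
    and v: "strongly_measurable_on {0<..<\<tau>} v" and t: "0 < t" "t < \<tau>" and s: "0 < s"
    and p: "1 < p" and \<kappa>: "0 \<le> \<kappa>" "\<kappa> < p - 1"
    and \<Phi>: "0 < \<Phi>" "wLp_integral 0 t \<kappa> p (\<lambda>x. norm (g x) + norm (v x)) \<le> ennreal (\<Phi> powr p)"
  shows "K_fun j s (w t) \<le> (((p-1)/(p-1-\<kappa>) + 1) * \<Phi> * t powr (- \<kappa>/p)) * s powr (1 - 1/p)"
proof -
  have sub: "{0<..<t} \<subseteq> {0<..<\<tau>}" using t by auto
  have g: "strongly_measurable_on {0<..<\<tau>} g"
    using wd by (auto simp: weak_deriv_on_def loc_integrable_def)
  have m: "(\<lambda>x. norm (g x) + norm (v x)) \<in> borel_measurable (lebesgue_on {0<..<t})"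
    using strongly_measurable_on_subset[OF _ _ sub v] strongly_measurable_on_subset[OF _ _ sub g]
    by (intro borel_measurable_add strongly_measurable_on_norm) auto
  have c: "0 \<le> ((p-1)/(p-1-\<kappa>) + 1) * \<Phi>" using p \<kappa> \<Phi>(1) by auto
  have "ennreal (K_fun j s (w t)) \<le> (\<integral>\<^sup>+x. ennreal (norm (g x) + norm (v x)) * indicator {t - min s t<..<t} x \<partial>lebesgue)"
    by (rule K_fun_trace_le[OF wd w wv w0 v t s])
  also have "\<dots> \<le> ennreal (((p-1)/(p-1-\<kappa>) + 1) * \<Phi> * (min s t) powr (1 - 1/p) * t powr (- \<kappa>/p))"
    using \<Phi>(2) s t m unfolding wLp_integral_def by (intro weighted_L1_le[OF p \<kappa> _ _ _ _ \<Phi>(1)]) auto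
  finally have "K_fun j s (w t) \<le> ((p-1)/(p-1-\<kappa>) + 1) * \<Phi> * (min s t) powr (1 - 1/p) * t powr (- \<kappa>/p)"
    using c by (subst (asm) ennreal_le_iff) auto
  also have "\<dots> \<le> ((p-1)/(p-1-\<kappa>) + 1) * \<Phi> * s powr (1 - 1/p) * t powr (- \<kappa>/p)"
    using c s t p by (intro mult_right_mono mult_left_mono powr_mono2) auto
  finally show ?thesis by (simp only: ac_simps)
qed

text \<open>Formally h is the derivative of \<beta>, and the integral is the increment of exp (\<nu>
  \<beta>) divided by \<nu>. With a factor 2 to spare this follows without differentiating \<beta>:
  it holds on intervals where \<beta> grows little, and both sides add up over adjacent
  intervals.\<close>

lemma nn_integral_exp_weight_le:
  fixes h \<beta> :: "real \<Rightarrow> real"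
  assumes h: "\<And>x. 0 \<le> h x" "h \<in> borel_measurable (lebesgue_on {0<..<T})"
    and \<beta>: "continuous_on {0..T} \<beta>" "\<And>s t. 0 \<le> s \<Longrightarrow> s \<le> t \<Longrightarrow> t \<le> T \<Longrightarrow> \<beta> s \<le> \<beta> t"
    and h\<beta>: "\<And>s t. 0 \<le> s \<Longrightarrow> s \<le> t \<Longrightarrow> t \<le> T \<Longrightarrow>
      (\<integral>\<^sup>+x. ennreal (h x) * indicator {s<..<t} x \<partial>lebesgue) = ennreal (\<beta> t - \<beta> s)"
    and \<nu>: "0 < \<nu>" and t: "0 \<le> t" "t \<le> T"
  shows "(\<integral>\<^sup>+x. ennreal (h x * exp (\<nu> * \<beta> x)) * indicator {0<..<t} x \<partial>lebesgue)
    \<le> ennreal (2 * (exp (\<nu> * \<beta> t) - exp (\<nu> * \<beta> 0)) / \<nu>)"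
proof -
  define N where "N r s = (\<integral>\<^sup>+x. ennreal (h x * exp (\<nu> * \<beta> x)) * indicator {r<..<s} x \<partial>lebesgue)" for r s
  define P where "P r s \<longleftrightarrow> (0 \<le> r \<longrightarrow> s \<le> T \<longrightarrow> N r s \<le> ennreal (2 * (exp (\<nu> * \<beta> s) - exp (\<nu> * \<beta> r)) / \<nu>))" for r s
  have "(\<lambda>x. \<beta> x) \<in> borel_measurable (lebesgue_on {0<..<T})"
    by (intro continuous_imp_measurable_on_sets_lebesgue continuous_on_subset[OF \<beta>(1)])
       (auto simp: greaterThanLessThan_subseteq_atLeastAtMost_iff)
  then have hm: "(\<lambda>x. h x * exp (\<nu> * \<beta> x)) \<in> borel_measurable (lebesgue_on {0<..<T})"
    using h(2) by measurable
  have m: "(\<lambda>x. ennreal (h x * exp (\<nu> * \<beta> x)) * indicator {r<..<s} x) \<in> borel_measurable lebesgue"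
    if "0 \<le> r" "s \<le> T" for r s
    using that by (intro borel_measurable_ennreal_indicator measurable_restrict_mono[OF hm]) auto
  have small: "N r s \<le> ennreal (2 * (exp (\<nu> * \<beta> s) - exp (\<nu> * \<beta> r)) / \<nu>)"
    if rs: "0 \<le> r" "r \<le> s" "s \<le> T" and d: "\<nu> * (\<beta> s - \<beta> r) \<le> ln 2" for r s
  proof -
    have "N r s \<le> (\<integral>\<^sup>+x. ennreal (exp (\<nu> * \<beta> s)) * (ennreal (h x) * indicator {r<..<s} x) \<partial>lebesgue)"
      unfolding N_def
    proof (rule nn_integral_mono)
      fix x
      show "ennreal (h x * exp (\<nu> * \<beta> x)) * indicator {r<..<s} x \<le> ennreal (exp (\<nu> * \<beta> s)) * (ennreal (h x) * indicator {r<..<s} x)"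
      proof (cases "x \<in> {r<..<s}")
        case True
        then have "\<beta> x \<le> \<beta> s" using rs by (intro \<beta>(2)) auto
        then have "h x * exp (\<nu> * \<beta> x) \<le> exp (\<nu> * \<beta> s) * h x"
          using h(1)[of x] \<nu> by (subst mult.commute) (intro mult_right_mono, auto)
        then show ?thesis using True h(1)[of x] by (simp add: ennreal_leI flip: ennreal_mult)
      qed simp
    qed
    also have "\<dots> = ennreal (exp (\<nu> * \<beta> s)) * ennreal (\<beta> s - \<beta> r)"
      using h\<beta>[OF rs] rs
      by (subst nn_integral_cmult) (auto intro!: borel_measurable_ennreal_indicator measurable_restrict_mono[OF h(2)])
    also have "\<dots> = ennreal (exp (\<nu> * \<beta> s) * (\<beta> s - \<beta> r))"
      using \<beta>(2)[OF rs] by (simp add: ennreal_mult)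
    also have "exp (\<nu> * \<beta> s) * (\<beta> s - \<beta> r) \<le> 2 * (exp (\<nu> * \<beta> s) - exp (\<nu> * \<beta> r)) / \<nu>"
    proof -
      \<comment> \<open>As y \<le> ln 2 gives exp y \<le> 2, one has y exp y \<le> 2 y \<le> 2 (exp
        y - 1), which is the source of the factor 2.\<close>
      define y where "y = \<nu> * (\<beta> s - \<beta> r)"
      have y: "0 \<le> y" "y \<le> ln 2" using d \<beta>(2)[OF rs] \<nu> by (auto simp: y_def)
      have e: "exp (\<nu> * \<beta> s) = exp (\<nu> * \<beta> r) * exp y" by (simp add: y_def algebra_simps flip: exp_add)
      have "exp y \<le> 2" using y(2) by (metis exp_le_cancel_iff exp_ln zero_less_numeral)
      then have "exp y * y \<le> 2 * y" using y by (intro mult_right_mono)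
      also have "\<dots> \<le> 2 * (exp y - 1)"
      proof -
        have "y \<le> exp y - 1"
          using exp_ge_add_one_self[of y] by (metis add.commute le_diff_eq)
        then show ?thesis by (intro mult_left_mono) auto
      qed
      finally have "exp (\<nu> * \<beta> r) * (exp y * y) \<le> exp (\<nu> * \<beta> r) * (2 * (exp y - 1))"
        by (intro mult_left_mono) auto
      then have "exp (\<nu> * \<beta> s) * y \<le> 2 * (exp (\<nu> * \<beta> s) - exp (\<nu> * \<beta> r))"
        unfolding e by (simp add: algebra_simps)
      then show ?thesis using \<nu> by (simp add: y_def field_simps)
    qed
    finally show ?thesis by (simp add: ennreal_leI)
  qed
  \<comment> \<open>Bisection assembles the small intervals: continuity of \<beta> provides the
    local statement near each point.\<close>
  have "P 0 t"
    using t(1)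
  proof (induction rule: Bolzano)
    case (trans a b c)
    show ?case
      unfolding P_def
    proof (intro impI)
      assume ac: "0 \<le> a" "c \<le> T"
      have "N a c \<le> (\<integral>\<^sup>+x. ennreal (h x * exp (\<nu> * \<beta> x)) * indicator {a<..<b} x + ennreal (h x * exp (\<nu> * \<beta> x)) * indicator {b<..<c} x \<partial>lebesgue)"
        unfolding N_def
      proof (rule nn_integral_mono_AE)
        show "AE x in lebesgue. ennreal (h x * exp (\<nu> * \<beta> x)) * indicator {a<..<c} x
          \<le> ennreal (h x * exp (\<nu> * \<beta> x)) * indicator {a<..<b} x + ennreal (h x * exp (\<nu> * \<beta> x)) * indicator {b<..<c} x"
          using AE_lebesgue_neq[of b] by eventually_elim (auto simp: indicator_def)
      qed
      also have "\<dots> = N a b + N b c"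
        unfolding N_def using trans(3,4) ac by (intro nn_integral_add m) auto
      also have "\<dots> \<le> ennreal (2 * (exp (\<nu> * \<beta> b) - exp (\<nu> * \<beta> a)) / \<nu>) + ennreal (2 * (exp (\<nu> * \<beta> c) - exp (\<nu> * \<beta> b)) / \<nu>)"
        using trans ac by (intro add_mono) (auto simp: P_def)
      also have "\<dots> = ennreal (2 * (exp (\<nu> * \<beta> b) - exp (\<nu> * \<beta> a)) / \<nu> + 2 * (exp (\<nu> * \<beta> c) - exp (\<nu> * \<beta> b)) / \<nu>)"
        using \<beta>(2)[of a b] \<beta>(2)[of b c] trans(3,4) ac \<nu> by (intro ennreal_plus[symmetric]) auto
      also have "2 * (exp (\<nu> * \<beta> b) - exp (\<nu> * \<beta> a)) / \<nu> + 2 * (exp (\<nu> * \<beta> c) - exp (\<nu> * \<beta> b)) / \<nu> = 2 * (exp (\<nu> * \<beta> c) - exp (\<nu> * \<beta> a)) / \<nu>"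
        by (simp flip: add_divide_distrib)
      finally show "N a c \<le> ennreal (2 * (exp (\<nu> * \<beta> c) - exp (\<nu> * \<beta> a)) / \<nu>)" .
    qed
  next
    case (local x)
    then have x: "x \<in> {0..T}" using t by auto
    \<comment> \<open>Half of ln 2 / \<nu>, since both endpoints of an interval around x may deviate
      from \<beta> x by e.\<close>
    define e where "e = ln 2 / (2 * \<nu>)"
    have e: "e > 0" using \<nu> by (simp add: e_def)
    obtain d where d: "d > 0" "\<And>y. y \<in> {0..T} \<Longrightarrow> dist y x < d \<Longrightarrow> dist (\<beta> y) (\<beta> x) < e"
      using \<beta>(1) x e unfolding continuous_on_iff by metis
    have "P a b" if ab: "a \<le> x" "x \<le> b" "b - a < d" for a b
      unfolding P_def
    proof (intro impI small)
      assume "0 \<le> a" "b \<le> T"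
      then have "dist (\<beta> a) (\<beta> x) < e" "dist (\<beta> b) (\<beta> x) < e"
        using ab d(2)[of a] d(2)[of b] by (auto simp: dist_norm)
      then have "\<beta> b - \<beta> a \<le> 2 * e" by (simp add: dist_norm)
      then show "\<nu> * (\<beta> b - \<beta> a) \<le> ln 2" using \<nu> by (simp add: e_def field_simps)
    qed (use ab in auto)
    then show ?case using d(1) by blast
  qed
  then show ?thesis using t by (simp add: P_def N_def)
qed

text \<open>Because \<beta> T is the q-th power of the norm of b, the exponential weight enters the
  final constant through that norm only.\<close>

lemma wLp_primitive:
  fixes b :: "real \<Rightarrow> real"
  assumes b: "wLp 0 T 0 q b" and q: "0 < q" and T: "0 < T"
  obtains \<beta> where "continuous_on {0..T} \<beta>" "\<beta> 0 = 0" "\<beta> T = wLp_norm 0 T 0 q b powr q"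
    "\<And>s t. 0 \<le> s \<Longrightarrow> s \<le> t \<Longrightarrow> t \<le> T \<Longrightarrow> \<beta> s \<le> \<beta> t"
    "\<And>s t. 0 \<le> s \<Longrightarrow> s \<le> t \<Longrightarrow> t \<le> T \<Longrightarrow>
      (\<integral>\<^sup>+x. ennreal (\<bar>b x\<bar> powr q) * indicator {s<..<t} x \<partial>lebesgue) = ennreal (\<beta> t - \<beta> s)"
proof -
  define h where "h x = indicator {0<..<T} x *\<^sub>R (\<bar>b x\<bar> powr q)" for x
  have h0: "0 \<le> h x" for x by (simp add: h_def)
  have wI: "wLp_integral 0 T 0 q b = (\<integral>\<^sup>+x. ennreal (h x) \<partial>lebesgue)"
    unfolding wLp_integral_def by (intro nn_integral_cong) (auto simp: h_def indicator_def)
  have bm: "(\<lambda>x. \<bar>b x\<bar> powr q) \<in> borel_measurable (lebesgue_on {0<..<T})"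
    using b strongly_measurable_on_norm[of "{0<..<T}" b] unfolding wLp_def by simp
  have hm: "h \<in> borel_measurable lebesgue"
  proof -
    have "(\<lambda>x. if x \<in> {0<..<T} then \<bar>b x\<bar> powr q else 0) \<in> borel_measurable lebesgue"
      using bm by (subst borel_measurable_if) auto
    also have "(\<lambda>x. if x \<in> {0<..<T} then \<bar>b x\<bar> powr q else 0) = h"
      by (auto simp: h_def indicator_def)
    finally show ?thesis .
  qed
  have int: "integrable lebesgue h"
    using b wI h0 by (intro integrableI_bounded hm) (auto simp: wLp_def)
  then have abs: "set_integrable lebesgue S h" if "S \<in> sets lebesgue" for S
    unfolding set_integrable_def using that by (intro integrable_mult_indicator)
  have hI: "h integrable_on {s..t}" for s t
    using set_lebesgue_integral_eq_integral(1)[OF abs[of "{s..t}"]] by simp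
  define \<beta> where "\<beta> t = integral {0..t} h" for t
  have nn: "(\<integral>\<^sup>+x. ennreal (\<bar>b x\<bar> powr q) * indicator {s<..<t} x \<partial>lebesgue) = ennreal (\<beta> t - \<beta> s)"
    if st: "0 \<le> s" "s \<le> t" "t \<le> T" for s t
  proof -
    have "(\<integral>\<^sup>+x. ennreal (\<bar>b x\<bar> powr q) * indicator {s<..<t} x \<partial>lebesgue) = (\<integral>\<^sup>+x. ennreal (h x) * indicator {s..t} x \<partial>lebesgue)"
    proof (rule nn_integral_cong_AE)
      show "AE x in lebesgue. ennreal (\<bar>b x\<bar> powr q) * indicator {s<..<t} x = ennreal (h x) * indicator {s..t} x"
        using AE_lebesgue_neq[of s] AE_lebesgue_neq[of t]
        by eventually_elim (use st in \<open>auto simp: h_def indicator_def\<close>)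
    qed
    also have "\<dots> = ennreal (integral {s..t} h)"
      using h0 hI by (intro nn_integral_has_integral_indicator(1)) (auto intro: integrable_integral)
    also have "integral {s..t} h = \<beta> t - \<beta> s"
      unfolding \<beta>_def using Henstock_Kurzweil_Integration.integral_combine[of 0 s t h] st hI by simp
    finally show ?thesis .
  qed
  have mono: "\<beta> s \<le> \<beta> t" if "0 \<le> s" "s \<le> t" "t \<le> T" for s t
    unfolding \<beta>_def using that h0 hI by (intro integral_subset_le) auto
  have "wLp_integral 0 T 0 q b = ennreal (\<beta> T - \<beta> 0)"
    unfolding nn[OF order_refl less_imp_le[OF T] order_refl, symmetric] wLp_integral_def
    by (intro nn_integral_cong) (auto simp: indicator_def)
  moreover have "\<beta> 0 = 0" by (simp add: \<beta>_def)
  ultimately have "ennreal (wLp_norm 0 T 0 q b powr q) = ennreal (\<beta> T)"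
    using wLp_integral_eq_norm_powr[OF b q] by simp
  then have "\<beta> T = wLp_norm 0 T 0 q b powr q"
    using mono[of 0 T] T \<open>\<beta> 0 = 0\<close> by (subst (asm) ennreal_inj) auto
  moreover have "continuous_on {0..T} \<beta>"
    unfolding \<beta>_def using hI by (rule indefinite_integral_continuous_1)
  ultimately show thesis
    using that[of \<beta>] \<open>\<beta> 0 = 0\<close> mono nn by blast
qed

section \<open>The perturbation estimate\<close>

lemma wLp_norm_mono_interval:
  assumes "wLp a b \<kappa> p f" "t \<le> b" "0 < p"
  shows "wLp_norm a t \<kappa> p f \<le> wLp_norm a b \<kappa> p f"
  unfolding wLp_norm_def using assms wLp_integral_mono_interval[of a a t b \<kappa> p f]
  by (intro powr_mono2 enn2real_mono) (auto simp: wLp_def)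

lemma MR_norm_eq:
  fixes j :: "'a::real_normed_vector \<Rightarrow>\<^sub>L 'b::real_normed_vector"
  assumes "weak_deriv_on a b (\<lambda>t. j (u t)) g"
  shows "MR_norm j p \<kappa> a b u = max (wLp_norm a b \<kappa> p u) (wLp_norm a b \<kappa> p (\<lambda>t. j (u t)) + wLp_norm a b \<kappa> p g)"
  unfolding MR_norm_def wW1p_norm_def wLp_norm_some_weak_deriv[OF assms] ..

lemma MR_weak_deriv:
  fixes j :: "'a::real_normed_vector \<Rightarrow>\<^sub>L 'b::real_normed_vector"
  assumes "MR j p \<kappa> a b u"
  obtains g where "weak_deriv_on a b (\<lambda>t. j (u t)) g" "wLp a b \<kappa> p g"
  using assms unfolding MR_def wW1p_def by blast

lemma MR_norm_mono_interval:
  fixes j :: "'a::real_normed_vector \<Rightarrow>\<^sub>L 'b::real_normed_vector"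
  assumes "MR j p \<kappa> a b u" "t \<le> b" "0 < p"
  shows "MR_norm j p \<kappa> a t u \<le> MR_norm j p \<kappa> a b u"
proof -
  obtain g where g: "weak_deriv_on a b (\<lambda>t. j (u t)) g" "wLp a b \<kappa> p g"
    using assms(1) by (rule MR_weak_deriv)
  have "wLp a b \<kappa> p u" "wLp a b \<kappa> p (\<lambda>t. j (u t))"
    using assms(1) by (auto simp: MR_def wW1p_def)
  then show ?thesis
    unfolding MR_norm_eq[OF g(1)] MR_norm_eq[OF weak_deriv_on_subinterval[OF g(1) assms(2)]]
    using g(2) assms(2,3) by (intro max.mono add_mono wLp_norm_mono_interval) auto
qed

lemma MR_norm_nonneg: "0 \<le> MR_norm j p \<kappa> a b u"
  unfolding MR_norm_def by (intro max.coboundedI1 wLp_norm_nonneg)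

text \<open>The coefficient of the trace term once the interpolation integral is split at \<sigma> =
  (\<delta>/|b t|)^q: the constant of \<open>weighted_L1_le\<close>, the denominator from
  integrating over [\<sigma>,\<infinity>), and the power of \<delta> from \<sigma>^(1/q-1/p). As q >
  p it blows up for \<delta> \<rightarrow> 0, so smallness of this term has to come from
  \<nu>.\<close>

definition trace_const :: "real \<Rightarrow> real \<Rightarrow> real \<Rightarrow> real \<Rightarrow> real" where
  "trace_const p q \<kappa> \<delta> = ((p-1)/(p-1-\<kappa>) + 1) / (1/p - 1/q) * \<delta> powr (1 - q/p)"

text \<open>\<open>B t\<close> is a map on all of \<open>'b\<close> but is constrained only on the
  interpolation space, so it is applied only to elements of that space. \<open>\<beta>\<close>
  stands for the primitive of |b|^q starting at 0 and enters through these properties alone.\<close>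

locale lower_order_perturbation =
  fixes j :: "'a::banach \<Rightarrow>\<^sub>L 'b::banach"
    and p q \<kappa> T :: real and B :: "real \<Rightarrow> 'b \<Rightarrow> 'b" and b \<beta> :: "real \<Rightarrow> real"
  assumes p: "1 < p" and \<kappa>: "0 \<le> \<kappa>" "\<kappa> < p - 1" and q: "p < q" and T: "0 < T"
    and B_measurable: "\<And>x. x \<in> interp_space j (1 - 1/q) 1 \<Longrightarrow> strongly_measurable_on {0..T} (\<lambda>t. B t x)"
    and B_linear: "\<And>t x y c. t \<in> {0..T} \<Longrightarrow> x \<in> interp_space j (1 - 1/q) 1 \<Longrightarrow> y \<in> interp_space j (1 - 1/q) 1 \<Longrightarrow>
         B t (x + y) = B t x + B t y \<and> B t (c *\<^sub>R x) = c *\<^sub>R B t x"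
    and B_bound: "\<And>t x. t \<in> {0..T} \<Longrightarrow> x \<in> interp_space j (1 - 1/q) 1 \<Longrightarrow>
         norm (B t x) \<le> b t * interp_norm j (1 - 1/q) 1 x"
    and b: "wLp 0 T 0 q b"
    and \<beta>: "continuous_on {0..T} \<beta>" "\<beta> 0 = 0"
      "\<And>s t. 0 \<le> s \<Longrightarrow> s \<le> t \<Longrightarrow> t \<le> T \<Longrightarrow> \<beta> s \<le> \<beta> t"
      "\<And>s t. 0 \<le> s \<Longrightarrow> s \<le> t \<Longrightarrow> t \<le> T \<Longrightarrow>
        (\<integral>\<^sup>+x. ennreal (\<bar>b x\<bar> powr q) * indicator {s<..<t} x \<partial>lebesgue) = ennreal (\<beta> t - \<beta> s)"
begin

lemma embedding_in_interp_space: "j y \<in> interp_space j (1 - 1/q) 1"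
  using interp_norm_embedding[OF p q] by blast

lemma B_lincomb:
  assumes "t \<in> {0..T}"
  shows "B t (j (x + c *\<^sub>R y)) = B t (j x) + c *\<^sub>R B t (j y)"
  using B_linear[OF assms embedding_in_interp_space embedding_in_interp_space, of x "c *\<^sub>R y"]
    B_linear[OF assms embedding_in_interp_space embedding_in_interp_space, of y y c]
  by (simp add: blinfun.add_right blinfun.scaleR_right)

lemma B_bound_abs:
  assumes "t \<in> {0..T}"
  shows "norm (B t (j y)) \<le> \<bar>b t\<bar> * interp_norm j (1 - 1/q) 1 (j y)"
proof -
  have "b t * interp_norm j (1 - 1/q) 1 (j y) \<le> \<bar>b t\<bar> * interp_norm j (1 - 1/q) 1 (j y)"
    by (intro mult_right_mono) (auto simp: interp_norm_def)
  then show ?thesis using B_bound[OF assms embedding_in_interp_space, of y] by linarith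
qed

text \<open>On a simple function the composition is a finite sum of indicators times t \<mapsto> B t
  (j y), each measurable by hypothesis. For fixed t the map y \<mapsto> B t (j y) is Lipschitz with
  constant |b t| C, so the simple approximation of \<open>u\<close> carries over pointwise.\<close>

lemma B_strongly_measurable:
  assumes u: "strongly_measurable_on {0<..<\<tau>} u" and \<tau>: "\<tau> \<le> T"
  shows "strongly_measurable_on {0<..<\<tau>} (\<lambda>t. B t (j (u t)))"
proof -
  let ?S = "{0<..<\<tau>}"
  obtain C where C: "\<And>y. interp_norm j (1 - 1/q) 1 (j y) \<le> C * norm y"
    using interp_norm_embedding[OF p q] by blast
  obtain s where s: "\<And>n. simple_function (lebesgue_on ?S) (s n)"
    and lim: "AE t in lebesgue_on ?S. (\<lambda>n. s n t) \<longlonglongrightarrow> u t"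
    using u unfolding strongly_measurable_on_def by blast
  show ?thesis
  proof (rule strongly_measurable_on_AE_limit)
    fix n
    let ?V = "s n ` ?S"
    have fin: "finite ?V" using s[of n] by (simp add: simple_function_def)
    have "strongly_measurable_on ?S (\<lambda>t. \<Sum>y\<in>?V. (if s n t = y then 1 else 0) *\<^sub>R B t (j y))"
    proof (intro strongly_measurable_on_sum strongly_measurable_on_scaleR_simple)
      fix y
      show "simple_function (lebesgue_on ?S) (\<lambda>t. if s n t = y then 1 else 0 :: real)"
        by (rule simple_function_compose1[OF s])
      show "strongly_measurable_on ?S (\<lambda>t. B t (j y))"
        by (rule strongly_measurable_on_subset[OF _ _ _ B_measurable[OF embedding_in_interp_space]])
           (use \<tau> in auto)
    qed
    moreover have "AE t in lebesgue_on ?S. (\<Sum>y\<in>?V. (if s n t = y then 1 else 0) *\<^sub>R B t (j y)) = B t (j (s n t))"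
    proof (rule AE_I2)
      fix t assume "t \<in> space (lebesgue_on ?S)"
      then have "s n t \<in> ?V" by simp
      moreover have "(\<Sum>y\<in>?V. (if s n t = y then 1 else 0) *\<^sub>R B t (j y)) = (\<Sum>y\<in>?V. if s n t = y then B t (j y) else 0)"
        by (intro sum.cong) auto
      ultimately show "(\<Sum>y\<in>?V. (if s n t = y then 1 else 0) *\<^sub>R B t (j y)) = B t (j (s n t))"
        using fin by (simp add: sum.delta')
    qed
    ultimately show "strongly_measurable_on ?S (\<lambda>t. B t (j (s n t)))"
      by (rule strongly_measurable_on_AE_cong)
  next
    show "AE t in lebesgue_on ?S. (\<lambda>n. B t (j (s n t))) \<longlonglongrightarrow> B t (j (u t))"
      using lim AE_space
    proof eventually_elim
      case (elim t)
      then have t: "t \<in> {0..T}" using \<tau> by auto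
      have le: "norm (B t (j (s n t)) - B t (j (u t))) \<le> (\<bar>b t\<bar> * C) * norm (s n t - u t)" for n
      proof -
        have "B t (j (s n t)) - B t (j (u t)) = B t (j (s n t - u t))"
          using B_lincomb[OF t, of "s n t" "-1" "u t"] by simp
        also have "norm \<dots> \<le> \<bar>b t\<bar> * interp_norm j (1 - 1/q) 1 (j (s n t - u t))"
          by (rule B_bound_abs[OF t])
        also have "\<dots> \<le> \<bar>b t\<bar> * (C * norm (s n t - u t))"
          by (intro mult_left_mono C) auto
        finally show ?thesis by (simp add: mult.assoc)
      qed
      have "(\<lambda>n. s n t - u t) \<longlonglongrightarrow> 0" using elim(1) by (simp add: LIM_zero)
      then have "(\<lambda>n. (\<bar>b t\<bar> * C) * norm (s n t - u t)) \<longlonglongrightarrow> (\<bar>b t\<bar> * C) * norm (0::'a)"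
        by (intro tendsto_mult tendsto_const tendsto_norm)
      then have lim0: "(\<lambda>n. (\<bar>b t\<bar> * C) * norm (s n t - u t)) \<longlonglongrightarrow> 0" by simp
      have "(\<lambda>n. B t (j (s n t)) - B t (j (u t))) \<longlonglongrightarrow> 0"
        by (rule Lim_null_comparison[OF _ lim0]) (use le in simp)
      then show ?case by (simp add: LIM_zero_iff)
    qed
  qed simp
qed

lemma trace_const_nonneg: "0 \<le> trace_const p q \<kappa> \<delta>"
proof -
  have "1/q \<le> 1/p" using p q by (simp add: frac_le)
  then show ?thesis
    unfolding trace_const_def using p \<kappa> by (intro mult_nonneg_nonneg divide_nonneg_nonneg) auto
qed

text \<open>The splitting point \<open>\<sigma> = (\<delta> / \<bar>b t\<bar>)\<^sup>q\<close> of the interpolation integral balances the two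
  contributions: it removes \<open>b\<close> from the first one and turns the second into \<open>\<bar>b\<bar>\<^sup>q\<close> after taking
  \<open>p\<close>-th powers.\<close>

lemma B_pointwise_le:
  assumes t: "0 < t" "t \<le> T" and \<delta>: "0 < \<delta>" and \<Phi>: "0 \<le> \<Phi>"
    and K: "\<And>s. 0 < s \<Longrightarrow> K_fun j s (j y) \<le> (((p-1)/(p-1-\<kappa>) + 1) * \<Phi> * t powr (- \<kappa>/p)) * s powr (1 - 1/p)"
  shows "\<bar>t\<bar> powr \<kappa> * norm (B t (j y)) powr p \<le>
    2 powr p * ((q * \<delta>) powr p * (\<bar>t\<bar> powr \<kappa> * norm y powr p) + trace_const p q \<kappa> \<delta> powr p * (\<bar>b t\<bar> powr q * \<Phi> powr p))"
\<comment> \<open>The splitting point divides by |b t|; where b vanishes, so does B t (j y).\<close>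
proof (cases "b t = 0")
  case True
  then have "norm (B t (j y)) = 0" using B_bound_abs[of t y] t by simp
  then show ?thesis by (simp add: zero_le_mult_iff)
next
  case False
  define a where "a = \<bar>b t\<bar>"
  have a: "0 < a" using False by (simp add: a_def)
  define c where "c = (p-1)/(p-1-\<kappa>) + 1"
  have c: "0 \<le> c" using p \<kappa> by (simp add: c_def)
  define \<sigma> where "\<sigma> = (\<delta> / a) powr q"
  have \<sigma>: "0 < \<sigma>" using \<delta> a by (simp add: \<sigma>_def)
  have q0: "0 < q" using p q by simp
  have "interp_norm j (1 - 1/q) 1 (j y) \<le> q * \<sigma> powr (1/q) * norm y + (c * \<Phi> * t powr (- \<kappa>/p)) * \<sigma> powr (1/q - 1/p) / (1/p - 1/q)"
    using c \<Phi> K by (intro interp_norm_le p q \<sigma> K_fun_embedding) (auto simp: c_def)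
  then have "a * interp_norm j (1 - 1/q) 1 (j y) \<le> a * (q * \<sigma> powr (1/q) * norm y + (c * \<Phi> * t powr (- \<kappa>/p)) * \<sigma> powr (1/q - 1/p) / (1/p - 1/q))"
    using a by (intro mult_left_mono) auto
  also have "\<sigma> powr (1/q) = \<delta> / a" using q0 a \<delta> by (simp add: \<sigma>_def powr_powr)
  also have "\<sigma> powr (1/q - 1/p) = (\<delta> / a) powr (1 - q/p)"
  proof -
    have "q * (1/q - 1/p) = 1 - q/p" using q0 by (simp add: algebra_simps)
    then show ?thesis by (simp only: \<sigma>_def powr_powr)
  qed
  also have "(\<delta> / a) powr (1 - q/p) = \<delta> powr (1 - q/p) * (a powr (q/p) / a)"
    using a \<delta> by (simp add: powr_divide powr_diff)
  also have "a * (q * (\<delta> / a) * norm y + (c * \<Phi> * t powr (- \<kappa>/p)) * (\<delta> powr (1 - q/p) * (a powr (q/p) / a)) / (1/p - 1/q))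
      = (q * \<delta>) * norm y + trace_const p q \<kappa> \<delta> * (a powr (q/p) * (\<Phi> * t powr (- \<kappa>/p)))"
    using a by (simp add: trace_const_def c_def distrib_left)
  finally have "a * interp_norm j (1 - 1/q) 1 (j y) \<le> (q * \<delta>) * norm y + trace_const p q \<kappa> \<delta> * (a powr (q/p) * (\<Phi> * t powr (- \<kappa>/p)))" .
  then have "norm (B t (j y)) \<le> (q * \<delta>) * norm y + trace_const p q \<kappa> \<delta> * (a powr (q/p) * (\<Phi> * t powr (- \<kappa>/p)))"
    using B_bound_abs[of t y] t by (simp add: a_def)
  then have "norm (B t (j y)) powr p \<le> ((q * \<delta>) * norm y + trace_const p q \<kappa> \<delta> * (a powr (q/p) * (\<Phi> * t powr (- \<kappa>/p)))) powr p"
    using p by (intro powr_mono2) auto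
  also have "\<dots> \<le> 2 powr p * (((q * \<delta>) * norm y) powr p + (trace_const p q \<kappa> \<delta> * (a powr (q/p) * (\<Phi> * t powr (- \<kappa>/p)))) powr p)"
    using p q0 \<delta> \<Phi> trace_const_nonneg by (intro powr_add_le) auto
  also have "((q * \<delta>) * norm y) powr p = (q * \<delta>) powr p * norm y powr p"
    using q0 \<delta> by (simp add: powr_mult)
  also have "(trace_const p q \<kappa> \<delta> * (a powr (q/p) * (\<Phi> * t powr (- \<kappa>/p)))) powr p
      = trace_const p q \<kappa> \<delta> powr p * (a powr q * (\<Phi> powr p * t powr (- \<kappa>)))"
    using trace_const_nonneg \<Phi> p by (simp add: powr_mult powr_powr)
  finally have "\<bar>t\<bar> powr \<kappa> * norm (B t (j y)) powr p \<le> \<bar>t\<bar> powr \<kappa> *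
      (2 powr p * ((q * \<delta>) powr p * norm y powr p + trace_const p q \<kappa> \<delta> powr p * (a powr q * (\<Phi> powr p * t powr (- \<kappa>)))))"
    by (intro mult_left_mono) auto
  also have "\<dots> = 2 powr p * ((q * \<delta>) powr p * (\<bar>t\<bar> powr \<kappa> * norm y powr p) + trace_const p q \<kappa> \<delta> powr p * (a powr q * (\<Phi> powr p * (t powr \<kappa> * t powr (- \<kappa>)))))"
    using t by (simp add: algebra_simps)
  \<comment> \<open>The weight absorbs the singular factor of the trace estimate, leaving |b t|^q
    without any power of t.\<close>
  also have "t powr \<kappa> * t powr (- \<kappa>) = 1" using t by (simp flip: powr_add)
  finally show ?thesis by (simp add: a_def)
qed

text \<open>Growth of the solution norm like exp (\<nu> \<beta>) is inherited by B v. The term with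
  |b|^q is integrated against the exponential and gains 1/\<nu>, whereas the term with the norm of
  \<open>v\<close> gains nothing from \<nu> and relies on small \<delta>.\<close>

lemma B_integral_le:
  assumes v: "MR j p \<kappa> 0 \<tau> v" and sol: "strong_solution j \<A> 0 \<tau> f 0 v" and \<tau>: "0 < \<tau>" "\<tau> \<le> T"
    and \<delta>: "0 < \<delta>" and \<nu>: "0 < \<nu>" and \<mu>: "0 < \<mu>"
    and le: "\<And>t. 0 < t \<Longrightarrow> t \<le> \<tau> \<Longrightarrow> MR_norm j p \<kappa> 0 t v powr p \<le> \<mu> * exp (\<nu> * \<beta> t)"
    and t: "0 < t" "t \<le> \<tau>"
  shows "wLp_integral 0 t \<kappa> p (\<lambda>x. B x (j (v x)))
    \<le> ennreal ((2 powr p * (q * \<delta>) powr p + 2 powr (2*p+2) * trace_const p q \<kappa> \<delta> powr p / \<nu>) * \<mu> * exp (\<nu> * \<beta> t))"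
proof -
  have p0: "0 < p" "0 \<le> p" using p by auto
  obtain g where g: "weak_deriv_on 0 \<tau> (\<lambda>t. j (v t)) g" "wLp 0 \<tau> \<kappa> p g"
    using v by (rule MR_weak_deriv)
  obtain w where w: "continuous_on {0..\<tau>} w" "AE t in lebesgue_on {0<..<\<tau>}. w t = j (v t)" "w 0 = 0"
    using sol unfolding strong_solution_def by blast
  have wv: "wLp 0 \<tau> \<kappa> p v" using v by (simp add: MR_def)
  have vm: "strongly_measurable_on {0<..<\<tau>} v" using wv by (simp add: wLp_def)
  have parts: "wLp_integral 0 x \<kappa> p v \<le> ennreal (\<mu> * exp (\<nu> * \<beta> x))"
    "wLp_integral 0 x \<kappa> p g \<le> ennreal (\<mu> * exp (\<nu> * \<beta> x))" if x: "0 < x" "x \<le> \<tau>" for x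
  proof -
    have "wLp_norm 0 x \<kappa> p v \<le> MR_norm j p \<kappa> 0 x v" "wLp_norm 0 x \<kappa> p g \<le> MR_norm j p \<kappa> 0 x v"
      unfolding MR_norm_eq[OF weak_deriv_on_subinterval[OF g(1) x(2)]]
      using wLp_norm_nonneg[of 0 x \<kappa> p "\<lambda>t. j (v t)"] by auto
    then have "wLp_norm 0 x \<kappa> p v powr p \<le> MR_norm j p \<kappa> 0 x v powr p"
      "wLp_norm 0 x \<kappa> p g powr p \<le> MR_norm j p \<kappa> 0 x v powr p"
      using p0 by (auto intro!: powr_mono2 wLp_norm_nonneg)
    then show "wLp_integral 0 x \<kappa> p v \<le> ennreal (\<mu> * exp (\<nu> * \<beta> x))"
      "wLp_integral 0 x \<kappa> p g \<le> ennreal (\<mu> * exp (\<nu> * \<beta> x))"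
      unfolding wLp_integral_eq_norm_powr[OF wLp_subinterval[OF wv x(2)] p0(1)]
        wLp_integral_eq_norm_powr[OF wLp_subinterval[OF g(2) x(2)] p0(1)]
      using le[OF x] by (auto intro!: ennreal_leI)
  qed
  \<comment> \<open>The factor 2^(p+1) pays for adding the norms of \<open>g\<close> and
    \<open>v\<close>: each of their p-th power integrals is at most \<mu> exp (\<nu> \<beta> x), and
    splitting the sum costs 2^p.\<close>
  define \<Phi> where "\<Phi> x = (2 powr (p+1) * (\<mu> * exp (\<nu> * \<beta> x))) powr (1/p)" for x
  have \<Phi>: "0 < \<Phi> x" "\<Phi> x powr p = 2 powr (p+1) * (\<mu> * exp (\<nu> * \<beta> x))" for x
    using \<mu> p0 by (auto simp: \<Phi>_def powr_powr)
  have \<Phi>_ge: "wLp_integral 0 x \<kappa> p (\<lambda>y. norm (g y) + norm (v y)) \<le> ennreal (\<Phi> x powr p)"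
    if x: "0 < x" "x \<le> \<tau>" for x
  proof -
    have m: "strongly_measurable_on {0<..<x} (\<lambda>y. norm (h y))" if "wLp 0 \<tau> \<kappa> p h" for h :: "real \<Rightarrow> 'z::real_normed_vector"
      using wLp_subinterval[OF that x(2)] unfolding wLp_def
      by (intro strongly_measurable_on_compose2[where h="\<lambda>z _. norm z" and g=h]) (auto intro: tendsto_norm)
    have nn: "wLp_integral 0 x \<kappa> p (\<lambda>y. norm (h y)) = wLp_integral 0 x \<kappa> p h" for h :: "real \<Rightarrow> 'z::real_normed_vector"
      by (simp add: wLp_integral_def)
    have "wLp_integral 0 x \<kappa> p (\<lambda>y. norm (g y) + 1 *\<^sub>R norm (v y))
        \<le> ennreal (2 powr p) * (wLp_integral 0 x \<kappa> p (\<lambda>y. norm (g y)) + ennreal (\<bar>1\<bar> powr p) * wLp_integral 0 x \<kappa> p (\<lambda>y. norm (v y)))"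
      by (rule wLp_integral_lincomb_le[OF m[OF g(2)] m[OF wv] p0(2)])
    also have "\<dots> \<le> ennreal (2 powr p) * (ennreal (\<mu> * exp (\<nu> * \<beta> x)) + ennreal (\<mu> * exp (\<nu> * \<beta> x)))"
      using parts[OF x] by (intro mult_left_mono) (auto simp: nn intro!: add_mono)
    also have "\<dots> = ennreal (\<Phi> x powr p)"
    proof -
      have "ennreal (2 powr p) * (ennreal E + ennreal E) = ennreal (2 powr p * (2 * E))" if "0 \<le> E" for E
        using that by (simp add: ennreal_mult flip: mult_2)
      from this[of "\<mu> * exp (\<nu> * \<beta> x)"] show ?thesis
        unfolding \<Phi>(2) using \<mu> by (simp add: powr_add)
    qed
    finally show ?thesis by simp
  qed
  let ?V = "\<lambda>x. ennreal (\<bar>x\<bar> powr \<kappa> * norm (v x) powr p) * indicator {0<..<t} x"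
  let ?H = "\<lambda>x. ennreal (\<bar>b x\<bar> powr q * exp (\<nu> * \<beta> x)) * indicator {0<..<t} x"
  let ?D = "trace_const p q \<kappa> \<delta> powr p * (2 powr (p+1) * \<mu>)"
  have bm: "(\<lambda>x. \<bar>b x\<bar> powr q) \<in> borel_measurable (lebesgue_on {0<..<T})"
    using b strongly_measurable_on_norm[of "{0<..<T}" b] unfolding wLp_def by simp
  have tT: "t \<le> T" using t \<tau> by simp
  have Hm: "?H \<in> borel_measurable lebesgue"
  proof (rule borel_measurable_ennreal_indicator)
    have "\<beta> \<in> borel_measurable (lebesgue_on {0<..<t})"
      using tT by (intro continuous_imp_measurable_on_sets_lebesgue continuous_on_subset[OF \<beta>(1)]) auto
    moreover have "(\<lambda>x. \<bar>b x\<bar> powr q) \<in> borel_measurable (lebesgue_on {0<..<t})"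
      using tT by (intro measurable_restrict_mono[OF bm]) auto
    ultimately show "(\<lambda>x. \<bar>b x\<bar> powr q * exp (\<nu> * \<beta> x)) \<in> borel_measurable (lebesgue_on {0<..<t})"
      by measurable
  qed simp
  have Vm: "?V \<in> borel_measurable lebesgue"
    using wLp_subinterval[OF wv t(2)] by (intro wLp_integrand_measurable) (simp add: wLp_def)
  have "wLp_integral 0 t \<kappa> p (\<lambda>x. B x (j (v x)))
      \<le> (\<integral>\<^sup>+x. ennreal (2 powr p) * (ennreal ((q * \<delta>) powr p) * ?V x + ennreal ?D * ?H x) \<partial>lebesgue)"
    unfolding wLp_integral_def
  proof (rule nn_integral_mono_AE)
    have "AE x in lebesgue. x \<in> {0<..<\<tau>} \<longrightarrow> w x = j (v x)"
      using w(2) by (simp add: AE_restrict_space_iff)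
    then show "AE x in lebesgue. ennreal (\<bar>x\<bar> powr \<kappa> * norm (B x (j (v x))) powr p) * indicator {0<..<t} x
        \<le> ennreal (2 powr p) * (ennreal ((q * \<delta>) powr p) * ?V x + ennreal ?D * ?H x)"
    proof eventually_elim
      case (elim x)
      show ?case
      proof (cases "x \<in> {0<..<t}")
        case True
        then have x: "0 < x" "x < \<tau>" "x \<le> T" and wx: "w x = j (v x)" using elim t \<tau> by auto
        have "\<bar>x\<bar> powr \<kappa> * norm (B x (j (v x))) powr p \<le>
          2 powr p * ((q * \<delta>) powr p * (\<bar>x\<bar> powr \<kappa> * norm (v x) powr p) + trace_const p q \<kappa> \<delta> powr p * (\<bar>b x\<bar> powr q * \<Phi> x powr p))"
        proof (rule B_pointwise_le[OF x(1,3) \<delta> less_imp_le[OF \<Phi>(1)]])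
          fix s :: real assume s: "0 < s"
          show "K_fun j s (j (v x)) \<le> (((p-1)/(p-1-\<kappa>) + 1) * \<Phi> x * x powr (- \<kappa>/p)) * s powr (1 - 1/p)"
            unfolding wx[symmetric]
            using x by (intro K_fun_trace_powr_le[OF g(1) w vm x(1,2) s p \<kappa> \<Phi>(1)] \<Phi>_ge) auto
        qed
        also have "trace_const p q \<kappa> \<delta> powr p * (\<bar>b x\<bar> powr q * \<Phi> x powr p) = ?D * (\<bar>b x\<bar> powr q * exp (\<nu> * \<beta> x))"
          unfolding \<Phi>(2) by (simp only: ac_simps)
        finally have "ennreal (\<bar>x\<bar> powr \<kappa> * norm (B x (j (v x))) powr p)
            \<le> ennreal (2 powr p * ((q * \<delta>) powr p * (\<bar>x\<bar> powr \<kappa> * norm (v x) powr p) + ?D * (\<bar>b x\<bar> powr q * exp (\<nu> * \<beta> x))))"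
          by (rule ennreal_leI)
        also have "\<dots> = ennreal (2 powr p) * (ennreal ((q * \<delta>) powr p) * ennreal (\<bar>x\<bar> powr \<kappa> * norm (v x) powr p) + ennreal ?D * ennreal (\<bar>b x\<bar> powr q * exp (\<nu> * \<beta> x)))"
          using \<mu> by (simp add: ennreal_mult ennreal_plus)
        finally show ?thesis using True by simp
      qed simp
    qed
  qed
  also have "\<dots> = ennreal (2 powr p) * (ennreal ((q * \<delta>) powr p) * (\<integral>\<^sup>+x. ?V x \<partial>lebesgue) + ennreal ?D * (\<integral>\<^sup>+x. ?H x \<partial>lebesgue))"
    using Vm Hm by (simp add: nn_integral_cmult nn_integral_add)
  also have "\<dots> \<le> ennreal (2 powr p) * (ennreal ((q * \<delta>) powr p) * ennreal (\<mu> * exp (\<nu> * \<beta> t)) + ennreal ?D * ennreal (2 * exp (\<nu> * \<beta> t) / \<nu>))"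
  proof (intro mult_left_mono add_mono)
    show "(\<integral>\<^sup>+x. ?V x \<partial>lebesgue) \<le> ennreal (\<mu> * exp (\<nu> * \<beta> t))"
      using parts(1)[OF t] by (simp add: wLp_integral_def)
    have "(\<integral>\<^sup>+x. ?H x \<partial>lebesgue) \<le> ennreal (2 * (exp (\<nu> * \<beta> t) - exp (\<nu> * \<beta> 0)) / \<nu>)"
      using t tT by (intro nn_integral_exp_weight_le[OF _ bm \<beta>(1,3,4) \<nu>]) auto
    also have "\<dots> \<le> ennreal (2 * exp (\<nu> * \<beta> t) / \<nu>)"
      using \<nu> by (intro ennreal_leI divide_right_mono) auto
    finally show "(\<integral>\<^sup>+x. ?H x \<partial>lebesgue) \<le> ennreal (2 * exp (\<nu> * \<beta> t) / \<nu>)" .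
  qed auto
  also have "\<dots> = ennreal (2 powr p * ((q * \<delta>) powr p * (\<mu> * exp (\<nu> * \<beta> t)) + ?D * (2 * exp (\<nu> * \<beta> t) / \<nu>)))"
  proof -
    have "ennreal a * (ennreal x * ennreal y + ennreal z * ennreal w) = ennreal (a * (x * y + z * w))"
      if "0 \<le> a" "0 \<le> x" "0 \<le> y" "0 \<le> z" "0 \<le> w" for a x y z w
      using that by (simp add: ennreal_mult ennreal_plus)
    then show ?thesis using \<mu> \<nu> by simp
  qed
  also have "2 powr p * ((q * \<delta>) powr p * (\<mu> * exp (\<nu> * \<beta> t)) + ?D * (2 * exp (\<nu> * \<beta> t) / \<nu>))
      = (2 powr p * (q * \<delta>) powr p + (2 powr p * 2 powr (p+1) * 2) * trace_const p q \<kappa> \<delta> powr p / \<nu>) * \<mu> * exp (\<nu> * \<beta> t)"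
    by (simp add: algebra_simps)
  \<comment> \<open>The three factors come from \<open>B_pointwise_le\<close>, from \<Phi>, and from
    \<open>nn_integral_exp_weight_le\<close>.\<close>
  also have "2 powr p * 2 powr (p+1) * 2 = (2::real) powr (2*p+2)"
  proof -
    have "2 powr p * 2 powr (p+1) * 2 powr 1 = (2::real) powr (p + (p+1) + 1)" by (simp only: powr_add)
    moreover have "p + (p+1) + 1 = 2*p+2" by simp
    ultimately show ?thesis by (simp only: powr_one_gt_zero_iff powr_one zero_le_numeral)
  qed
  finally show ?thesis .
qed

end

section \<open>Parameters and series\<close>

text \<open>The order of choice matters: \<delta> makes the first term equal to 2^(-p-2), and then
  \<nu> is taken large against the value \<open>trace_const\<close> has at this \<delta>. Neither
  depends on T or b.\<close>

lemma contraction_params: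
  fixes p q \<kappa> M :: real
  assumes p: "1 < p" and q: "p < q" and M: "0 \<le> M"
  shows "\<exists>\<nu>>0. \<exists>\<delta>>0. (M + 1) powr p *
    (2 powr p * (q * \<delta>) powr p + 2 powr (2*p+2) * trace_const p q \<kappa> \<delta> powr p / \<nu>) \<le> 2 powr (-p-1)"
proof -
  \<comment> \<open>Solves (M+1) 2 q \<delta> = 2^(-(p+2)/p), whose p-th power is 2^(-p-2).\<close>
  define \<delta> where "\<delta> = 2 powr (-(p+2)/p) / (2 * q * (M+1))"
  have q0: "0 < q" using p q by simp
  have \<delta>: "0 < \<delta>" using q0 M by (simp add: \<delta>_def)
  define X where "X = (M + 1) powr p * (2 powr (2*p+2) * trace_const p q \<kappa> \<delta> powr p)"
  have X: "0 \<le> X" by (simp add: X_def)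
  define \<nu> where "\<nu> = 2 powr (p+2) * (X + 1)"
  have \<nu>: "0 < \<nu>" using X by (simp add: \<nu>_def)
  have "(M + 1) powr p * (2 powr p * (q * \<delta>) powr p) = ((M+1) * (2 * (q * \<delta>))) powr p"
    using M q0 \<delta> by (simp add: powr_mult)
  also have "(M+1) * (2 * (q * \<delta>)) = 2 powr (-(p+2)/p)"
  proof -
    have "a * (2 * (q * (X / (2 * q * a)))) = X" if "0 < a" for a X
      using that q0 by simp
    then show ?thesis using M unfolding \<delta>_def by (metis add_nonneg_pos zero_less_one)
  qed
  also have "(2 powr (-(p+2)/p)) powr p = (2::real) powr (-p-2)"
    using p by (simp add: powr_powr)
  finally have 1: "(M + 1) powr p * (2 powr p * (q * \<delta>) powr p) = 2 powr (-p-2)" .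
  have "X / \<nu> \<le> (X + 1) / \<nu>" using \<nu> by (intro divide_right_mono) auto
  also have "\<dots> = 1 / 2 powr (p+2)" using X by (simp add: \<nu>_def)
  also have "\<dots> = 2 powr (-p-2)" by (simp add: powr_minus_divide[symmetric])
  finally have 2: "X / \<nu> \<le> 2 powr (-p-2)" .
  have "(M + 1) powr p * (2 powr p * (q * \<delta>) powr p + 2 powr (2*p+2) * trace_const p q \<kappa> \<delta> powr p / \<nu>)
      = (M + 1) powr p * (2 powr p * (q * \<delta>) powr p) + X / \<nu>"
    by (simp add: X_def distrib_left)
  also have "\<dots> \<le> 2 powr (-p-2) + 2 powr (-p-2)" using 1 2 by simp
  also have "\<dots> = 2 powr (-p-1)"
  proof -
    have "-p-1 = (-p-2) + 1" by simp
    then show ?thesis by (simp only: powr_add) simp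
  qed
  finally show ?thesis using \<nu> \<delta> by blast
qed

text \<open>The infimum is itself an admissible constant: for positive norm of f divide by it, and
  for zero norm every admissible C already forces the solution norm to be 0. This allows the final
  constant to be a function of the infimum.\<close>

lemma maxreg_bound_const:
  assumes "maxreg_bound j \<A> p \<kappa> a b C"
  shows "maxreg_bound j \<A> p \<kappa> a b (maxreg_const j \<A> p \<kappa> a b)"
proof -
  let ?S = "{C. maxreg_bound j \<A> p \<kappa> a b C}"
  have ne: "?S \<noteq> {}" using assms by blast
  have pos: "0 \<le> C" if "C \<in> ?S" for C using that by (simp add: maxreg_bound_def)
  have M0: "0 \<le> Inf ?S" using ne pos by (intro cInf_greatest)
  show ?thesis
    unfolding maxreg_const_def maxreg_bound_def
  proof (intro conjI allI impI)
    show "0 \<le> Inf {C. 0 \<le> C \<and> (\<forall>f \<tau> v. wLp a b \<kappa> p f \<and> a < \<tau> \<and> \<tau> \<le> b \<and> MR j p \<kappa> a \<tau> v \<and>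
       strong_solution j \<A> a \<tau> f 0 v \<longrightarrow> MR_norm j p \<kappa> a \<tau> v \<le> C * wLp_norm a \<tau> \<kappa> p f)}"
      using M0 by (simp add: maxreg_bound_def)
    fix f \<tau> v
    assume v: "wLp a b \<kappa> p f \<and> a < \<tau> \<and> \<tau> \<le> b \<and> MR j p \<kappa> a \<tau> v \<and> strong_solution j \<A> a \<tau> f 0 v"
    let ?N = "wLp_norm a \<tau> \<kappa> p f"
    have le: "MR_norm j p \<kappa> a \<tau> v \<le> C * ?N" if "C \<in> ?S" for C
      using that v by (auto simp: maxreg_bound_def)
    have "MR_norm j p \<kappa> a \<tau> v \<le> Inf ?S * ?N"
    proof (cases "?N = 0")
      case True
      then show ?thesis using le[of C] assms by simp
    next
      case False
      then have N: "0 < ?N" using wLp_norm_nonneg[of a \<tau> \<kappa> p f] by simp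
      have "MR_norm j p \<kappa> a \<tau> v / ?N \<le> Inf ?S"
        using le N by (intro cInf_greatest[OF ne]) (simp add: divide_le_eq)
      then show ?thesis using N by (simp add: divide_le_eq)
    qed
    then show "MR_norm j p \<kappa> a \<tau> v \<le> Inf {C. 0 \<le> C \<and> (\<forall>f \<tau> v. wLp a b \<kappa> p f \<and> a < \<tau> \<and> \<tau> \<le> b \<and> MR j p \<kappa> a \<tau> v \<and>
       strong_solution j \<A> a \<tau> f 0 v \<longrightarrow> MR_norm j p \<kappa> a \<tau> v \<le> C * wLp_norm a \<tau> \<kappa> p f)} * ?N"
      by (simp add: maxreg_bound_def)
  qed
qed

lemma maxreg_const_le:
  "maxreg_bound j \<A> p \<kappa> a b C \<Longrightarrow> maxreg_const j \<A> p \<kappa> a b \<le> C"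
  unfolding maxreg_const_def by (intro cInf_lower bdd_belowI[of _ 0]) (auto simp: maxreg_bound_def)

section \<open>Convergence of series in the weighted space\<close>

lemma norm_suminf_geometric_le:
  fixes x :: "nat \<Rightarrow> 'x::banach"
  assumes "\<And>k. norm (x k) \<le> A * (1/2) ^ (k + N)"
  shows "summable x" "norm (\<Sum>k. x k) \<le> 2 * A"
proof -
  have "0 \<le> A * (1/2) ^ N" using order_trans[OF norm_ge_zero assms[of 0]] by simp
  moreover have "0 < (1/2::real) ^ N" by simp
  ultimately have A: "0 \<le> A" using zero_le_mult_iff not_less by blast
  have le: "norm (x k) \<le> A * (1/2) ^ k" for k
  proof -
    have "(1/2::real) ^ (k + N) \<le> (1/2) ^ k" by (intro power_decreasing) auto
    then show ?thesis using assms[of k] A by (meson mult_left_mono order_trans)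
  qed
  have sm: "summable (\<lambda>k. A * (1/2::real) ^ k)" by (intro summable_mult summable_geometric) simp
  show "summable x" using le by (intro summable_comparison_test'[OF sm, of 0]) auto
  have "norm (\<Sum>k. x k) \<le> (\<Sum>k. A * (1/2::real) ^ k)"
    by (rule norm_suminf_le[OF le sm])
  also have "\<dots> = 2 * A" by (subst suminf_mult) (auto simp: suminf_geometric)
  finally show "norm (\<Sum>k. x k) \<le> 2 * A" .
qed

text \<open>The terms are dominated by \<open>\<parallel>h\<^sub>k\<parallel> \<le> 2\<^bsup>-k\<^esup> sup\<^sub>i 2\<^sup>i \<parallel>h\<^sub>i\<parallel>\<close>, which avoids Minkowski's inequality.\<close>

lemma wLp_series:
  fixes h :: "nat \<Rightarrow> real \<Rightarrow> 'x::banach"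
  assumes h: "\<And>n. strongly_measurable_on {0<..<b} (h n)" and p: "0 < p" and \<Gamma>: "0 \<le> \<Gamma>"
    and le: "\<And>n. wLp_integral 0 b \<kappa> p (h n) \<le> ennreal (\<Gamma> * (2 powr (-p-1)) ^ n)"
  obtains g where "strongly_measurable_on {0<..<b} g"
    "\<And>N. wLp_integral 0 b \<kappa> p (\<lambda>x. g x - (\<Sum>n<N. h n x)) \<le> ennreal (2 powr p * \<Gamma> * 2 * (1/2) ^ N)"
proof -
  \<comment> \<open>The k-th integral decays like 2^(-(p+1)k). Multiplying by 2^(pk) leaves decay
    2^(-k), so the weighted sum \<open>R N\<close> still has a finite integral, of order 2^(-N), and
    is finite almost everywhere.\<close>
  define c where "c k x = (2 powr p) ^ k * (\<bar>x\<bar> powr \<kappa> * norm (h k x) powr p)" for k x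
  have c0: "0 \<le> c k x" for k x by (simp add: c_def)
  define R where "R N x = (\<Sum>k. ennreal (c (k + N) x) * indicator {0<..<b} x)" for N x
  have c_eq: "ennreal (c k x) * indicator {0<..<b} x =
      ennreal ((2 powr p) ^ k) * (ennreal (\<bar>x\<bar> powr \<kappa> * norm (h k x) powr p) * indicator {0<..<b} x)" for k x
    unfolding c_def by (subst ennreal_mult) (auto simp: mult.assoc)
  have cm: "(\<lambda>x. ennreal (c k x) * indicator {0<..<b} x) \<in> borel_measurable lebesgue" for k
    unfolding c_eq
    by (intro borel_measurable_times_ennreal borel_measurable_const wLp_integrand_measurable h)
  have ci: "(\<integral>\<^sup>+x. ennreal (c k x) * indicator {0<..<b} x \<partial>lebesgue) \<le> ennreal (\<Gamma> * (1/2) ^ k)" for k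
  proof -
    have "(\<integral>\<^sup>+x. ennreal (c k x) * indicator {0<..<b} x \<partial>lebesgue) = ennreal ((2 powr p) ^ k) * wLp_integral 0 b \<kappa> p (h k)"
      unfolding c_eq wLp_integral_def by (rule nn_integral_cmult[OF wLp_integrand_measurable[OF h]])
    also have "\<dots> \<le> ennreal ((2 powr p) ^ k) * ennreal (\<Gamma> * (2 powr (-p-1)) ^ k)"
      by (intro mult_left_mono le) auto
    also have "\<dots> = ennreal (\<Gamma> * (2 powr p * 2 powr (-p-1)) ^ k)"
      using \<Gamma> by (simp add: power_mult_distrib ac_simps flip: ennreal_mult)
    also have "2 powr p * 2 powr (-p-1) = (1/2::real)"
      by (simp add: powr_minus_divide flip: powr_add)
    finally show ?thesis .
  qed
  have RI: "(\<integral>\<^sup>+x. R N x \<partial>lebesgue) \<le> ennreal (\<Gamma> * 2 * (1/2) ^ N)" for N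
  proof -
    have "(\<integral>\<^sup>+x. R N x \<partial>lebesgue) = (\<Sum>k. \<integral>\<^sup>+x. ennreal (c (k + N) x) * indicator {0<..<b} x \<partial>lebesgue)"
      unfolding R_def by (rule nn_integral_suminf[OF cm])
    also have "\<dots> \<le> (\<Sum>k. ennreal (\<Gamma> * (1/2) ^ N * (1/2) ^ k))"
    proof (intro suminf_le summableI)
      show "(\<integral>\<^sup>+x. ennreal (c (k + N) x) * indicator {0<..<b} x \<partial>lebesgue) \<le> ennreal (\<Gamma> * (1/2) ^ N * (1/2) ^ k)" for k
        using ci[of "k + N"] by (simp add: power_add mult.assoc mult.commute[of "(1/2) ^ k"])
    qed
    also have "\<dots> = ennreal (\<Gamma> * (1/2) ^ N * 2)"
    proof (rule suminf_ennreal_eq)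
      show "0 \<le> \<Gamma> * (1/2) ^ N * (1/2) ^ k" for k using \<Gamma> by simp
      show "(\<lambda>k. \<Gamma> * (1/2) ^ N * (1/2::real) ^ k) sums (\<Gamma> * (1/2) ^ N * 2)"
        using geometric_sums[of "1/2::real"] by (intro sums_mult) simp
    qed
    finally show ?thesis by (simp add: ac_simps)
  qed
  have Rm: "R N \<in> borel_measurable lebesgue" for N
    unfolding R_def using cm by (intro borel_measurable_suminf_order) 
  have "AE x in lebesgue. \<forall>N. R N x \<noteq> \<infinity>"
    unfolding AE_all_countable
  proof
    fix N show "AE x in lebesgue. R N x \<noteq> \<infinity>"
      using RI[of N] Rm by (intro nn_integral_PInf_AE) (auto simp: top_unique)
  qed
  then have "AE x in lebesgue. x \<in> {0<..<b} \<longrightarrow> (\<forall>N. summable (\<lambda>k. h (k + N) x) \<and>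
      ennreal (\<bar>x\<bar> powr \<kappa> * norm (\<Sum>k. h (k + N) x) powr p) \<le> ennreal (2 powr p) * R N x)"
  proof eventually_elim
    case (elim x)
    show ?case
    proof (intro impI allI)
      fix N assume x: "x \<in> {0<..<b}"
      then have x0: "0 < \<bar>x\<bar> powr \<kappa>" by simp
      define r where "r = enn2real (R N x)"
      have r: "R N x = ennreal r" "0 \<le> r" using elim by (auto simp: r_def less_top)
      \<comment> \<open>Each term of \<open>R N\<close> is at most r, that is, h (k+N) x has norm at
        most A 2^(-k-N). The tail is then bounded by 2 A, and its smallness in N comes from the
        integral of \<open>R N\<close>.\<close>
      define A where "A = (r / \<bar>x\<bar> powr \<kappa>) powr (1/p)"
      have A: "0 \<le> A" "\<bar>x\<bar> powr \<kappa> * A powr p = r"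
        using x0 r p by (auto simp: A_def powr_powr)
      have "norm (h (k + N) x) \<le> A * (1/2) ^ (k + N)" for k
      proof -
        have "ennreal (c (k + N) x) \<le> R N x"
          unfolding R_def using x sum_le_suminf[of "\<lambda>k. ennreal (c (k + N) x)" "{k}"] by (simp add: summableI)
        then have "c (k + N) x \<le> r" using r c0 by simp
        then have "((2 powr p) ^ (k + N) * norm (h (k + N) x) powr p) * \<bar>x\<bar> powr \<kappa> \<le> r"
          by (simp only: c_def ac_simps)
        then have "(2 powr p) ^ (k + N) * norm (h (k + N) x) powr p \<le> r / \<bar>x\<bar> powr \<kappa>"
          using x0 by (simp add: pos_le_divide_eq)
        moreover have "(2 powr p) ^ (k + N) * norm (h (k + N) x) powr p = (2 ^ (k + N) * norm (h (k + N) x)) powr p"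
          by (simp add: powr_mult powr_powr flip: powr_realpow) (simp add: mult.commute)
        ultimately have "((2 ^ (k + N) * norm (h (k + N) x)) powr p) powr (1/p) \<le> A"
          unfolding A_def using p by (intro powr_mono2) auto
        then have "2 ^ (k + N) * norm (h (k + N) x) \<le> A" using p by (simp add: powr_powr)
        then show ?thesis by (simp add: field_simps power_one_over)
      qed
      note geo = norm_suminf_geometric_le[OF this]
      have "norm (\<Sum>k. h (k + N) x) powr p \<le> (2 * A) powr p"
        using geo(2) p by (intro powr_mono2) auto
      then have "\<bar>x\<bar> powr \<kappa> * norm (\<Sum>k. h (k + N) x) powr p \<le> \<bar>x\<bar> powr \<kappa> * (2 * A) powr p"
        by (intro mult_left_mono) auto
      also have "\<dots> = 2 powr p * (\<bar>x\<bar> powr \<kappa> * A powr p)" using A by (simp add: powr_mult)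
      also have "\<dots> = 2 powr p * r" using A(2) by simp
      finally have "ennreal (\<bar>x\<bar> powr \<kappa> * norm (\<Sum>k. h (k + N) x) powr p) \<le> ennreal (2 powr p) * R N x"
        using r by (simp add: ennreal_leI flip: ennreal_mult)
      then show "summable (\<lambda>k. h (k + N) x) \<and>
          ennreal (\<bar>x\<bar> powr \<kappa> * norm (\<Sum>k. h (k + N) x) powr p) \<le> ennreal (2 powr p) * R N x"
        using geo(1) by simp
    qed
  qed
  then have ae: "AE x in lebesgue_on {0<..<b}. \<forall>N. summable (\<lambda>k. h (k + N) x) \<and>
      ennreal (\<bar>x\<bar> powr \<kappa> * norm (\<Sum>k. h (k + N) x) powr p) \<le> ennreal (2 powr p) * R N x"
    by (simp add: AE_restrict_space_iff)
  define g where "g x = (\<Sum>k. h k x)" for x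
  show thesis
  proof (rule that)
    show "strongly_measurable_on {0<..<b} g"
    proof (rule strongly_measurable_on_AE_limit)
      show "strongly_measurable_on {0<..<b} (\<lambda>x. \<Sum>k<n. h k x)" for n
        by (intro strongly_measurable_on_sum h)
      show "AE x in lebesgue_on {0<..<b}. (\<lambda>n. \<Sum>k<n. h k x) \<longlonglongrightarrow> g x"
        using ae
      proof eventually_elim
        case (elim x)
        then have "summable (\<lambda>k. h (k + 0) x)" by blast
        then show ?case unfolding g_def using summable_LIMSEQ by simp
      qed
    qed simp
    fix N
    have "wLp_integral 0 b \<kappa> p (\<lambda>x. g x - (\<Sum>n<N. h n x)) \<le> (\<integral>\<^sup>+x. ennreal (2 powr p) * R N x \<partial>lebesgue)"
      unfolding wLp_integral_def
    proof (rule nn_integral_mono_AE)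
      have "AE x in lebesgue. x \<in> {0<..<b} \<longrightarrow> (\<forall>N. summable (\<lambda>k. h (k + N) x) \<and>
          ennreal (\<bar>x\<bar> powr \<kappa> * norm (\<Sum>k. h (k + N) x) powr p) \<le> ennreal (2 powr p) * R N x)"
        using ae by (simp add: AE_restrict_space_iff)
      then show "AE x in lebesgue. ennreal (\<bar>x\<bar> powr \<kappa> * norm (g x - (\<Sum>n<N. h n x)) powr p) * indicator {0<..<b} x \<le> ennreal (2 powr p) * R N x"
      proof eventually_elim
        case (elim x)
        show ?case
        proof (cases "x \<in> {0<..<b}")
          case True
          then have "summable (\<lambda>k. h (k + 0) x)" using elim by blast
          then have "g x - (\<Sum>n<N. h n x) = (\<Sum>k. h (k + N) x)"
            unfolding g_def using suminf_split_initial_segment[of "\<lambda>k. h k x" N] by simp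
          then show ?thesis using True elim by simp
        qed simp
      qed
    qed
    also have "\<dots> = ennreal (2 powr p) * (\<integral>\<^sup>+x. R N x \<partial>lebesgue)"
      by (rule nn_integral_cmult[OF Rm])
    also have "\<dots> \<le> ennreal (2 powr p) * ennreal (\<Gamma> * 2 * (1/2) ^ N)"
      by (intro mult_left_mono RI) auto
    also have "\<dots> = ennreal (2 powr p * \<Gamma> * 2 * (1/2) ^ N)"
      using \<Gamma> by (simp add: ac_simps flip: ennreal_mult)
    finally show "wLp_integral 0 b \<kappa> p (\<lambda>x. g x - (\<Sum>n<N. h n x)) \<le> ennreal (2 powr p * \<Gamma> * 2 * (1/2) ^ N)" .
  qed
qed

section \<open>Maximal regularity of the perturbed problem\<close>

context lower_order_perturbation
begin

lemma \<beta>_nonneg: "0 \<le> t \<Longrightarrow> t \<le> T \<Longrightarrow> 0 \<le> \<beta> t"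
  using \<beta>(3)[of 0 t] \<beta>(2) by simp

text \<open>Purely qualitative: \<open>B_integral_le\<close> with \<delta> = \<nu> = 1 and the
  constant growth bound given by the norm over the whole of (0,\<tau>), as exp (\<beta> t) \<ge> 1.
  It makes sense of f - B v as a right-hand side.\<close>

lemma B_wLp:
  assumes v: "MR j p \<kappa> 0 \<tau> v" and sol: "strong_solution j \<A> 0 \<tau> f 0 v" and \<tau>: "0 < \<tau>" "\<tau> \<le> T"
  shows "wLp 0 \<tau> \<kappa> p (\<lambda>t. B t (j (v t)))"
proof -
  define \<mu> where "\<mu> = MR_norm j p \<kappa> 0 \<tau> v powr p + 1"
  have \<mu>: "0 < \<mu>" by (simp add: \<mu>_def add_nonneg_pos)
  have "MR_norm j p \<kappa> 0 t v powr p \<le> \<mu> * exp (1 * \<beta> t)" if t: "0 < t" "t \<le> \<tau>" for t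
  proof -
    have "MR_norm j p \<kappa> 0 t v powr p \<le> MR_norm j p \<kappa> 0 \<tau> v powr p"
      using p v t by (intro powr_mono2 MR_norm_mono_interval MR_norm_nonneg) auto
    also have "\<dots> \<le> \<mu> * 1" by (simp add: \<mu>_def)
    also have "\<dots> \<le> \<mu> * exp (1 * \<beta> t)"
      using \<mu> \<beta>_nonneg[of t] t \<tau> by (intro mult_left_mono) auto
    finally show ?thesis .
  qed
  note le = B_integral_le[OF v sol \<tau> zero_less_one zero_less_one \<mu> this \<tau>(1) order_refl]
  have "wLp_integral 0 \<tau> \<kappa> p (\<lambda>t. B t (j (v t))) < \<infinity>"
    using le_less_trans[OF le ennreal_less_top] by simp
  moreover have "strongly_measurable_on {0<..<\<tau>} (\<lambda>t. B t (j (v t)))"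
    using v \<tau> by (intro B_strongly_measurable) (auto simp: MR_def wLp_def)
  ultimately show ?thesis by (simp add: wLp_def)
qed

end

locale maxreg_perturbation = lower_order_perturbation j p q \<kappa> T B b \<beta>
  for j :: "'a::banach \<Rightarrow>\<^sub>L 'b::banach" and p q \<kappa> T B b \<beta> +
  fixes A :: "real \<Rightarrow> 'a \<Rightarrow>\<^sub>L 'b" and M \<nu> \<delta> :: real
  assumes bound: "maxreg_bound j (\<lambda>t x. A t x) p \<kappa> 0 T M"
    and \<nu>: "0 < \<nu>" and \<delta>: "0 < \<delta>"
    and params: "(M + 1) powr p * (2 powr p * (q * \<delta>) powr p + 2 powr (2*p+2) * trace_const p q \<kappa> \<delta> powr p / \<nu>)
      \<le> 2 powr (-p-1)"
begin

lemma M_nonneg: "0 \<le> M"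
  using bound by (simp add: maxreg_bound_def)

text \<open>In the norm \<open>sup\<^sub>t exp (- \<nu> \<beta> t) \<parallel>g\<parallel>\<^sup>p\<close> (over \<open>(0,t)\<close>), the map sending \<open>g\<close> to \<open>B u\<close>, where \<open>u\<close> solves
  \<open>u' + A u = g\<close>, is a contraction.\<close>

lemma contraction:
  assumes g: "wLp 0 T \<kappa> p g" and v: "MR j p \<kappa> 0 \<tau> v" and sol: "strong_solution j (\<lambda>t x. A t x) 0 \<tau> g 0 v"
    and \<tau>: "0 < \<tau>" "\<tau> \<le> T" and \<Gamma>: "0 < \<Gamma>"
    and le: "\<And>t. 0 < t \<Longrightarrow> t \<le> \<tau> \<Longrightarrow> wLp_integral 0 t \<kappa> p g \<le> ennreal (\<Gamma> * exp (\<nu> * \<beta> t))"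
    and t: "0 < t" "t \<le> \<tau>"
  shows "wLp_integral 0 t \<kappa> p (\<lambda>x. B x (j (v x))) \<le> ennreal (2 powr (-p-1) * \<Gamma> * exp (\<nu> * \<beta> t))"
proof -
  let ?c = "2 powr p * (q * \<delta>) powr p + 2 powr (2*p+2) * trace_const p q \<kappa> \<delta> powr p / \<nu>"
  have p0: "0 < p" "0 \<le> p" using p by auto
  \<comment> \<open>M + 1 in place of M keeps this factor positive in case M = 0.\<close>
  have \<mu>: "0 < (M + 1) powr p * \<Gamma>" using M_nonneg \<Gamma> by simp
  have "MR_norm j p \<kappa> 0 x v powr p \<le> (M + 1) powr p * \<Gamma> * exp (\<nu> * \<beta> x)" if x: "0 < x" "x \<le> \<tau>" for x
  proof -
    have N: "0 \<le> wLp_norm 0 x \<kappa> p g" by (rule wLp_norm_nonneg)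
    \<comment> \<open>Causality: the restriction of \<open>v\<close> to (0,x) is a solution there,
      and the constant M serves every x.\<close>
    have "MR_norm j p \<kappa> 0 x v \<le> M * wLp_norm 0 x \<kappa> p g"
      using bound g x \<tau> MR_subinterval[OF v x(2)] strong_solution_subinterval[OF sol x(2)]
      unfolding maxreg_bound_def by (meson order_trans)
    also have "\<dots> \<le> (M + 1) * wLp_norm 0 x \<kappa> p g" using N by (intro mult_right_mono) auto
    finally have "MR_norm j p \<kappa> 0 x v powr p \<le> ((M + 1) * wLp_norm 0 x \<kappa> p g) powr p"
      using p0 by (intro powr_mono2 MR_norm_nonneg) auto
    also have "\<dots> = (M + 1) powr p * wLp_norm 0 x \<kappa> p g powr p"
      using M_nonneg N by (simp add: powr_mult)
    also have "\<dots> \<le> (M + 1) powr p * (\<Gamma> * exp (\<nu> * \<beta> x))"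
    proof (intro mult_left_mono)
      have "wLp 0 x \<kappa> p g" using g x \<tau> by (intro wLp_subinterval[OF g]) auto
      from le[OF x] show "wLp_norm 0 x \<kappa> p g powr p \<le> \<Gamma> * exp (\<nu> * \<beta> x)"
        unfolding wLp_integral_eq_norm_powr[OF \<open>wLp 0 x \<kappa> p g\<close> p0(1)] using \<Gamma> by simp
    qed simp
    finally show ?thesis by (simp add: mult.assoc)
  qed
  from B_integral_le[OF v sol \<tau> \<delta> \<nu> \<mu> this t]
  have "wLp_integral 0 t \<kappa> p (\<lambda>x. B x (j (v x))) \<le> ennreal (?c * ((M + 1) powr p * \<Gamma>) * exp (\<nu> * \<beta> t))" .
  also have "?c * ((M + 1) powr p * \<Gamma>) * exp (\<nu> * \<beta> t) = ((M + 1) powr p * ?c) * (\<Gamma> * exp (\<nu> * \<beta> t))"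
    by (simp only: ac_simps)
  also have "ennreal \<dots> \<le> ennreal (2 powr (-p-1) * (\<Gamma> * exp (\<nu> * \<beta> t)))"
    using params \<Gamma> by (intro ennreal_leI mult_right_mono) auto
  finally show ?thesis by (simp only: mult.assoc)
qed

text \<open>\<open>v\<close> solves the problem for A with right-hand side g = f - B v, so it is
  enough to bound \<open>g\<close> by f. Absorption is carried out by iterating the contraction: any
  finite bound for \<open>g\<close> improves at each round, and in the limit only the contribution
  of f remains.\<close>

lemma a_priori_estimate:
  assumes f: "wLp 0 T \<kappa> p f" and v: "MR j p \<kappa> 0 \<tau> v"
    and sol: "strong_solution j (\<lambda>t x. A t x + B t (j x)) 0 \<tau> f 0 v" and \<tau>: "0 < \<tau>" "\<tau> \<le> T"
  shows "MR_norm j p \<kappa> 0 \<tau> v \<le> M * (2 powr (p+1) * exp (\<nu> * \<beta> T)) powr (1/p) * wLp_norm 0 \<tau> \<kappa> p f"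
proof -
  have p0: "0 < p" "0 \<le> p" using p by auto
  \<comment> \<open>Extended by zero beyond \<tau>, as the bound for A speaks of right-hand sides on
    (0,T).\<close>
  define g where "g t = (if t \<in> {0<..<\<tau>} then f t + (-1) *\<^sub>R B t (j (v t)) else 0)" for t
  have Bv: "wLp 0 \<tau> \<kappa> p (\<lambda>t. B t (j (v t)))" by (rule B_wLp[OF v sol \<tau>])
  have f\<tau>: "wLp 0 \<tau> \<kappa> p f" by (rule wLp_subinterval[OF f \<tau>(2)])
  have fB: "wLp 0 \<tau> \<kappa> p (\<lambda>t. f t + (-1) *\<^sub>R B t (j (v t)))"
    by (rule wLp_lincomb[OF f\<tau> Bv p0(2)])
  have g_int: "wLp_integral 0 t \<kappa> p g = wLp_integral 0 (min t \<tau>) \<kappa> p (\<lambda>t. f t + (-1) *\<^sub>R B t (j (v t)))" for t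
    unfolding wLp_integral_def g_def using p0 by (intro nn_integral_cong) (auto simp: indicator_def)
  have "strongly_measurable_on {0<..<T} g"
    unfolding g_def using fB by (intro strongly_measurable_on_extend_zero) (auto simp: wLp_def)
  then have g: "wLp 0 T \<kappa> p g"
    using fB \<tau> by (simp add: wLp_def g_int)
  have solA: "strong_solution j (\<lambda>t x. A t x) 0 \<tau> g 0 v"
  proof (rule strong_solution_perturb[OF sol])
    have "wLp 0 \<tau> 0 1 (\<lambda>t. (A t (v t) + B t (j (v t))) + (-1) *\<^sub>R B t (j (v t)))"
      using sol wLp_imp_wLp_0_1[OF Bv p \<kappa> \<tau>(1)] by (intro wLp_lincomb) (auto simp: strong_solution_def)
    then show "wLp 0 \<tau> 0 1 (\<lambda>t. A t (v t))" by simp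
    show "AE t in lebesgue_on {0<..<\<tau>}. f t - (A t (v t) + B t (j (v t))) = g t - A t (v t)"
      by (rule AE_I2) (simp add: g_def)
  qed
  define F where "F = wLp_norm 0 \<tau> \<kappa> p f powr p"
  have F: "wLp_integral 0 \<tau> \<kappa> p f = ennreal F" "0 \<le> F"
    using wLp_integral_eq_norm_powr[OF f\<tau> p0(1)] by (auto simp: F_def)
  \<comment> \<open>One round replaces \<Gamma> by 2^p F + \<Gamma>/2. The fixed point is 2^(p+1) F
    and the deviation from it halves each time; the added 1 keeps \<Gamma> positive.\<close>
  define \<Gamma> where "\<Gamma> n = 2 powr (p+1) * F + (wLp_norm 0 \<tau> \<kappa> p g powr p + 1) * (1/2) ^ n" for n :: nat
  have \<Gamma>: "0 < \<Gamma> n" for n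
    using F(2) by (simp add: \<Gamma>_def add_nonneg_pos)
  have e1: "1 \<le> exp (\<nu> * \<beta> t)" if "0 < t" "t \<le> \<tau>" for t
    using \<nu> \<beta>_nonneg[of t] that \<tau> by simp
  have iter: "wLp_integral 0 t \<kappa> p g \<le> ennreal (\<Gamma> n * exp (\<nu> * \<beta> t))" if "0 < t" "t \<le> \<tau>" for t n
    using that
  proof (induction n arbitrary: t)
    case 0
    have "wLp_integral 0 t \<kappa> p g \<le> wLp_integral 0 \<tau> \<kappa> p g"
      using 0 by (intro wLp_integral_mono_interval) auto
    also have "\<dots> = ennreal (wLp_norm 0 \<tau> \<kappa> p g powr p)"
      by (intro wLp_integral_eq_norm_powr wLp_subinterval[OF g] \<tau> p0)
    also have "\<dots> \<le> ennreal (\<Gamma> 0 * exp (\<nu> * \<beta> t))"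
    proof (rule ennreal_leI)
      have "wLp_norm 0 \<tau> \<kappa> p g powr p \<le> \<Gamma> 0 * 1" using F(2) by (simp add: \<Gamma>_def)
      also have "\<dots> \<le> \<Gamma> 0 * exp (\<nu> * \<beta> t)" using \<Gamma>[of 0] e1[OF 0] by (intro mult_left_mono) auto
      finally show "wLp_norm 0 \<tau> \<kappa> p g powr p \<le> \<Gamma> 0 * exp (\<nu> * \<beta> t)" .
    qed
    finally show ?case .
  next
    case (Suc n)
    have m: "strongly_measurable_on {0<..<t} f" "strongly_measurable_on {0<..<t} (\<lambda>t. B t (j (v t)))"
      using wLp_subinterval[OF f\<tau> Suc.prems(2)] wLp_subinterval[OF Bv Suc.prems(2)] by (auto simp: wLp_def)
    have "wLp_integral 0 t \<kappa> p g = wLp_integral 0 t \<kappa> p (\<lambda>t. f t + (-1) *\<^sub>R B t (j (v t)))"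
      using Suc.prems by (simp add: g_int)
    also have "\<dots> \<le> ennreal (2 powr p) * (wLp_integral 0 t \<kappa> p f + ennreal (\<bar>-1\<bar> powr p) * wLp_integral 0 t \<kappa> p (\<lambda>t. B t (j (v t))))"
      by (rule wLp_integral_lincomb_le[OF m p0(2)])
    also have "\<dots> \<le> ennreal (2 powr p) * (ennreal F + ennreal (2 powr (-p-1) * \<Gamma> n * exp (\<nu> * \<beta> t)))"
    proof (intro mult_left_mono add_mono)
      show "wLp_integral 0 t \<kappa> p f \<le> ennreal F"
        unfolding F(1)[symmetric] using Suc.prems by (intro wLp_integral_mono_interval) auto
      show "ennreal (\<bar>-1\<bar> powr p) * wLp_integral 0 t \<kappa> p (\<lambda>t. B t (j (v t))) \<le> ennreal (2 powr (-p-1) * \<Gamma> n * exp (\<nu> * \<beta> t))"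
        using contraction[OF g v solA \<tau> \<Gamma> Suc.IH Suc.prems] by simp
    qed auto
    also have "\<dots> = ennreal (2 powr p * F + (2 powr p * 2 powr (-p-1)) * \<Gamma> n * exp (\<nu> * \<beta> t))"
      using F(2) \<Gamma>[of n] by (simp add: distrib_left mult.assoc flip: ennreal_mult ennreal_plus)
    also have "2 powr p * 2 powr (-p-1) = (1/2::real)"
      by (simp add: powr_minus_divide flip: powr_add)
    also have "ennreal (2 powr p * F + 1/2 * \<Gamma> n * exp (\<nu> * \<beta> t)) \<le> ennreal (\<Gamma> (Suc n) * exp (\<nu> * \<beta> t))"
    proof (rule ennreal_leI)
      have "2 powr p * F * 1 \<le> 2 powr p * F * exp (\<nu> * \<beta> t)"
        using F(2) e1[OF Suc.prems] by (intro mult_left_mono) auto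
      moreover have "\<Gamma> (Suc n) = 2 powr p * F + 1/2 * \<Gamma> n"
        by (simp add: \<Gamma>_def powr_add algebra_simps)
      ultimately show "2 powr p * F + 1/2 * \<Gamma> n * exp (\<nu> * \<beta> t) \<le> \<Gamma> (Suc n) * exp (\<nu> * \<beta> t)"
        by (simp add: distrib_right)
    qed
    finally show ?case .
  qed
  define E where "E = exp (\<nu> * \<beta> \<tau>)"
  have "wLp 0 \<tau> \<kappa> p g" by (rule wLp_subinterval[OF g \<tau>(2)])
  note g\<tau> = wLp_integral_eq_norm_powr[OF this p0(1)]
  have "wLp_norm 0 \<tau> \<kappa> p g powr p \<le> \<Gamma> n * E" for n
    using iter[OF \<tau>(1) order_refl, of n] \<Gamma>[of n] unfolding g\<tau> E_def by simp
  \<comment> \<open>In the limit the a priori unknown norm of \<open>g\<close> drops out of the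
    right-hand side.\<close>
  moreover have "(\<lambda>n. \<Gamma> n * E) \<longlonglongrightarrow> (2 powr (p+1) * F + (wLp_norm 0 \<tau> \<kappa> p g powr p + 1) * 0) * E"
    unfolding \<Gamma>_def by (intro tendsto_intros LIMSEQ_power_zero) auto
  ultimately have "wLp_norm 0 \<tau> \<kappa> p g powr p \<le> (2 powr (p+1) * F + (wLp_norm 0 \<tau> \<kappa> p g powr p + 1) * 0) * E"
    by (intro LIMSEQ_le_const) auto
  also have "\<dots> = (2 powr (p+1) * E) * F" by simp
  also have "\<dots> \<le> (2 powr (p+1) * exp (\<nu> * \<beta> T)) * F"
    unfolding E_def using \<nu> \<tau> F(2) \<beta>(3)[of \<tau> T] by (intro mult_right_mono mult_left_mono) auto
  finally have "(wLp_norm 0 \<tau> \<kappa> p g powr p) powr (1/p) \<le> ((2 powr (p+1) * exp (\<nu> * \<beta> T)) * F) powr (1/p)"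
    using p0 by (intro powr_mono2) auto
  then have "wLp_norm 0 \<tau> \<kappa> p g \<le> (2 powr (p+1) * exp (\<nu> * \<beta> T)) powr (1/p) * wLp_norm 0 \<tau> \<kappa> p f"
    using p0 wLp_norm_nonneg[of 0 \<tau> \<kappa> p g] wLp_norm_nonneg[of 0 \<tau> \<kappa> p f]
    by (simp add: F_def powr_mult powr_powr)
  then have "M * wLp_norm 0 \<tau> \<kappa> p g \<le> M * ((2 powr (p+1) * exp (\<nu> * \<beta> T)) powr (1/p) * wLp_norm 0 \<tau> \<kappa> p f)"
    using M_nonneg by (intro mult_left_mono)
  moreover have "MR_norm j p \<kappa> 0 \<tau> v \<le> M * wLp_norm 0 \<tau> \<kappa> p g"
    using bound g \<tau> v solA unfolding maxreg_bound_def by blast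
  ultimately show ?thesis by (simp add: mult.assoc)
qed

text \<open>Neumann series for g = f - B u, where u solves the problem for A with right-hand side g.
  The terms decay like 2^(-(p+1)n) in p-th power, which is the decay that \<open>wLp_series\<close>
  asks for.\<close>

lemma solution_exists:
  assumes ex: "\<And>g. wLp 0 T \<kappa> p g \<Longrightarrow> \<exists>u. MR j p \<kappa> 0 T u \<and> strong_solution j (\<lambda>t x. A t x) 0 T g 0 u"
    and f: "wLp 0 T \<kappa> p f"
  shows "\<exists>u. MR j p \<kappa> 0 T u \<and> strong_solution j (\<lambda>t x. A t x + B t (j x)) 0 T f 0 u"
proof -
  have p0: "0 < p" "0 \<le> p" using p by auto
  \<comment> \<open>\<open>S\<close> is a choice of solutions and is not known to be linear;
    superposition is therefore applied to the solutions themselves.\<close>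
  obtain S where S: "\<And>g. wLp 0 T \<kappa> p g \<Longrightarrow> MR j p \<kappa> 0 T (S g)"
    "\<And>g. wLp 0 T \<kappa> p g \<Longrightarrow> strong_solution j (\<lambda>t x. A t x) 0 T g 0 (S g)"
    using ex by metis
  define gs where "gs = rec_nat f (\<lambda>n g t. - B t (j (S g t)))"
  have gs0: "gs 0 = f" and gsS: "gs (Suc n) = (\<lambda>t. - B t (j (S (gs n) t)))" for n
    by (auto simp: gs_def)
  define \<Gamma> where "\<Gamma> = wLp_norm 0 T \<kappa> p f powr p + 1"
  have \<Gamma>: "0 < \<Gamma>" by (simp add: \<Gamma>_def add_nonneg_pos)
  have e1: "1 \<le> exp (\<nu> * \<beta> t)" if "0 < t" "t \<le> T" for t
    using \<nu> \<beta>_nonneg[of t] that by simp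
  have neg: "wLp_integral 0 t \<kappa> p (\<lambda>t. - h t) = wLp_integral 0 t \<kappa> p h" for h :: "real \<Rightarrow> 'b" and t
    by (simp add: wLp_integral_def)
  have gs: "wLp 0 T \<kappa> p (gs n) \<and> (\<forall>t. 0 < t \<longrightarrow> t \<le> T \<longrightarrow>
      wLp_integral 0 t \<kappa> p (gs n) \<le> ennreal ((\<Gamma> * (2 powr (-p-1)) ^ n) * exp (\<nu> * \<beta> t)))" for n
  proof (induction n)
    case 0
    have "wLp_integral 0 t \<kappa> p f \<le> ennreal (\<Gamma> * exp (\<nu> * \<beta> t))" if t: "0 < t" "t \<le> T" for t
    proof -
      have "wLp_integral 0 t \<kappa> p f \<le> wLp_integral 0 T \<kappa> p f"
        using t by (intro wLp_integral_mono_interval) auto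
      also have "\<dots> = ennreal (wLp_norm 0 T \<kappa> p f powr p)" by (rule wLp_integral_eq_norm_powr[OF f p0(1)])
      also have "\<dots> \<le> ennreal (\<Gamma> * exp (\<nu> * \<beta> t))"
      proof (rule ennreal_leI)
        have "wLp_norm 0 T \<kappa> p f powr p \<le> \<Gamma> * 1" by (simp add: \<Gamma>_def)
        also have "\<dots> \<le> \<Gamma> * exp (\<nu> * \<beta> t)" using \<Gamma> e1[OF t] by (intro mult_left_mono) auto
        finally show "wLp_norm 0 T \<kappa> p f powr p \<le> \<Gamma> * exp (\<nu> * \<beta> t)" .
      qed
      finally show ?thesis .
    qed
    then show ?case using f by (simp add: gs0)
  next
    case (Suc n)
    then have g: "wLp 0 T \<kappa> p (gs n)" by blast
    have pos: "0 < \<Gamma> * (2 powr (-p-1)) ^ n" using \<Gamma> by simp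
    have "wLp 0 T \<kappa> p (\<lambda>t. 0 + (-1) *\<^sub>R B t (j (S (gs n) t)))"
      by (intro wLp_lincomb B_wLp[OF S(1)[OF g] S(2)[OF g] T order_refl] p0)
         (simp add: wLp_def wLp_integral_def strongly_measurable_on_const)
    moreover have "wLp_integral 0 t \<kappa> p (\<lambda>x. B x (j (S (gs n) x))) \<le> ennreal (2 powr (-p-1) * (\<Gamma> * (2 powr (-p-1)) ^ n) * exp (\<nu> * \<beta> t))"
      if t: "0 < t" "t \<le> T" for t
      using Suc by (intro contraction[OF g S(1)[OF g] S(2)[OF g] T order_refl pos _ t]) auto
    ultimately show ?case unfolding gsS neg by (simp add: ac_simps)
  qed
  have eT: "0 < exp (\<nu> * \<beta> T)" by simp
  obtain g where gm: "strongly_measurable_on {0<..<T} g"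
    and gN: "\<And>N. wLp_integral 0 T \<kappa> p (\<lambda>x. g x - (\<Sum>n<N. gs n x)) \<le> ennreal (2 powr p * (\<Gamma> * exp (\<nu> * \<beta> T)) * 2 * (1/2) ^ N)"
  proof (rule wLp_series[of T gs p "\<Gamma> * exp (\<nu> * \<beta> T)" \<kappa>])
    show "strongly_measurable_on {0<..<T} (gs n)" for n using gs[of n] by (simp add: wLp_def)
    show "wLp_integral 0 T \<kappa> p (gs n) \<le> ennreal (\<Gamma> * exp (\<nu> * \<beta> T) * (2 powr (-p-1)) ^ n)" for n
      using gs[of n] T by (simp add: ac_simps)
  qed (use p0 \<Gamma> in auto)
  define C where "C = 2 powr p * (\<Gamma> * exp (\<nu> * \<beta> T)) * 2"
  have C: "0 < C" using \<Gamma> by (simp add: C_def)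
  have g: "wLp 0 T \<kappa> p g"
    using gm gN[of 0] le_less_trans[OF _ ennreal_less_top] by (simp add: wLp_def)
  define u where "u = S g"
  have u: "MR j p \<kappa> 0 T u" "strong_solution j (\<lambda>t x. A t x) 0 T g 0 u" using S[OF g] by (auto simp: u_def)
  \<comment> \<open>Only finite sums of solutions are formed. The infinite series is summed on the
    side of the right-hand sides, and \<open>u\<close> is obtained by solving once for its
    sum.\<close>
  define U where "U N t = (\<Sum>n\<le>N. S (gs n) t)" for N t
  have U: "MR j p \<kappa> 0 T (U N) \<and> strong_solution j (\<lambda>t x. A t x) 0 T (\<lambda>t. \<Sum>n\<le>N. gs n t) 0 (U N)" for N
  proof (induction N)
    case 0
    show ?case using S[of "gs 0"] gs[of 0] by (simp add: U_def[abs_def])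
  next
    case (Suc N)
    have gS: "wLp 0 T \<kappa> p (gs (Suc N))" using gs by blast
    have eq: "U (Suc N) = (\<lambda>t. U N t + 1 *\<^sub>R S (gs (Suc N)) t)" by (simp add: U_def fun_eq_iff)
    have "strong_solution j (\<lambda>t x. A t x) 0 T (\<lambda>t. (\<Sum>n\<le>N. gs n t) + 1 *\<^sub>R gs (Suc N) t) (0 + 1 *\<^sub>R 0) (\<lambda>t. U N t + 1 *\<^sub>R S (gs (Suc N)) t)"
      using Suc S(2)[OF gS] by (intro strong_solution_lincomb) (auto simp: blinfun.add_right blinfun.scaleR_right)
    moreover have "MR j p \<kappa> 0 T (\<lambda>t. U N t + 1 *\<^sub>R S (gs (Suc N)) t)"
      using Suc S(1)[OF gS] p0 by (intro MR_lincomb) auto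
    ultimately show ?case unfolding eq by simp
  qed
  have B_diff: "B t (j (u t + (-1) *\<^sub>R U N t)) = B t (j (u t)) + (\<Sum>n\<le>N. gs (Suc n) t)" if t: "t \<in> {0<..<T}" for t N
  proof -
    have t': "t \<in> {0..T}" using t by auto
    have BU: "B t (j (U N t)) = - (\<Sum>n\<le>N. gs (Suc n) t)"
    proof (induction N)
      case 0
      show ?case by (simp add: U_def gsS)
    next
      case (Suc N)
      have "U (Suc N) t = U N t + 1 *\<^sub>R S (gs (Suc N)) t" by (simp add: U_def)
      then show ?case using Suc B_lincomb[OF t', of "U N t" 1] by (simp add: gsS)
    qed
    show ?thesis unfolding B_lincomb[OF t'] BU by simp
  qed
  \<comment> \<open>The residual of the fixed point equation is the tail of the series for
    \<open>g\<close> plus B applied to j (u - U N). Since u - U N solves the problem for A with a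
    tail of that series as right-hand side, \<open>contraction\<close> bounds the second part, and
    both parts vanish as N grows.\<close>
  have lim: "wLp_integral 0 T \<kappa> p (\<lambda>t. g t - f t + B t (j (u t))) \<le> ennreal (2 powr p * (2 * C) * exp (\<nu> * \<beta> T) * (1/2) ^ N)" for N
  proof -
    let ?G = "\<lambda>t. g t + (-1) *\<^sub>R (\<Sum>n\<le>N. gs n t)"
    let ?D = "\<lambda>t. u t + (-1) *\<^sub>R U N t"
    have sG: "wLp 0 T \<kappa> p (\<lambda>t. \<Sum>n\<le>N. gs n t)" for N
    proof (induction N)
      case (Suc N)
      then show ?case using wLp_lincomb[OF Suc, of "gs (Suc N)" 1] gs p0 by simp
    qed (use gs in simp)
    have GL: "wLp 0 T \<kappa> p ?G" by (rule wLp_lincomb[OF g sG p0(2)])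
    have D: "MR j p \<kappa> 0 T ?D" using u(1) U p0 by (intro MR_lincomb) auto
    have "strong_solution j (\<lambda>t x. A t x) 0 T ?G (0 + (-1) *\<^sub>R 0) ?D"
      using u(2) U by (intro strong_solution_lincomb) (auto simp: blinfun.diff_right)
    then have solD: "strong_solution j (\<lambda>t x. A t x) 0 T ?G 0 ?D" by simp
    have CN: "0 < C * (1/2) ^ N" using C by simp
    have IG: "wLp_integral 0 T \<kappa> p (\<lambda>t. g t - (\<Sum>n<K. gs n t)) \<le> ennreal (C * (1/2) ^ N)" if "N \<le> K" for K
    proof -
      have "(1/2::real) ^ K \<le> (1/2) ^ N" using that by (intro power_decreasing) auto
      then have "C * (1/2) ^ K \<le> C * (1/2) ^ N" using C by (intro mult_left_mono) auto
      then show ?thesis using gN[of K] unfolding C_def[symmetric] by (meson ennreal_leI order_trans)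
    qed
    have "wLp_integral 0 t \<kappa> p ?G \<le> ennreal (C * (1/2) ^ N * exp (\<nu> * \<beta> t))" if t: "0 < t" "t \<le> T" for t
    proof -
      have "wLp_integral 0 t \<kappa> p ?G \<le> wLp_integral 0 T \<kappa> p ?G"
        using t by (intro wLp_integral_mono_interval) auto
      also have "\<dots> \<le> ennreal (C * (1/2) ^ N)"
        using IG[of "Suc N"] by (simp add: lessThan_Suc_atMost)
      also have "\<dots> \<le> ennreal (C * (1/2) ^ N * exp (\<nu> * \<beta> t))"
        using mult_left_mono[OF e1[OF t], of "C * (1/2) ^ N"] CN by (intro ennreal_leI) simp
      finally show ?thesis .
    qed
    from contraction[OF GL D solD T order_refl CN this T order_refl]
    have "wLp_integral 0 T \<kappa> p (\<lambda>x. B x (j (?D x))) \<le> ennreal (2 powr (-p-1) * (C * (1/2) ^ N) * exp (\<nu> * \<beta> T))" .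
    also have "\<dots> \<le> ennreal (1 * (C * (1/2) ^ N) * exp (\<nu> * \<beta> T))"
    proof (intro ennreal_leI mult_right_mono)
      show "2 powr (-p-1) \<le> (1::real)" using powr_mono[of "-p-1" 0 "2::real"] p0 by simp
    qed (use C in auto)
    finally have IB: "wLp_integral 0 T \<kappa> p (\<lambda>x. B x (j (?D x))) \<le> ennreal (C * (1/2) ^ N * exp (\<nu> * \<beta> T))" by simp
    \<comment> \<open>The sum runs to N+1 because B applied to \<open>U N\<close> produces the terms
      1 to N+1 with opposite sign, and term 0 is f.\<close>
    let ?R = "\<lambda>t. g t + (-1) *\<^sub>R (\<Sum>n\<le>Suc N. gs n t)"
    have IR: "wLp_integral 0 T \<kappa> p ?R \<le> ennreal (C * (1/2) ^ N * exp (\<nu> * \<beta> T))"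
    proof -
      have "wLp_integral 0 T \<kappa> p ?R \<le> ennreal (C * (1/2) ^ N)"
        using IG[of "Suc (Suc N)"] by (simp add: lessThan_Suc_atMost del: sum.atMost_Suc sum.lessThan_Suc)
      also have "\<dots> \<le> ennreal (C * (1/2) ^ N * exp (\<nu> * \<beta> T))"
        using mult_left_mono[OF e1[OF T order_refl], of "C * (1/2) ^ N"] CN by (intro ennreal_leI) simp
      finally show ?thesis .
    qed
    have "AE t in lebesgue_on {0<..<T}. g t - f t + B t (j (u t)) = ?R t + 1 *\<^sub>R B t (j (?D t))"
    proof (rule AE_I2)
      fix t assume "t \<in> space (lebesgue_on {0<..<T})"
      then have t: "t \<in> {0<..<T}" by simp
      have "(\<Sum>n\<le>Suc N. gs n t) = f t + (\<Sum>n\<le>N. gs (Suc n) t)"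
        by (simp only: sum.atMost_Suc_shift gs0)
      then show "g t - f t + B t (j (u t)) = ?R t + 1 *\<^sub>R B t (j (?D t))"
        unfolding B_diff[OF t] by simp
    qed
    then have "wLp_integral 0 T \<kappa> p (\<lambda>t. g t - f t + B t (j (u t))) = wLp_integral 0 T \<kappa> p (\<lambda>t. ?R t + 1 *\<^sub>R B t (j (?D t)))"
      by (rule wLp_integral_cong_AE)
    also have "\<dots> \<le> ennreal (2 powr p) * (wLp_integral 0 T \<kappa> p ?R + ennreal (\<bar>1\<bar> powr p) * wLp_integral 0 T \<kappa> p (\<lambda>t. B t (j (?D t))))"
    proof (rule wLp_integral_lincomb_le[OF _ _ p0(2)])
      show "strongly_measurable_on {0<..<T} ?R" using wLp_lincomb[OF g sG p0(2), of "-1" "Suc N"] by (simp add: wLp_def)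
      show "strongly_measurable_on {0<..<T} (\<lambda>t. B t (j (?D t)))"
        using B_wLp[OF D solD T order_refl] by (simp add: wLp_def)
    qed
    also have "\<dots> \<le> ennreal (2 powr p) * (ennreal (C * (1/2) ^ N * exp (\<nu> * \<beta> T)) + ennreal (C * (1/2) ^ N * exp (\<nu> * \<beta> T)))"
      using IR IB by (intro mult_left_mono add_mono) auto
    also have "\<dots> = ennreal (2 powr p * (2 * (C * (1/2) ^ N * exp (\<nu> * \<beta> T))))"
    proof -
      have "ennreal (2 powr p) * (ennreal E + ennreal E) = ennreal (2 powr p * (2 * E))" if "0 \<le> E" for E
        using that by (simp add: ennreal_mult flip: mult_2)
      from this[of "C * (1/2) ^ N * exp (\<nu> * \<beta> T)"] show ?thesis using C by simp
    qed
    finally show ?thesis by (simp only: ac_simps)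
  qed
  have Bu: "wLp 0 T \<kappa> p (\<lambda>t. B t (j (u t)))" by (rule B_wLp[OF u T order_refl])
  have "(\<lambda>N. ennreal (2 powr p * (2 * C) * exp (\<nu> * \<beta> T) * (1/2) ^ N)) \<longlonglongrightarrow> ennreal (2 powr p * (2 * C) * exp (\<nu> * \<beta> T) * 0)"
    by (intro tendsto_ennrealI tendsto_mult tendsto_const LIMSEQ_power_zero) simp
  then have "wLp_integral 0 T \<kappa> p (\<lambda>t. g t - f t + B t (j (u t))) \<le> ennreal (2 powr p * (2 * C) * exp (\<nu> * \<beta> T) * 0)"
    by (rule LIMSEQ_le_const) (use lim in blast)
  then have zero: "wLp_integral 0 T \<kappa> p (\<lambda>t. g t - f t + B t (j (u t))) = 0" by simp
  have "wLp 0 T \<kappa> p (\<lambda>t. (g t + (-1) *\<^sub>R f t) + 1 *\<^sub>R B t (j (u t)))"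
    by (intro wLp_lincomb g f Bu p0)
  then have "AE t in lebesgue_on {0<..<T}. g t - f t + B t (j (u t)) = 0"
    using zero p0 by (intro wLp_integral_eq_0_imp_AE) auto
  then have eq: "AE t in lebesgue_on {0<..<T}. g t - A t (u t) = f t - (A t (u t) + B t (j (u t)))"
    by eventually_elim (simp add: algebra_simps add_eq_0_iff)
  have "wLp 0 T 0 1 (\<lambda>t. A t (u t) + 1 *\<^sub>R B t (j (u t)))"
    using u(2) wLp_imp_wLp_0_1[OF Bu p \<kappa> T] by (intro wLp_lincomb) (auto simp: strong_solution_def)
  then have "strong_solution j (\<lambda>t x. A t x + B t (j x)) 0 T f 0 u"
    using strong_solution_perturb[OF u(2), of "\<lambda>t x. A t x + B t (j x)" f] eq by simp
  then show ?thesis using u(1) by blast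
qed

end

theorem theorem2p5:
  fixes j :: "'a::banach \<Rightarrow>\<^sub>L 'b::banach" and p q \<kappa> :: real
  assumes j_inj: "inj (blinfun_apply j)"
    and j_dense: "closure (range (blinfun_apply j)) = UNIV"
    and p: "1 < p" and \<kappa>: "0 \<le> \<kappa>" "\<kappa> < p - 1" and q: "p < q"
  shows "\<exists>Cf :: real \<Rightarrow> real \<Rightarrow> real.
    \<forall>(T::real) (A :: real \<Rightarrow> ('a \<Rightarrow>\<^sub>L 'b)) (B :: real \<Rightarrow> 'b \<Rightarrow> 'b) (b :: real \<Rightarrow> real) (C_A::real).
      0 < T \<and>
      (\<forall>x. strongly_measurable_on {0..T} (\<lambda>t. A t x)) \<and>
      (\<forall>v. MR j p \<kappa> 0 T v \<longrightarrow>
         wLp 0 T \<kappa> p (\<lambda>t. A t (v t)) \<and>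
         wLp_norm 0 T \<kappa> p (\<lambda>t. A t (v t)) \<le> C_A * MR_norm j p \<kappa> 0 T v) \<and>
      has_maxreg j (\<lambda>t x. A t x) p \<kappa> 0 T \<and>
      (\<forall>x \<in> interp_space j (1 - 1/q) 1. strongly_measurable_on {0..T} (\<lambda>t. B t x)) \<and>
      (\<forall>t \<in> {0..T}. \<forall>x \<in> interp_space j (1 - 1/q) 1. \<forall>y \<in> interp_space j (1 - 1/q) 1. \<forall>c.
         B t (x + y) = B t x + B t y \<and> B t (c *\<^sub>R x) = c *\<^sub>R B t x) \<and>
      (\<forall>t \<in> {0..T}. \<forall>x \<in> interp_space j (1 - 1/q) 1.
         norm (B t x) \<le> b t * interp_norm j (1 - 1/q) 1 x) \<and>
      wLp 0 T 0 q b
      \<longrightarrow> has_maxreg j (\<lambda>t x. A t x + B t (j x)) p \<kappa> 0 T \<and>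
          maxreg_const j (\<lambda>t x. A t x + B t (j x)) p \<kappa> 0 T
            \<le> Cf (maxreg_const j (\<lambda>t x. A t x) p \<kappa> 0 T) (wLp_norm 0 T 0 q b)"
proof -
  \<comment> \<open>Chosen as a function of M alone, before T, A, B and b are introduced. Only the
    existence of \<delta> is recorded, as \<delta> does not enter the constant.\<close>
  define nu where "nu M = (SOME \<nu>. 0 < \<nu> \<and> (\<exists>\<delta>>0. (M + 1) powr p *
      (2 powr p * (q * \<delta>) powr p + 2 powr (2*p+2) * trace_const p q \<kappa> \<delta> powr p / \<nu>) \<le> 2 powr (-p-1)))" for M
  have nu: "0 < nu M \<and> (\<exists>\<delta>>0. (M + 1) powr p *
      (2 powr p * (q * \<delta>) powr p + 2 powr (2*p+2) * trace_const p q \<kappa> \<delta> powr p / nu M) \<le> 2 powr (-p-1))"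
    if "0 \<le> M" for M
    unfolding nu_def using contraction_params[OF p q that] by (rule someI_ex)
  \<comment> \<open>The constant of \<open>a_priori_estimate\<close> with \<beta> T replaced by N^q,
    where N is the norm of b.\<close>
  define Cf where "Cf M N = M * (2 powr (p+1) * exp (nu M * N powr q)) powr (1/p)" for M N
  show ?thesis
  proof (intro exI[of _ Cf] allI impI, elim conjE)
    fix T C_A :: real and A :: "real \<Rightarrow> ('a \<Rightarrow>\<^sub>L 'b)" and B :: "real \<Rightarrow> 'b \<Rightarrow> 'b" and b :: "real \<Rightarrow> real"
    assume T: "0 < T" and maxreg: "has_maxreg j (\<lambda>t x. A t x) p \<kappa> 0 T"
      and B_measurable: "\<forall>x \<in> interp_space j (1 - 1/q) 1. strongly_measurable_on {0..T} (\<lambda>t. B t x)"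
      and B_linear: "\<forall>t \<in> {0..T}. \<forall>x \<in> interp_space j (1 - 1/q) 1. \<forall>y \<in> interp_space j (1 - 1/q) 1. \<forall>c.
         B t (x + y) = B t x + B t y \<and> B t (c *\<^sub>R x) = c *\<^sub>R B t x"
      and B_bound: "\<forall>t \<in> {0..T}. \<forall>x \<in> interp_space j (1 - 1/q) 1.
         norm (B t x) \<le> b t * interp_norm j (1 - 1/q) 1 x"
      and b: "wLp 0 T 0 q b"
    let ?A = "\<lambda>t. blinfun_apply (A t)" and ?AB = "\<lambda>t x. A t x + B t (j x)"
    define M where "M = maxreg_const j ?A p \<kappa> 0 T"
    have bound: "maxreg_bound j ?A p \<kappa> 0 T M"
      using maxreg maxreg_bound_const unfolding has_maxreg_def M_def by blast
    then have M: "0 \<le> M" by (simp add: maxreg_bound_def)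
    obtain \<delta> where \<delta>: "0 < \<delta>" "(M + 1) powr p *
      (2 powr p * (q * \<delta>) powr p + 2 powr (2*p+2) * trace_const p q \<kappa> \<delta> powr p / nu M) \<le> 2 powr (-p-1)"
      using nu[OF M] by blast
    have p0: "0 < p" "0 \<le> p" and q0: "0 < q" using p q by auto
    obtain \<beta> where primitive: "continuous_on {0..T} \<beta>" "\<beta> 0 = 0" "\<beta> T = wLp_norm 0 T 0 q b powr q"
      "\<And>s t. 0 \<le> s \<Longrightarrow> s \<le> t \<Longrightarrow> t \<le> T \<Longrightarrow> \<beta> s \<le> \<beta> t"
      "\<And>s t. 0 \<le> s \<Longrightarrow> s \<le> t \<Longrightarrow> t \<le> T \<Longrightarrow>
        (\<integral>\<^sup>+x. ennreal (\<bar>b x\<bar> powr q) * indicator {s<..<t} x \<partial>lebesgue) = ennreal (\<beta> t - \<beta> s)"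
      by (rule wLp_primitive[OF b q0 T], rule that)
    interpret maxreg_perturbation j p q \<kappa> T B b \<beta> A M "nu M" \<delta>
      by unfold_locales
         (use p \<kappa> q T B_measurable B_linear B_bound b primitive bound nu[OF M] \<delta> in \<open>blast+\<close>)
    let ?C = "Cf M (wLp_norm 0 T 0 q b)"
    have bound_AB: "maxreg_bound j ?AB p \<kappa> 0 T ?C"
      unfolding maxreg_bound_def
    proof (intro conjI allI impI)
      show "0 \<le> ?C" using M by (simp add: Cf_def)
      show "MR_norm j p \<kappa> 0 \<tau> v \<le> ?C * wLp_norm 0 \<tau> \<kappa> p f"
        if "wLp 0 T \<kappa> p f \<and> 0 < \<tau> \<and> \<tau> \<le> T \<and> MR j p \<kappa> 0 \<tau> v \<and> strong_solution j ?AB 0 \<tau> f 0 v" for f \<tau> v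
        using that a_priori_estimate[of f \<tau> v] unfolding Cf_def primitive(3) by blast
    qed
    have existence: "\<exists>u. MR j p \<kappa> 0 T u \<and> strong_solution j ?AB 0 T f 0 u" if "wLp 0 T \<kappa> p f" for f
      using maxreg that unfolding has_maxreg_def by (intro solution_exists) blast+
    \<comment> \<open>The difference of two solutions has right-hand side 0, so the bound just
      obtained for A + B makes its norm vanish.\<close>
    have uniqueness: "AE t in lebesgue_on {0<..<T}. u t = v t"
      if u: "MR j p \<kappa> 0 T u" "strong_solution j ?AB 0 T f 0 u"
        and v: "MR j p \<kappa> 0 T v" "strong_solution j ?AB 0 T f 0 v" for f u v
    proof -
      let ?d = "\<lambda>t. u t + (-1) *\<^sub>R v t"
      have d: "MR j p \<kappa> 0 T ?d" by (rule MR_lincomb[OF u(1) v(1) p0(2)])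
      have "strong_solution j ?AB 0 T (\<lambda>t. f t + (-1) *\<^sub>R f t) (0 + (-1) *\<^sub>R 0) ?d"
      proof (rule strong_solution_lincomb[OF u(2) v(2)])
        fix t x y assume "0 < t" "t < T"
        then have "t \<in> {0..T}" by simp
        then show "?AB t (x + (-1) *\<^sub>R y) = ?AB t x + (-1) *\<^sub>R ?AB t y"
          using B_lincomb[of t x "-1" y] by (simp add: blinfun.diff_right)
      qed
      then have "strong_solution j ?AB 0 T (\<lambda>t. 0) 0 ?d" by simp
      moreover have "wLp 0 T \<kappa> p (\<lambda>t. 0 :: 'b)"
        by (simp add: wLp_def wLp_integral_def strongly_measurable_on_const)
      ultimately have "MR_norm j p \<kappa> 0 T ?d \<le> ?C * wLp_norm 0 T \<kappa> p (\<lambda>t. 0 :: 'b)"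
        using bound_AB d T unfolding maxreg_bound_def by blast
      also have "wLp_norm 0 T \<kappa> p (\<lambda>t. 0 :: 'b) = 0"
        by (simp add: wLp_norm_def wLp_integral_def)
      finally have "wLp_norm 0 T \<kappa> p ?d \<le> 0" unfolding MR_norm_def by simp
      then have "wLp_norm 0 T \<kappa> p ?d = 0" using wLp_norm_nonneg by (rule order_antisym)
      moreover have wd: "wLp 0 T \<kappa> p ?d" using d by (simp add: MR_def)
      ultimately have "wLp_integral 0 T \<kappa> p ?d = 0"
        using wLp_integral_eq_norm_powr[OF wd p0(1)] p0(1) by (simp only: powr_0 ennreal_0)
      from wLp_integral_eq_0_imp_AE[OF wd this p0(1)] have "AE t in lebesgue_on {0<..<T}. ?d t = 0" .
      then show ?thesis by simp
    qed
    have "has_maxreg j ?AB p \<kappa> 0 T"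
      unfolding has_maxreg_def using existence uniqueness bound_AB by blast
    moreover have "maxreg_const j ?AB p \<kappa> 0 T \<le> Cf (maxreg_const j ?A p \<kappa> 0 T) (wLp_norm 0 T 0 q b)"
      using maxreg_const_le[OF bound_AB] by (simp add: M_def)
    ultimately show "has_maxreg j ?AB p \<kappa> 0 T \<and>
        maxreg_const j ?AB p \<kappa> 0 T \<le> Cf (maxreg_const j ?A p \<kappa> 0 T) (wLp_norm 0 T 0 q b)"
      by blast
  qed
qed

end
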